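(* Let $\Omega\subset\mathbb{R}^n$ be an open bounded set with Lipschitz boundary, let $u_a,u_b\in\mathbb{R}$ with $u_a<u_b$, and let $U_{ad}:=\{u\in L^2(\Omega): u_a\le u(x)\le u_b \text{ for a.a. } x\in\Omega\}$. Let $f:L^2(\Omega)\to\mathbb{R}$ be bounded from below, weakly lower semicontinuous and continuously Fréchet differentiable, and such that $f(u_k)\to+\infty$ for every sequence $(u_k)\subset U_{ad}$ with $\|u_k\|_{L^2(\Omega)}\to\infty$. Let $\bar u\in U_{ad}\cap BV(\Omega)$ be locally optimal for $$\min_{u\in U_{ad}\cap BV(\Omega)} J(u):=f(u)+|u|_{BV(\Omega)},$$ i.e., there is $r>0$ such that $J(\bar u)\le J(u)$ for all $u\in U_{ad}\cap BV(\Omega)$ with $\|u-\bar u\|_{BV(\Omega)}+\|u-\bar u\|_{L^2(\Omega)}<r$. Then there are $\lambda^*\in\partial\|\cdot\|_{\mathcal M(\Omega)}(\nabla\bar u)\subset(\mathcal M(\Omega)^n)^*$ with $\operatorname{div}\lambda^*\in L^2(\Omega)$ and functions $\lambda^a,\lambda^b\in L^2(\Omega)$ such that $$-\operatorname{div}\lambda^*-\lambda^a+\lambda^b=-\nabla f(\bar u)$$ and $$\lambda^a\ge0,\quad \lambda^b\ge0,\quad (\lambda^a,u_a-\bar u)=0,\quad(\lambda^b,\bar u-u_b)=0.$$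
   Context: $|u|_{BV(\Omega)}:=\sup\{\int_\Omega u\operatorname{div}\varphi\,dx:\varphi\in C_0^\infty(\Omega)^n,\ |\varphi(x)|\le1\ \forall x\in\Omega\}=\|\nabla u\|_{\mathcal M(\Omega)^n}$, where $|\cdot|$ is the Euclidean norm on $\mathbb{R}^n$ and $\mathcal M(\Omega)=C_0(\Omega)^*$ is the space of real Borel measures; $\|u\|_{BV(\Omega)}=\|u\|_{L^1(\Omega)}+|u|_{BV(\Omega)}$. The norm $\|\cdot\|_{\mathcal M(\Omega)}$ on $\mathcal M(\Omega)^n$ (also written $\|\cdot\|_{\mathcal M(\Omega)^n}$) is the total variation norm with respect to the Euclidean norm, so that $|u|_{BV(\Omega)}=\|\nabla u\|_{\mathcal M(\Omega)}$ for all $u\in BV(\Omega)$, and $\partial$ denotes the convex subdifferential. The operator $-\operatorname{div}:(\mathcal M(\Omega)^n)^*\to(BV(\Omega)\cap L^2(\Omega))^*$ is the adjoint of $\nabla:BV(\Omega)\cap L^2(\Omega)\to\mathcal M(\Omega)^n$, i.e. $\langle\operatorname{div}\lambda,u\rangle=-\langle\lambda,\nabla u\rangle$; "$\operatorname{div}\lambda^*\in L^2(\Omega)$" means that this functional is given by integration against an $L^2(\Omega)$ function, with which it is identified. $\nabla f(u)\in L^2(\Omega)$ is the Riesz representative of $f'(u)$. $(\cdot,\cdot)$ is the $L^2(\Omega)$ inner product. *)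

theory Defs
  imports "HOL-Analysis.Analysis"
begin

text \<open>
  Functions on \<open>\<Omega> \<subseteq> \<real>\<^sup>n\<close> are total functions on \<open>real ^ 'n\<close>. Elements of Lebesgue spaces are
  represented by functions whose values off \<open>\<Omega>\<close> are irrelevant and which are identified if they
  agree almost everywhere with respect to \<open>lebesgue_on \<Omega>\<close>.
\<close>

type_synonym 'n fn = "real ^ 'n \<Rightarrow> real"


section \<open>Domains\<close>

text \<open>
  Near every boundary point, after a rotation that turns \<open>e\<close> into the last coordinate direction, the
  set is the strict epigraph of a Lipschitz function of the remaining coordinates, i.e. of the
  orthogonal projection \<open>y - (y \<bullet> e) *\<^sub>R e\<close> onto the hyperplane \<open>e\<^sup>\<bottom>\<close>.
\<close>

definition lipschitz_boundary :: "(real ^ 'n) set \<Rightarrow> bool" where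
  "lipschitz_boundary \<Omega> \<longleftrightarrow>
     (\<forall>x \<in> frontier \<Omega>. \<exists>r > 0. \<exists>e. norm e = 1 \<and>
        (\<exists>\<gamma> L. L-lipschitz_on {z. z \<bullet> e = 0} \<gamma> \<and>
          \<Omega> \<inter> ball x r = {y \<in> ball x r. y \<bullet> e > (\<gamma> (y - (y \<bullet> e) *\<^sub>R e) :: real)}))"


section \<open>Test functions\<close>

abbreviation partial_deriv :: "'n \<Rightarrow> (real ^ 'n \<Rightarrow> 'b) \<Rightarrow> real ^ 'n \<Rightarrow> 'b::real_normed_vector" where
  "partial_deriv i \<phi> x \<equiv> frechet_derivative \<phi> (at x) (axis i 1)"

primrec Ck :: "nat \<Rightarrow> (real ^ 'n \<Rightarrow> 'b::real_normed_vector) \<Rightarrow> bool" where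
  "Ck 0 \<phi> \<longleftrightarrow> continuous_on UNIV \<phi>"
| "Ck (Suc k) \<phi> \<longleftrightarrow> (\<forall>x. \<phi> differentiable (at x)) \<and> (\<forall>i. Ck k (partial_deriv i \<phi>))"

text \<open>Smooth functions with compact support in \<open>\<Omega>\<close>, extended by zero to the whole space.\<close>

definition test_functions :: "(real ^ 'n) set \<Rightarrow> (real ^ 'n \<Rightarrow> 'b::real_normed_vector) set" where
  "test_functions \<Omega> =
     {\<phi>. (\<forall>k. Ck k \<phi>) \<and> compact (closure {x. \<phi> x \<noteq> 0}) \<and> closure {x. \<phi> x \<noteq> 0} \<subseteq> \<Omega>}"

definition divergence :: "(real ^ 'n \<Rightarrow> real ^ 'n) \<Rightarrow> 'n fn" where
  "divergence \<phi> x = (\<Sum>i\<in>UNIV. partial_deriv i \<phi> x $ i)"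


section \<open>The space \<open>L\<^sup>2(\<Omega>)\<close> and functionals on it\<close>

definition L2 :: "(real ^ 'n) set \<Rightarrow> 'n fn set" where
  "L2 \<Omega> = {u. u \<in> borel_measurable (lebesgue_on \<Omega>) \<and> integrable (lebesgue_on \<Omega>) (\<lambda>x. (u x)\<^sup>2)}"

definition L2_inner :: "(real ^ 'n) set \<Rightarrow> 'n fn \<Rightarrow> 'n fn \<Rightarrow> real" where
  "L2_inner \<Omega> u v = (LINT x|lebesgue_on \<Omega>. u x * v x)"

definition L2_norm :: "(real ^ 'n) set \<Rightarrow> 'n fn \<Rightarrow> real" where
  "L2_norm \<Omega> u = sqrt (LINT x|lebesgue_on \<Omega>. (u x)\<^sup>2)"

definition bounded_linear_functional :: "('a \<Rightarrow> real) set \<Rightarrow> (('a \<Rightarrow> real) \<Rightarrow> real)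
    \<Rightarrow> (('a \<Rightarrow> real) \<Rightarrow> real) \<Rightarrow> bool" where
  "bounded_linear_functional V N D \<longleftrightarrow>
     (\<forall>u\<in>V. \<forall>v\<in>V. D (\<lambda>x. u x + v x) = D u + D v) \<and>
     (\<forall>u\<in>V. \<forall>c. D (\<lambda>x. c * u x) = c * D u) \<and>
     (\<exists>C. \<forall>u\<in>V. \<bar>D u\<bar> \<le> C * N u)"

text \<open>\<open>f\<close> is a function of equivalence classes.\<close>

definition L2_well_defined :: "(real ^ 'n) set \<Rightarrow> ('n fn \<Rightarrow> real) \<Rightarrow> bool" where
  "L2_well_defined \<Omega> f \<longleftrightarrow>
     (\<forall>u\<in>L2 \<Omega>. \<forall>v\<in>L2 \<Omega>. (AE x in lebesgue_on \<Omega>. u x = v x) \<longrightarrow> f u = f v)"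

definition L2_bounded_below :: "(real ^ 'n) set \<Rightarrow> ('n fn \<Rightarrow> real) \<Rightarrow> bool" where
  "L2_bounded_below \<Omega> f \<longleftrightarrow> (\<exists>c. \<forall>u\<in>L2 \<Omega>. c \<le> f u)"

definition L2_weakly_converges :: "(real ^ 'n) set \<Rightarrow> (nat \<Rightarrow> 'n fn) \<Rightarrow> 'n fn \<Rightarrow> bool" where
  "L2_weakly_converges \<Omega> U u \<longleftrightarrow>
     (\<forall>k. U k \<in> L2 \<Omega>) \<and> u \<in> L2 \<Omega> \<and>
     (\<forall>v\<in>L2 \<Omega>. (\<lambda>k. L2_inner \<Omega> (U k) v) \<longlonglongrightarrow> L2_inner \<Omega> u v)"

text \<open>Sequential weak lower semicontinuity.\<close>

definition L2_weakly_lsc :: "(real ^ 'n) set \<Rightarrow> ('n fn \<Rightarrow> real) \<Rightarrow> bool" where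
  "L2_weakly_lsc \<Omega> f \<longleftrightarrow>
     (\<forall>U u. L2_weakly_converges \<Omega> U u \<longrightarrow> ereal (f u) \<le> liminf (\<lambda>k. ereal (f (U k))))"

definition L2_has_derivative ::
    "(real ^ 'n) set \<Rightarrow> ('n fn \<Rightarrow> real) \<Rightarrow> ('n fn \<Rightarrow> real) \<Rightarrow> 'n fn \<Rightarrow> bool" where
  "L2_has_derivative \<Omega> f D u \<longleftrightarrow>
     bounded_linear_functional (L2 \<Omega>) (L2_norm \<Omega>) D \<and>
     (\<forall>\<epsilon>>0. \<exists>\<delta>>0. \<forall>h\<in>L2 \<Omega>. L2_norm \<Omega> h < \<delta> \<longrightarrow>
        \<bar>f (\<lambda>x. u x + h x) - f u - D h\<bar> \<le> \<epsilon> * L2_norm \<Omega> h)"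

definition L2_continuously_differentiable :: "(real ^ 'n) set \<Rightarrow> ('n fn \<Rightarrow> real) \<Rightarrow> bool" where
  "L2_continuously_differentiable \<Omega> f \<longleftrightarrow>
     (\<exists>Df. (\<forall>u\<in>L2 \<Omega>. L2_has_derivative \<Omega> f (Df u) u) \<and>
       (\<forall>u\<in>L2 \<Omega>. \<forall>\<epsilon>>0. \<exists>\<delta>>0. \<forall>v\<in>L2 \<Omega>. L2_norm \<Omega> (\<lambda>x. v x - u x) < \<delta> \<longrightarrow>
          (\<forall>h\<in>L2 \<Omega>. \<bar>Df v h - Df u h\<bar> \<le> \<epsilon> * L2_norm \<Omega> h)))"

text \<open>The Riesz representative of \<open>f'(u)\<close>; it is determined up to equality almost everywhere.\<close>

definition L2_gradient :: "(real ^ 'n) set \<Rightarrow> ('n fn \<Rightarrow> real) \<Rightarrow> 'n fn \<Rightarrow> 'n fn" where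
  "L2_gradient \<Omega> f u = (SOME g. g \<in> L2 \<Omega> \<and> L2_has_derivative \<Omega> f (L2_inner \<Omega> g) u)"


section \<open>The spaces \<open>M(\<Omega>) = C\<^sub>0(\<Omega>)\<^sup>*\<close> and \<open>M(\<Omega>)\<^sup>n\<close>\<close>

text \<open>
  The continuous functions on \<open>\<Omega>\<close> that become arbitrarily small outside compact subsets of \<open>\<Omega>\<close>. They
  are extended by zero, so that equality as functions on the whole space is equality on \<open>\<Omega>\<close>.
\<close>

definition C0 :: "(real ^ 'n) set \<Rightarrow> 'n fn set" where
  "C0 \<Omega> = {\<phi>. continuous_on \<Omega> \<phi> \<and> (\<forall>x. x \<notin> \<Omega> \<longrightarrow> \<phi> x = 0) \<and>
            (\<forall>\<epsilon>>0. compact {x \<in> \<Omega>. \<epsilon> \<le> \<bar>\<phi> x\<bar>})}"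

definition C0_norm :: "'n fn \<Rightarrow> real" where
  "C0_norm \<phi> = (SUP x. \<bar>\<phi> x\<bar>)"

text \<open>
  A real Borel measure is the functional \<open>\<phi> \<mapsto> \<integral>\<phi> d\<mu>\<close> on \<open>C\<^sub>0(\<Omega>)\<close>. Setting the functional to zero off
  \<open>C\<^sub>0(\<Omega>)\<close> makes equality of elements of \<open>M(\<Omega>)\<close> the equality of HOL.
\<close>

definition real_measures :: "(real ^ 'n) set \<Rightarrow> ('n fn \<Rightarrow> real) set" where
  "real_measures \<Omega> = {m. bounded_linear_functional (C0 \<Omega>) C0_norm m \<and> (\<forall>\<phi>. \<phi> \<notin> C0 \<Omega> \<longrightarrow> m \<phi> = 0)}"

type_synonym 'n vmeas = "'n \<Rightarrow> 'n fn \<Rightarrow> real"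

definition vector_measures :: "(real ^ 'n) set \<Rightarrow> 'n vmeas set" where
  "vector_measures \<Omega> = {\<mu>. \<forall>i. \<mu> i \<in> real_measures \<Omega>}"

text \<open>
  The total variation norm \<open>sup {\<integral>\<phi> \<cdot> d\<mu> : \<phi> \<in> C\<^sub>0(\<Omega>)\<^sup>n, |\<phi>(x)| \<le> 1}\<close> with respect to the Euclidean norm.
\<close>

definition total_variation :: "(real ^ 'n) set \<Rightarrow> 'n vmeas \<Rightarrow> real" where
  "total_variation \<Omega> \<mu> =
     Sup {(\<Sum>i\<in>UNIV. \<mu> i (\<lambda>x. \<phi> x $ i)) | \<phi> :: real ^ 'n \<Rightarrow> real ^ 'n.
            (\<forall>i. (\<lambda>x. \<phi> x $ i) \<in> C0 \<Omega>) \<and> (\<forall>x\<in>\<Omega>. norm (\<phi> x) \<le> 1)}"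

text \<open>
  The dual of \<open>M(\<Omega>)\<^sup>n\<close>; only the values of \<open>l\<close> on \<open>vector_measures \<Omega>\<close> are relevant.
\<close>

definition vector_measures_dual :: "(real ^ 'n) set \<Rightarrow> ('n vmeas \<Rightarrow> real) set" where
  "vector_measures_dual \<Omega> = {l.
     (\<forall>\<mu>\<in>vector_measures \<Omega>. \<forall>\<nu>\<in>vector_measures \<Omega>. l (\<lambda>i \<phi>. \<mu> i \<phi> + \<nu> i \<phi>) = l \<mu> + l \<nu>) \<and>
     (\<forall>\<mu>\<in>vector_measures \<Omega>. \<forall>c. l (\<lambda>i \<phi>. c * \<mu> i \<phi>) = c * l \<mu>) \<and>
     (\<exists>C. \<forall>\<mu>\<in>vector_measures \<Omega>. \<bar>l \<mu>\<bar> \<le> C * total_variation \<Omega> \<mu>)}"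

definition subdifferential ::
    "(real ^ 'n) set \<Rightarrow> ('n vmeas \<Rightarrow> real) \<Rightarrow> 'n vmeas \<Rightarrow> ('n vmeas \<Rightarrow> real) set" where
  "subdifferential \<Omega> F \<mu> =
     {l \<in> vector_measures_dual \<Omega>. \<forall>\<nu>\<in>vector_measures \<Omega>. F \<nu> \<ge> F \<mu> + l (\<lambda>i \<phi>. \<nu> i \<phi> - \<mu> i \<phi>)}"


section \<open>Functions of bounded variation\<close>

definition BV_values :: "(real ^ 'n) set \<Rightarrow> 'n fn \<Rightarrow> real set" where
  "BV_values \<Omega> u = {(LINT x|lebesgue_on \<Omega>. u x * divergence \<phi> x) | \<phi>.
                      \<phi> \<in> test_functions \<Omega> \<and> (\<forall>x\<in>\<Omega>. norm (\<phi> x) \<le> 1)}"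

definition BV_seminorm :: "(real ^ 'n) set \<Rightarrow> 'n fn \<Rightarrow> real" where
  "BV_seminorm \<Omega> u = Sup (BV_values \<Omega> u)"

text \<open>The supremum is finite exactly if \<open>BV_values \<Omega> u\<close> is bounded above.\<close>

definition BV :: "(real ^ 'n) set \<Rightarrow> 'n fn set" where
  "BV \<Omega> = {u. integrable (lebesgue_on \<Omega>) u \<and> bdd_above (BV_values \<Omega> u)}"

definition BV_norm :: "(real ^ 'n) set \<Rightarrow> 'n fn \<Rightarrow> real" where
  "BV_norm \<Omega> u = (LINT x|lebesgue_on \<Omega>. \<bar>u x\<bar>) + BV_seminorm \<Omega> u"

text \<open>
  The distributional gradient, for \<open>u\<close> in \<open>BV \<Omega>\<close>. It exists and is unique because the test functions
  are dense in \<open>C\<^sub>0(\<Omega>)\<close>.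
\<close>

definition BV_gradient :: "(real ^ 'n) set \<Rightarrow> 'n fn \<Rightarrow> 'n vmeas" where
  "BV_gradient \<Omega> u = (THE \<mu>. \<mu> \<in> vector_measures \<Omega> \<and>
     (\<forall>i. \<forall>\<psi>\<in>test_functions \<Omega>.
        \<mu> i \<psi> = - (LINT x|lebesgue_on \<Omega>. u x * partial_deriv i \<psi> x)))"

text \<open>
  For \<open>l\<close> in the dual of \<open>M(\<Omega>)\<^sup>n\<close>, the functional \<open>div l\<close> on \<open>BV(\<Omega>) \<inter> L\<^sup>2(\<Omega>)\<close>, and its identification
  with a function \<open>d\<close> in \<open>L\<^sup>2(\<Omega>)\<close>.
\<close>

definition dual_div :: "(real ^ 'n) set \<Rightarrow> ('n vmeas \<Rightarrow> real) \<Rightarrow> 'n fn \<Rightarrow> real" where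
  "dual_div \<Omega> l u = - l (BV_gradient \<Omega> u)"

definition dual_div_is :: "(real ^ 'n) set \<Rightarrow> ('n vmeas \<Rightarrow> real) \<Rightarrow> 'n fn \<Rightarrow> bool" where
  "dual_div_is \<Omega> l d \<longleftrightarrow>
     d \<in> L2 \<Omega> \<and> (\<forall>u \<in> BV \<Omega> \<inter> L2 \<Omega>. dual_div \<Omega> l u = L2_inner \<Omega> d u)"


section \<open>The optimization problem\<close>

definition U_ad :: "(real ^ 'n) set \<Rightarrow> real \<Rightarrow> real \<Rightarrow> 'n fn set" where
  "U_ad \<Omega> ua ub = {u \<in> L2 \<Omega>. AE x in lebesgue_on \<Omega>. ua \<le> u x \<and> u x \<le> ub}"

definition cost :: "(real ^ 'n) set \<Rightarrow> ('n fn \<Rightarrow> real) \<Rightarrow> 'n fn \<Rightarrow> real" where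
  "cost \<Omega> f u = f u + BV_seminorm \<Omega> u"

definition locally_optimal ::
    "(real ^ 'n) set \<Rightarrow> real \<Rightarrow> real \<Rightarrow> ('n fn \<Rightarrow> real) \<Rightarrow> 'n fn \<Rightarrow> bool" where
  "locally_optimal \<Omega> ua ub f ubar \<longleftrightarrow>
     ubar \<in> U_ad \<Omega> ua ub \<inter> BV \<Omega> \<and>
     (\<exists>r>0. \<forall>u \<in> U_ad \<Omega> ua ub \<inter> BV \<Omega>.
        BV_norm \<Omega> (\<lambda>x. u x - ubar x) + L2_norm \<Omega> (\<lambda>x. u x - ubar x) < r \<longrightarrow>
        cost \<Omega> f ubar \<le> cost \<Omega> f u)"

end

theory Submission
  imports Defs "HOL-Library.Function_Algebras"
begin

text \<open>
  Write \<open>g\<close> for the gradient of \<open>f\<close> at \<open>ubar\<close>. Convexity of the seminorm turns local optimality into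
  \<open>(g, v - ubar) + |v|\<^bsub>BV\<^esub> - |ubar|\<^bsub>BV\<^esub> \<ge> 0\<close> for all admissible \<open>v\<close>. Neither the seminorm nor the indicator of
  the constraint is continuous on \<open>L\<^sup>2\<close>, so the subdifferential sum rule does not apply directly. But truncating
  \<open>v\<close> to \<open>[ua, ub]\<close> does not increase \<open>|v|\<^bsub>BV\<^esub>\<close> and changes \<open>(g, v)\<close> by at most
  \<open>P v = \<integral>|g| dist (v, [ua, ub])\<close>; hence the constraint may be replaced by the penalty \<open>P\<close>, which is convex and
  Lipschitz on \<open>L\<^sup>2\<close>. By Hahn-Banach the functional \<open>(\<nabla>h, h) \<mapsto> - (g, h)\<close> extends to a linear functional
  on \<open>M\<^sup>n \<times> L\<^sup>2\<close> below \<open>(\<nu>, h) \<mapsto> \<parallel>\<nabla>ubar + \<nu>\<parallel> - \<parallel>\<nabla>ubar\<parallel> + P (ubar + h)\<close>. Its first component is \<open>\<lambda>\<^sup>*\<close>; its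
  second component is an \<open>L\<^sup>2\<close> function \<open>p\<close>, whose negative and positive parts are \<open>\<lambda>\<^sup>a\<close> and \<open>\<lambda>\<^sup>b\<close>.
\<close>

section \<open>The Hahn-Banach theorem with a convex majorant\<close>

text \<open>The Lipschitz penalty is what makes the multipliers functions: it bounds the second
  component of the extended functional by a multiple of the \<open>L\<^sup>2\<close> norm, so that
  the Riesz theorem applies; the indicator of the box would give no such bound. As the penalty
  vanishes on the admissible set, \<open>p\<close> lies in the normal cone of that set at
  \<open>ubar\<close>, which yields complementarity. The main work is the truncation estimate with
  the sharp constant 1; a larger factor would spoil the comparison of \<open>|v|\<close> with
  \<open>|ubar|\<close>. It is proved without approximating \<open>BV\<close> functions by smooth
  ones: derivatives are replaced by difference quotients, one direction at a time, and the
  directions are recombined by a partition of unity in the values of the test field. Since measures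
  are functionals on \<open>C\<^sub>0\<close>, the existence of \<open>\<nabla>u\<close> also rests
  on the Hahn-Banach theorem, and the passage between test functions and \<open>C\<^sub>0\<close>
  needs an approximation that does not increase absolute values.\<close>

instantiation "fun" :: (type, scaleR) scaleR
begin

definition scaleR_fun_def: "r *\<^sub>R f = (\<lambda>x. r *\<^sub>R f x)"

instance ..

end

lemma scaleR_fun_apply [simp]: "(r *\<^sub>R f) x = r *\<^sub>R f x"
  by (simp add: scaleR_fun_def)

text \<open>With pointwise operations, functions, functionals on them and families of functionals
  form real vector spaces, so that \<open>subspace\<close> and \<open>convex_on\<close> apply to
  \<open>C0\<close>, \<open>L2\<close>, \<open>vector_measures\<close> and their products.\<close>

instance "fun" :: (type, real_vector) real_vector
  by standard (auto simp: fun_eq_iff scaleR_add_right scaleR_add_left)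

text \<open>
  A subspace of \<open>X \<times> \<real>\<close> lying below \<open>\<Phi>\<close> is automatically the graph of a linear functional, because an
  element \<open>(0, a)\<close> with \<open>a \<noteq> 0\<close> has multiples above \<open>\<Phi> 0\<close>. Zorn's lemma is applied to such graphs.
\<close>

definition subfunctional_graph :: "'a::real_vector set \<Rightarrow> ('a \<Rightarrow> real) \<Rightarrow> ('a \<times> real) set \<Rightarrow> bool" where
  "subfunctional_graph X \<Phi> G \<longleftrightarrow>
     subspace G \<and> (\<forall>(x, a) \<in> G. x \<in> X \<and> a \<le> \<Phi> x)"

lemma subfunctional_graph_single_valued:
  assumes G: "subfunctional_graph X \<Phi> G" and "(x, a) \<in> G" "(x, b) \<in> G"
  shows "a = b"
proof (rule ccontr)
  assume "a \<noteq> b"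
  have sub: "subspace G" using G by (simp add: subfunctional_graph_def)
  have "(x, a) - (x, b) \<in> G" using sub assms(2,3) by (rule subspace_diff)
  then have "c *\<^sub>R (0, a - b) \<in> G" for c
    using sub by (intro subspace_scale) auto
  then have "c * (a - b) \<le> \<Phi> 0" for c
    using G unfolding subfunctional_graph_def by fastforce
  from this[of "(\<Phi> 0 + 1) / (a - b)"] show False using \<open>a \<noteq> b\<close> by simp
qed

text \<open>The inequality \<open>a + t * c \<le> \<Phi> (x + t *\<^sub>R x0)\<close> bounds
  \<open>c\<close> from below for \<open>t < 0\<close> and from above for \<open>t > 0\<close>.
  Convexity puts every lower bound below every upper bound, and \<open>c\<close> is the supremum of
  the lower ones. If \<open>x0\<close> already lies in the domain of \<open>G\<close>, then
  \<open>c\<close> is forced to be its old value, so this case needs no separate treatment.\<close>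

lemma subfunctional_graph_extend:
  assumes X: "subspace X" and cvx: "convex_on X \<Phi>"
    and G: "subfunctional_graph X \<Phi> G" and x0: "x0 \<in> X"
  shows "\<exists>c. subfunctional_graph X \<Phi> {(x + t *\<^sub>R x0, a + t * c) | x a t. (x, a) \<in> G}"
proof -
  have sub: "subspace G" and le: "\<And>x a. (x, a) \<in> G \<Longrightarrow> x \<in> X \<and> a \<le> \<Phi> x"
    using G by (auto simp: subfunctional_graph_def)
  define L where "L = {(a - \<Phi> (x - s *\<^sub>R x0)) / s | x a s. (x, a) \<in> G \<and> s > 0}"
  \<comment> \<open>The weights are those for which the two multiples of \<open>x0\<close> cancel.
    What is left is a convex combination of \<open>x\<close> and \<open>x'\<close>, and there
    \<open>G\<close> lies below \<open>\<Phi>\<close>.\<close>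
  have key: "(a - \<Phi> (x - s *\<^sub>R x0)) / s \<le> (\<Phi> (x' + t *\<^sub>R x0) - a') / t"
    if "(x, a) \<in> G" "(x', a') \<in> G" "s > 0" "t > 0" for x a x' a' s t
  proof -
    have mem: "(t / (s + t)) *\<^sub>R (x, a) + (s / (s + t)) *\<^sub>R (x', a') \<in> G"
      using sub that by (intro subspace_add subspace_scale)
    have eq: "(t / (s + t)) *\<^sub>R (x - s *\<^sub>R x0) + (s / (s + t)) *\<^sub>R (x' + t *\<^sub>R x0)
        = (t / (s + t)) *\<^sub>R x + (s / (s + t)) *\<^sub>R x'"
      by (simp add: scaleR_add_right scaleR_diff_right mult.commute)
    have "x - s *\<^sub>R x0 \<in> X" "x' + t *\<^sub>R x0 \<in> X"
      using le[OF that(1)] le[OF that(2)] x0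
      by (simp_all add: subspace_add[OF X] subspace_diff[OF X] subspace_scale[OF X])
    moreover have "t / (s + t) + s / (s + t) = 1" "0 \<le> t / (s + t)" "0 \<le> s / (s + t)"
      using that by (simp_all flip: add_divide_distrib)
    ultimately have "\<Phi> ((t / (s + t)) *\<^sub>R (x - s *\<^sub>R x0) + (s / (s + t)) *\<^sub>R (x' + t *\<^sub>R x0))
        \<le> (t / (s + t)) * \<Phi> (x - s *\<^sub>R x0) + (s / (s + t)) * \<Phi> (x' + t *\<^sub>R x0)"
      using cvx unfolding convex_on_def by blast
    moreover have "(t / (s + t)) * a + (s / (s + t)) * a' \<le> \<Phi> ((t / (s + t)) *\<^sub>R x + (s / (s + t)) *\<^sub>R x')"
      using le[of _ "(t / (s + t)) * a + (s / (s + t)) * a'"] mem by simp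
    ultimately have "(t / (s + t)) * a + (s / (s + t)) * a'
        \<le> (t / (s + t)) * \<Phi> (x - s *\<^sub>R x0) + (s / (s + t)) * \<Phi> (x' + t *\<^sub>R x0)"
      unfolding eq by linarith
    then have "t * a + s * a' \<le> t * \<Phi> (x - s *\<^sub>R x0) + s * \<Phi> (x' + t *\<^sub>R x0)"
      using that by (simp add: divide_simps)
    then show ?thesis using that by (simp add: divide_simps algebra_simps)
  qed
  have G0: "(0, 0) \<in> G" using subspace_0[OF sub] by (simp add: zero_prod_def)
  have ne: "L \<noteq> {}" unfolding L_def using G0 zero_less_one by blast
  have bdd: "bdd_above L"
    unfolding L_def by (rule bdd_aboveI[of _ "(\<Phi> (0 + 1 *\<^sub>R x0) - 0) / 1"])
      (use key[OF _ G0 _ zero_less_one] in blast)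
  define c where "c = Sup L"
  have lower: "(a - \<Phi> (x - s *\<^sub>R x0)) / s \<le> c" if "(x, a) \<in> G" "s > 0" for x a s
    unfolding c_def by (rule cSup_upper[OF _ bdd]) (use that in \<open>unfold L_def, blast\<close>)
  have upper: "c \<le> (\<Phi> (x + t *\<^sub>R x0) - a) / t" if "(x, a) \<in> G" "t > 0" for x a t
    unfolding c_def by (rule cSup_least[OF ne]) (use that key in \<open>unfold L_def, blast\<close>)
  have dominated: "a + t * c \<le> \<Phi> (x + t *\<^sub>R x0)" if "(x, a) \<in> G" for x a t
  proof (cases t "0::real" rule: linorder_cases)
    case less
    then show ?thesis using lower[OF that, of "- t"] by (simp add: field_simps)
  next
    case equal
    then show ?thesis using le[OF that] by simp
  next
    case greater
    then show ?thesis using upper[OF that greater] by (simp add: field_simps)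
  qed
  have "subspace {(x + t *\<^sub>R x0, a + t * c) | x a t. (x, a) \<in> G}"
  proof (rule subspaceI)
    show "0 \<in> {(x + t *\<^sub>R x0, a + t * c) | x a t. (x, a) \<in> G}"
      using G0 unfolding zero_prod_def mem_Collect_eq
      by (intro exI[of _ 0] conjI) simp_all
  next
    fix y z assume "y \<in> {(x + t *\<^sub>R x0, a + t * c) | x a t. (x, a) \<in> G}"
      and "z \<in> {(x + t *\<^sub>R x0, a + t * c) | x a t. (x, a) \<in> G}"
    then obtain x a t x' a' t' where "y = (x + t *\<^sub>R x0, a + t * c)" "(x, a) \<in> G"
      "z = (x' + t' *\<^sub>R x0, a' + t' * c)" "(x', a') \<in> G" by blast
    moreover from this have "(x, a) + (x', a') \<in> G" using sub by (intro subspace_add)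
    ultimately have "y + z = ((x + x') + (t + t') *\<^sub>R x0, (a + a') + (t + t') * c) \<and> (x + x', a + a') \<in> G"
      by (simp add: algebra_simps)
    then show "y + z \<in> {(x + t *\<^sub>R x0, a + t * c) | x a t. (x, a) \<in> G}" by blast
  next
    fix r :: real and y assume "y \<in> {(x + t *\<^sub>R x0, a + t * c) | x a t. (x, a) \<in> G}"
    then obtain x a t where "y = (x + t *\<^sub>R x0, a + t * c)" "(x, a) \<in> G" by blast
    moreover from this have "r *\<^sub>R (x, a) \<in> G" using sub by (intro subspace_scale)
    ultimately have "r *\<^sub>R y = (r *\<^sub>R x + (r * t) *\<^sub>R x0, r * a + (r * t) * c) \<and> (r *\<^sub>R x, r * a) \<in> G"
      by (simp add: algebra_simps)
    then show "r *\<^sub>R y \<in> {(x + t *\<^sub>R x0, a + t * c) | x a t. (x, a) \<in> G}" by blast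
  qed
  moreover have "x + t *\<^sub>R x0 \<in> X" if "(x, a) \<in> G" for x a t
    using le[OF that] x0 by (simp add: subspace_add[OF X] subspace_scale[OF X])
  ultimately show ?thesis
    unfolding subfunctional_graph_def using dominated by (intro exI[of _ c]) auto
qed

text \<open>The majorant is only convex because the final application uses a shifted norm plus a
  penalty, which is not positively homogeneous. A maximal graph has all of \<open>X\<close> as its
  domain, since adjoining a further vector cannot enlarge it. Outside \<open>X\<close> the
  functional is arbitrary.\<close>

lemma Hahn_Banach_convex:
  fixes X :: "'a::real_vector set"
  assumes X: "subspace X" and cvx: "convex_on X \<Phi>" and G0: "subfunctional_graph X \<Phi> G0"
  obtains F where "\<And>x. x \<in> X \<Longrightarrow> F x \<le> \<Phi> x"
    "\<And>x y. x \<in> X \<Longrightarrow> y \<in> X \<Longrightarrow> F (x + y) = F x + F y"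
    "\<And>x c. x \<in> X \<Longrightarrow> F (c *\<^sub>R x) = c * F x"
    "\<And>x a. (x, a) \<in> G0 \<Longrightarrow> F x = a"
proof -
  define \<A> where "\<A> = {G. subfunctional_graph X \<Phi> G \<and> G0 \<subseteq> G}"
  have "\<exists>M\<in>\<A>. \<forall>G\<in>\<A>. M \<subseteq> G \<longrightarrow> G = M"
  proof (rule subset_Zorn_nonempty)
    show "\<A> \<noteq> {}" using G0 by (auto simp: \<A>_def)
  next
    fix \<C> assume ne: "\<C> \<noteq> {}" and chain: "subset.chain \<A> \<C>"
    have mem: "subspace G" "G0 \<subseteq> G" "\<And>x a. (x, a) \<in> G \<Longrightarrow> x \<in> X \<and> a \<le> \<Phi> x" if "G \<in> \<C>" for G
      using that chain by (auto simp: subset.chain_def \<A>_def subfunctional_graph_def)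
    have "subspace (\<Union>\<C>)"
    proof (rule subspaceI)
      obtain G where "G \<in> \<C>" using ne by blast
      then show "0 \<in> \<Union>\<C>" using subspace_0[OF mem(1)[of G]] by (intro UnionI)
    next
      fix y z assume "y \<in> \<Union>\<C>" "z \<in> \<Union>\<C>"
      then obtain G H where "G \<in> \<C>" "H \<in> \<C>" "y \<in> G" "z \<in> H" by blast
      moreover from this have "G \<subseteq> H \<or> H \<subseteq> G" using chain by (auto simp: subset.chain_def)
      ultimately obtain K where K: "K \<in> \<C>" "y \<in> K" "z \<in> K" by blast
      then show "y + z \<in> \<Union>\<C>" using subspace_add[OF mem(1)[OF K(1)] K(2,3)] by blast
    next
      fix r :: real and y assume "y \<in> \<Union>\<C>"
      then obtain G where G: "G \<in> \<C>" "y \<in> G" by blast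
      then show "r *\<^sub>R y \<in> \<Union>\<C>" using subspace_scale[OF mem(1)[OF G(1)] G(2)] by blast
    qed
    moreover have "x \<in> X \<and> a \<le> \<Phi> x" if "(x, a) \<in> \<Union>\<C>" for x a
      using that mem(3) by blast
    moreover have "G0 \<subseteq> \<Union>\<C>" using ne mem(2) by blast
    ultimately show "\<Union>\<C> \<in> \<A>"
      unfolding \<A>_def subfunctional_graph_def by blast
  qed
  then obtain M where "M \<in> \<A>" and "\<forall>G\<in>\<A>. M \<subseteq> G \<longrightarrow> G = M" by (rule bexE)
  then have M: "subfunctional_graph X \<Phi> M" "G0 \<subseteq> M"
    and max: "\<And>G. subfunctional_graph X \<Phi> G \<Longrightarrow> M \<subseteq> G \<Longrightarrow> G = M"
    using order_trans[of G0 M] by (simp_all add: \<A>_def)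
  have sub: "subspace M" using M by (simp add: subfunctional_graph_def)
  have total: "\<exists>a. (x, a) \<in> M" if x: "x \<in> X" for x
  proof -
    obtain c where c: "subfunctional_graph X \<Phi> {(y + t *\<^sub>R x, a + t * c) | y a t. (y, a) \<in> M}"
      using subfunctional_graph_extend[OF X cvx M(1) x] by blast
    have "M \<subseteq> {(y + t *\<^sub>R x, a + t * c) | y a t. (y, a) \<in> M}"
    proof clarify
      fix y a assume "(y, a) \<in> M"
      then show "\<exists>y' a' t. (y, a) = (y' + t *\<^sub>R x, a' + t * c) \<and> (y', a') \<in> M"
        by (intro exI[of _ y] exI[of _ a] exI[of _ 0]) simp
    qed
    from max[OF c this] have "{(y + t *\<^sub>R x, a + t * c) | y a t. (y, a) \<in> M} = M" .
    moreover have "\<exists>y a t. (x, c) = (y + t *\<^sub>R x, a + t * c) \<and> (y, a) \<in> M"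
      by (rule exI[of _ 0], rule exI[of _ 0], rule exI[of _ 1])
        (use subspace_0[OF sub] in \<open>simp add: zero_prod_def\<close>)
    ultimately have "(x, c) \<in> M" by (metis (mono_tags, lifting) mem_Collect_eq)
    then show ?thesis by blast
  qed
  define F where "F x = (SOME a. (x, a) \<in> M)" for x
  have F: "(x, F x) \<in> M" if "x \<in> X" for x
    unfolding F_def using someI_ex[OF total[OF that]] .
  have F_eq: "F x = a" if "(x, a) \<in> M" for x a
    using subfunctional_graph_single_valued[OF M(1) F that] that M(1)
    by (auto simp: subfunctional_graph_def)
  show thesis
  proof (rule that)
    show "F x \<le> \<Phi> x" if "x \<in> X" for x
      using F[OF that] M(1) by (auto simp: subfunctional_graph_def)
    show "F (x + y) = F x + F y" if "x \<in> X" "y \<in> X" for x y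
      using subspace_add[OF sub F[OF that(1)] F[OF that(2)]] by (intro F_eq) simp
    show "F (c *\<^sub>R x) = c * F x" if "x \<in> X" for x c
      using subspace_scale[OF sub F[OF that], of c] by (intro F_eq) simp
    show "F x = a" if "(x, a) \<in> G0" for x a
      using that M(2) by (intro F_eq) auto
  qed
qed

section \<open>The Hilbert space \<open>L\<^sup>2\<close>\<close>

lemma L2_D:
  assumes "u \<in> L2 \<Omega>"
  shows "u \<in> borel_measurable (lebesgue_on \<Omega>)" "integrable (lebesgue_on \<Omega>) (\<lambda>x. (u x)\<^sup>2)"
  using assms by (auto simp: L2_def)

lemma L2_mult_integrable:
  assumes u: "u \<in> L2 \<Omega>" and v: "v \<in> L2 \<Omega>"
  shows "integrable (lebesgue_on \<Omega>) (\<lambda>x. u x * v x)"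
proof (rule Bochner_Integration.integrable_bound)
  show "integrable (lebesgue_on \<Omega>) (\<lambda>x. (u x)\<^sup>2 + (v x)\<^sup>2)"
    using L2_D(2)[OF u] L2_D(2)[OF v] by simp
  show "(\<lambda>x. u x * v x) \<in> borel_measurable (lebesgue_on \<Omega>)"
    using L2_D(1)[OF u] L2_D(1)[OF v] by simp
  have "\<bar>a * b\<bar> \<le> a\<^sup>2 + b\<^sup>2" for a b :: real
    using sum_squares_bound[of "\<bar>a\<bar>" "\<bar>b\<bar>"] mult_nonneg_nonneg[OF abs_ge_zero[of a] abs_ge_zero[of b]]
    unfolding abs_mult power2_abs by linarith
  then show "AE x in lebesgue_on \<Omega>. norm (u x * v x) \<le> norm ((u x)\<^sup>2 + (v x)\<^sup>2)"
    by simp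
qed

lemma L2_add:
  assumes u: "u \<in> L2 \<Omega>" and v: "v \<in> L2 \<Omega>"
  shows "(\<lambda>x. u x + v x) \<in> L2 \<Omega>"
proof -
  have "integrable (lebesgue_on \<Omega>) (\<lambda>x. (u x)\<^sup>2 + (v x)\<^sup>2 + 2 * (u x * v x))"
    using L2_D(2)[OF u] L2_D(2)[OF v] L2_mult_integrable[OF u v] by simp
  then show ?thesis
    using L2_D(1)[OF u] L2_D(1)[OF v] by (simp add: L2_def power2_sum mult.assoc)
qed

lemma L2_scale:
  assumes "u \<in> L2 \<Omega>"
  shows "(\<lambda>x. c * u x) \<in> L2 \<Omega>"
  using L2_D[OF assms] by (auto simp: L2_def power_mult_distrib)

lemma L2_diff:
  assumes u: "u \<in> L2 \<Omega>" and v: "v \<in> L2 \<Omega>"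
  shows "(\<lambda>x. u x - v x) \<in> L2 \<Omega>"
  using L2_add[OF u L2_scale[OF v, of "-1"]] by simp

lemma L2_inner_commute: "L2_inner \<Omega> u v = L2_inner \<Omega> v u"
  by (simp add: L2_inner_def mult.commute)

lemma L2_inner_add_left:
  assumes "u \<in> L2 \<Omega>" "v \<in> L2 \<Omega>" "w \<in> L2 \<Omega>"
  shows "L2_inner \<Omega> (\<lambda>x. u x + v x) w = L2_inner \<Omega> u w + L2_inner \<Omega> v w"
  using L2_mult_integrable[OF assms(1,3)] L2_mult_integrable[OF assms(2,3)]
  by (simp add: L2_inner_def distrib_right)

lemma L2_inner_scale_left: "L2_inner \<Omega> (\<lambda>x. c * u x) w = c * L2_inner \<Omega> u w"
  by (simp add: L2_inner_def mult.assoc)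

lemma L2_inner_add_right:
  assumes "u \<in> L2 \<Omega>" "v \<in> L2 \<Omega>" "w \<in> L2 \<Omega>"
  shows "L2_inner \<Omega> w (\<lambda>x. u x + v x) = L2_inner \<Omega> w u + L2_inner \<Omega> w v"
  using L2_inner_add_left[OF assms] by (simp add: L2_inner_commute)

lemma L2_inner_scale_right: "L2_inner \<Omega> w (\<lambda>x. c * u x) = c * L2_inner \<Omega> w u"
  using L2_inner_scale_left by (simp add: L2_inner_commute)

lemma L2_norm_square: "(L2_norm \<Omega> u)\<^sup>2 = L2_inner \<Omega> u u"
  by (simp add: L2_norm_def L2_inner_def power2_eq_square)

lemma L2_norm_nonneg [simp]: "0 \<le> L2_norm \<Omega> u"
  by (simp add: L2_norm_def)

lemma L2_norm_scale: "L2_norm \<Omega> (\<lambda>x. c * u x) = \<bar>c\<bar> * L2_norm \<Omega> u"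
  by (simp add: L2_norm_def power_mult_distrib real_sqrt_mult)

lemma L2_norm_square_add:
  assumes u: "u \<in> L2 \<Omega>" and v: "v \<in> L2 \<Omega>"
  shows "(L2_norm \<Omega> (\<lambda>x. u x + v x))\<^sup>2 = (L2_norm \<Omega> u)\<^sup>2 + 2 * L2_inner \<Omega> u v + (L2_norm \<Omega> v)\<^sup>2"
  using u v by (simp add: L2_norm_square L2_inner_add_left L2_inner_add_right L2_add
      L2_inner_commute[of \<Omega> v u])

text \<open>Used for the Cauchy-Schwarz inequality and, with \<open>a = 0\<close>, to conclude that
  the first variation at a minimum vanishes.\<close>

lemma quadratic_nonneg_imp_discriminant:
  fixes a b c :: real
  assumes "\<And>t. 0 \<le> a + 2 * t * b + t\<^sup>2 * c"
  shows "b\<^sup>2 \<le> a * c"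
proof -
  have "c \<ge> 0"
  proof (rule ccontr)
    assume "\<not> c \<ge> 0"
    then have c: "c < 0" by simp
    \<comment> \<open>Chosen such that \<open>t \<ge> 1\<close> and the negative quadratic term
      outweighs \<open>\<bar>a\<bar> + 2 * t * \<bar>b\<bar>\<close>.\<close>
    define t where "t = 1 + (2 * \<bar>b\<bar> + \<bar>a\<bar>) / (- c)"
    have "(2 * \<bar>b\<bar> + \<bar>a\<bar>) / (- c) \<ge> 0" using c by (intro divide_nonneg_nonneg) auto
    moreover have "t * (- c) = - c + (2 * \<bar>b\<bar> + \<bar>a\<bar>)"
      using c unfolding t_def distrib_right by simp
    ultimately have t: "t \<ge> 1" "t * (- c) > 2 * \<bar>b\<bar> + \<bar>a\<bar>"
      using c by (simp_all add: t_def)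
    have "t * (t * (- c)) > t * (2 * \<bar>b\<bar> + \<bar>a\<bar>)" using t by (intro mult_strict_left_mono) auto
    moreover have "t * \<bar>a\<bar> \<ge> \<bar>a\<bar>" using t mult_right_mono[of 1 t "\<bar>a\<bar>"] by simp
    moreover have "t * b \<le> t * \<bar>b\<bar>" using t by simp
    ultimately have "a + 2 * t * b + t\<^sup>2 * c < 0"
      by (simp add: power2_eq_square algebra_simps)
    then show False using assms[of t] by simp
  qed
  moreover have "b = 0" if "c = 0"
  proof (rule ccontr)
    assume "b \<noteq> 0"
    then show False using assms[of "- (a + 1) / (2 * b)"] that by (simp add: field_simps)
  qed
  moreover have "b\<^sup>2 \<le> a * c" if "c > 0"
    using assms[of "- b / c"] that by (simp add: field_simps power2_eq_square)
  ultimately show ?thesis by (cases "c = 0") auto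
qed

lemma L2_Cauchy_Schwarz:
  assumes u: "u \<in> L2 \<Omega>" and v: "v \<in> L2 \<Omega>"
  shows "\<bar>L2_inner \<Omega> u v\<bar> \<le> L2_norm \<Omega> u * L2_norm \<Omega> v"
proof -
  have "0 \<le> (L2_norm \<Omega> u)\<^sup>2 + 2 * t * L2_inner \<Omega> u v + t\<^sup>2 * (L2_norm \<Omega> v)\<^sup>2" for t
    using L2_norm_square_add[OF u L2_scale[OF v, of t]] 
      zero_le_power2[of "L2_norm \<Omega> (\<lambda>x. u x + t * v x)"]
    by (simp add: L2_inner_scale_right L2_norm_scale power_mult_distrib)
  then have "(L2_inner \<Omega> u v)\<^sup>2 \<le> (L2_norm \<Omega> u)\<^sup>2 * (L2_norm \<Omega> v)\<^sup>2"
    by (rule quadratic_nonneg_imp_discriminant)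
  then show ?thesis
    by (metis L2_norm_nonneg abs_le_square_iff abs_of_nonneg mult_nonneg_nonneg power_mult_distrib)
qed

section \<open>Completeness of \<open>L2\<close> on a bounded open set and the Riesz theorem\<close>

locale bounded_open =
  fixes \<Omega> :: "(real ^ 'n) set"
  assumes open_\<Omega>: "open \<Omega>" and bounded_\<Omega>: "bounded \<Omega>"
begin

sublocale finite_measure "lebesgue_on \<Omega>"
proof
  have "\<Omega> \<in> lmeasurable" using bounded_\<Omega> open_\<Omega> by (rule lmeasurable_open)
  then show "emeasure (lebesgue_on \<Omega>) (space (lebesgue_on \<Omega>)) \<noteq> \<infinity>"
    by (auto simp: emeasure_restrict_space fmeasurable_def)
qed

lemma sets_\<Omega> [measurable]: "\<Omega> \<in> sets lebesgue" "\<Omega> \<in> sets borel"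
  using open_\<Omega> by auto

lemma L2_bounded:
  assumes "u \<in> borel_measurable (lebesgue_on \<Omega>)" and "AE x in lebesgue_on \<Omega>. \<bar>u x\<bar> \<le> B"
  shows "u \<in> L2 \<Omega>"
proof -
  have "integrable (lebesgue_on \<Omega>) (\<lambda>x. (u x)\<^sup>2)"
    by (rule integrable_const_bound[of _ "B\<^sup>2"])
      (use assms in \<open>auto elim!: eventually_mono simp flip: abs_le_square_iff\<close>)
  then show ?thesis using assms by (simp add: L2_def)
qed

lemma L2_abs:
  assumes "u \<in> L2 \<Omega>"
  shows "(\<lambda>x. \<bar>u x\<bar>) \<in> L2 \<Omega>"
  using L2_D[OF assms] by (auto simp: L2_def)

lemma L2_integrable:
  assumes "u \<in> L2 \<Omega>"
  shows "integrable (lebesgue_on \<Omega>) u"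
  using L2_mult_integrable[OF assms L2_bounded[of "\<lambda>_. 1" 1]] by simp

lemma L1_le_L2:
  assumes u: "u \<in> L2 \<Omega>"
  shows "(LINT x|lebesgue_on \<Omega>. \<bar>u x\<bar>) \<le> L2_norm \<Omega> (\<lambda>_. 1) * L2_norm \<Omega> u"
proof -
  have "(\<lambda>_. 1) \<in> L2 \<Omega>" by (rule L2_bounded[of _ 1]) auto
  from L2_Cauchy_Schwarz[OF this L2_abs[OF u]] show ?thesis
    by (simp add: L2_inner_def L2_norm_def)
qed

text \<open>By the geometric rate the increments have a finite sum of integrals, so the sequence
  converges almost everywhere; Fatou's lemma then carries the Cauchy bound over to the limit. Only
  such fast sequences occur in the Riesz theorem.\<close>

lemma L2_complete:
  assumes U: "\<And>k. U k \<in> L2 \<Omega>"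
    and cauchy: "\<And>j k. k \<le> j \<Longrightarrow> L2_norm \<Omega> (\<lambda>x. U j x - U k x) \<le> B * (1/2) ^ k"
  obtains u where "u \<in> L2 \<Omega>" "\<And>k. L2_norm \<Omega> (\<lambda>x. u x - U k x) \<le> B * (1/2) ^ k"
proof -
  let ?M = "lebesgue_on \<Omega>"
  have [measurable]: "U k \<in> borel_measurable ?M" for k using L2_D(1)[OF U] .
  have diff: "(\<lambda>x. U j x - U k x) \<in> L2 \<Omega>" for j k by (rule L2_diff[OF U U])
  have B: "0 \<le> B" using order_trans[OF L2_norm_nonneg cauchy[of 0 0]] by simp
  define C where "C = L2_norm \<Omega> (\<lambda>_. 1) * B"
  have C: "0 \<le> C" using B by (simp add: C_def)
  have step: "(\<integral>\<^sup>+x. ennreal \<bar>U (Suc k) x - U k x\<bar> \<partial>?M) \<le> ennreal (C * (1/2) ^ k)" for k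
  proof -
    have "(LINT x|?M. \<bar>U (Suc k) x - U k x\<bar>) \<le> L2_norm \<Omega> (\<lambda>_. 1) * L2_norm \<Omega> (\<lambda>x. U (Suc k) x - U k x)"
      using L1_le_L2[OF diff] .
    also have "\<dots> \<le> C * (1/2) ^ k"
      using mult_left_mono[OF cauchy[of k "Suc k"] L2_norm_nonneg[of \<Omega> "\<lambda>_. 1"]] by (simp add: C_def mult.assoc)
    finally show ?thesis
      using L2_integrable[OF diff, of "Suc k" k] by (subst nn_integral_eq_integral) (auto intro: ennreal_leI)
  qed
  have "(\<integral>\<^sup>+x. (\<Sum>k. ennreal \<bar>U (Suc k) x - U k x\<bar>) \<partial>?M)
      = (\<Sum>k. \<integral>\<^sup>+x. ennreal \<bar>U (Suc k) x - U k x\<bar> \<partial>?M)"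
    by (rule nn_integral_suminf) simp
  also have "\<dots> \<le> (\<Sum>k. ennreal (C * (1/2) ^ k))"
    by (rule suminf_le[OF step]) auto
  also have "\<dots> = ennreal (\<Sum>k. C * (1/2) ^ k)"
    using C by (intro suminf_ennreal2) (auto intro!: summable_mult)
  finally have "(\<integral>\<^sup>+x. (\<Sum>k. ennreal \<bar>U (Suc k) x - U k x\<bar>) \<partial>?M) \<noteq> \<infinity>"
    by (auto simp: top_unique)
  then have "AE x in ?M. (\<Sum>k. ennreal \<bar>U (Suc k) x - U k x\<bar>) \<noteq> \<infinity>"
    by (intro nn_integral_PInf_AE) auto
  then have conv: "AE x in ?M. convergent (\<lambda>k. U k x)"
  proof (rule eventually_mono)
    fix x assume "(\<Sum>k. ennreal \<bar>U (Suc k) x - U k x\<bar>) \<noteq> \<infinity>"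
    then have "summable (\<lambda>k. norm (U (Suc k) x - U k x))"
      by (intro summable_suminf_not_top) auto
    then have "summable (\<lambda>k. U (Suc k) x - U k x)" by (rule summable_norm_cancel)
    then have "convergent (\<lambda>n. \<Sum>k<n. U (Suc k) x - U k x)"
      by (simp add: summable_iff_convergent)
    then have "convergent (\<lambda>n. U n x - U 0 x)" by (subst (asm) sum_lessThan_telescope)
    then show "convergent (\<lambda>k. U k x)"
      using convergent_add[OF _ convergent_const[of "U 0 x"]] by fastforce
  qed
  define u where "u x = lim (\<lambda>k. U k x)" for x
  have [measurable]: "u \<in> borel_measurable ?M"
    unfolding u_def by (rule borel_measurable_lim_metric) simp
  have lim: "AE x in ?M. (\<lambda>k. U k x) \<longlonglongrightarrow> u x"
    using conv by eventually_elim (simp add: u_def convergent_LIMSEQ_iff)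
  \<comment> \<open>This is the Cauchy bound between \<open>U j\<close> and \<open>U k\<close> in
    the limit of large \<open>j\<close>. It yields both membership in \<open>L2\<close> and the
    rate.\<close>
  have fatou: "(\<integral>\<^sup>+x. ennreal ((u x - U k x)\<^sup>2) \<partial>?M) \<le> ennreal ((B * (1/2) ^ k)\<^sup>2)" for k
  proof -
    have "(\<integral>\<^sup>+x. ennreal ((u x - U k x)\<^sup>2) \<partial>?M)
        = (\<integral>\<^sup>+x. liminf (\<lambda>j. ennreal ((U j x - U k x)\<^sup>2)) \<partial>?M)"
    proof (rule nn_integral_cong_AE)
      show "AE x in ?M. ennreal ((u x - U k x)\<^sup>2) = liminf (\<lambda>j. ennreal ((U j x - U k x)\<^sup>2))"
        using lim
      proof eventually_elim
        case (elim x)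
        have "(\<lambda>j. ennreal ((U j x - U k x)\<^sup>2)) \<longlonglongrightarrow> ennreal ((u x - U k x)\<^sup>2)"
          using elim by (intro tendsto_intros)
        from lim_imp_Liminf[OF sequentially_bot this] show ?case by simp
      qed
    qed
    also have "\<dots> \<le> liminf (\<lambda>j. \<integral>\<^sup>+x. ennreal ((U j x - U k x)\<^sup>2) \<partial>?M)"
      by (rule nn_integral_liminf) simp
    also have "\<dots> \<le> ennreal ((B * (1/2) ^ k)\<^sup>2)"
    proof (intro Liminf_le[OF sequentially_bot] eventually_mono[OF eventually_ge_at_top[of k]])
      fix j assume "k \<le> j"
      have "(\<integral>\<^sup>+x. ennreal ((U j x - U k x)\<^sup>2) \<partial>?M) = ennreal ((L2_norm \<Omega> (\<lambda>x. U j x - U k x))\<^sup>2)"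
        using L2_D(2)[OF diff[of j k]]
        by (subst nn_integral_eq_integral) (auto simp: L2_norm_def)
      also have "\<dots> \<le> ennreal ((B * (1/2) ^ k)\<^sup>2)"
        using cauchy[OF \<open>k \<le> j\<close>] by (intro ennreal_leI power_mono) auto
      finally show "(\<integral>\<^sup>+x. ennreal ((U j x - U k x)\<^sup>2) \<partial>?M) \<le> ennreal ((B * (1/2) ^ k)\<^sup>2)" .
    qed
    finally show ?thesis .
  qed
  have uU: "(\<lambda>x. u x - U k x) \<in> L2 \<Omega>" for k
    unfolding L2_def mem_Collect_eq
  proof
    show "integrable ?M (\<lambda>x. (u x - U k x)\<^sup>2)"
      by (rule integrableI_nonneg) (use fatou[of k] in \<open>auto intro: le_less_trans\<close>)
  qed measurable
  show thesis
  proof (rule that)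
    show "u \<in> L2 \<Omega>" using L2_add[OF uU[of 0] U[of 0]] by simp
    fix k
    have "ennreal (LINT x|?M. (u x - U k x)\<^sup>2) \<le> ennreal ((B * (1/2) ^ k)\<^sup>2)"
      using fatou[of k] L2_D(2)[OF uU[of k]] by (subst (asm) nn_integral_eq_integral) auto
    then have "(L2_norm \<Omega> (\<lambda>x. u x - U k x))\<^sup>2 \<le> (B * (1/2) ^ k)\<^sup>2"
      by (simp add: L2_norm_def ennreal_le_iff)
    then show "L2_norm \<Omega> (\<lambda>x. u x - U k x) \<le> B * (1/2) ^ k"
      by (rule power2_le_imp_le) (simp add: B)
  qed
qed

text \<open>Variational proof: the representative is the minimizer of
  \<open>\<parallel>u\<parallel>\<^sup>2 - 2 D u\<close>, whose Euler equation is the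
  assertion.\<close>

lemma L2_Riesz:
  assumes D: "bounded_linear_functional (L2 \<Omega>) (L2_norm \<Omega>) D"
  obtains g where "g \<in> L2 \<Omega>" "\<And>h. h \<in> L2 \<Omega> \<Longrightarrow> D h = L2_inner \<Omega> g h"
proof -
  obtain C where C: "\<And>u. u \<in> L2 \<Omega> \<Longrightarrow> \<bar>D u\<bar> \<le> C * L2_norm \<Omega> u"
    and add: "\<And>u v. u \<in> L2 \<Omega> \<Longrightarrow> v \<in> L2 \<Omega> \<Longrightarrow> D (\<lambda>x. u x + v x) = D u + D v"
    and scale: "\<And>u c. u \<in> L2 \<Omega> \<Longrightarrow> D (\<lambda>x. c * u x) = c * D u"
    using D unfolding bounded_linear_functional_def by blast
  define J where "J u = (L2_norm \<Omega> u)\<^sup>2 - 2 * D u" for u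
  have J_lower: "- C\<^sup>2 \<le> J u" if "u \<in> L2 \<Omega>" for u
    using C[OF that] zero_le_power2[of "L2_norm \<Omega> u - C"] 
    unfolding J_def power2_diff by (simp add: mult.commute)
  define I where "I = Inf (J ` L2 \<Omega>)"
  have bdd: "bdd_below (J ` L2 \<Omega>)" using J_lower by (auto intro!: bdd_belowI[of _ "- C\<^sup>2"])
  have I: "I \<le> J u" if "u \<in> L2 \<Omega>" for u
    unfolding I_def by (rule cINF_lower[OF bdd that])
  have zero: "(\<lambda>_. 0) \<in> L2 \<Omega>" by (simp add: L2_def)
  \<comment> \<open>The tolerance \<open>(1/4) ^ k\<close> becomes, after taking a square root, the
    rate \<open>(1/2) ^ k\<close> that \<open>L2_complete\<close> asks for.\<close>
  have "\<exists>u\<in>L2 \<Omega>. J u \<le> I + (1/4) ^ k" for k :: nat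
  proof -
    have "I < I + (1/4) ^ k" by simp
    then obtain y where "y \<in> J ` L2 \<Omega>" "y < I + (1/4) ^ k"
      unfolding I_def using zero bdd by (subst (asm) (1) cInf_less_iff) auto
    then show ?thesis by (auto intro: less_imp_le)
  qed
  then obtain U where U: "\<And>k. U k \<in> L2 \<Omega>" and JU: "\<And>k. J (U k) \<le> I + (1/4) ^ k" by metis
  have J_expand: "J (\<lambda>x. u x + t * h x) = J u + 2 * t * (L2_inner \<Omega> u h - D h) + t\<^sup>2 * (L2_norm \<Omega> h)\<^sup>2"
    if "u \<in> L2 \<Omega>" "h \<in> L2 \<Omega>" for u h t
    using that unfolding J_def
    by (simp add: L2_norm_square_add L2_scale add scale L2_norm_scale power_mult_distrib
        L2_inner_scale_right algebra_simps)
  \<comment> \<open>The value of \<open>J\<close> at the midpoint of \<open>u\<close> and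
    \<open>v\<close> is at least \<open>I\<close>; this parallelogram argument makes the minimizing
    sequence Cauchy.\<close>
  have par: "(L2_norm \<Omega> (\<lambda>x. v x - u x))\<^sup>2 \<le> 2 * (J u - I) + 2 * (J v - I)"
    if u: "u \<in> L2 \<Omega>" and v: "v \<in> L2 \<Omega>" for u v
  proof -
    have d: "(\<lambda>x. v x - u x) \<in> L2 \<Omega>" by (rule L2_diff[OF v u])
    define \<beta> where "\<beta> = L2_inner \<Omega> u (\<lambda>x. v x - u x) - D (\<lambda>x. v x - u x)"
    define N where "N = (L2_norm \<Omega> (\<lambda>x. v x - u x))\<^sup>2"
    have "J v = J u + 2 * \<beta> + N"
      using J_expand[OF u d, of 1] by (simp add: \<beta>_def N_def)
    moreover have "I \<le> J u + \<beta> + N / 4"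
      using J_expand[OF u d, of "1/2"] I[OF L2_add[OF u L2_scale[OF d, of "1/2"]]]
      by (simp add: power2_eq_square \<beta>_def N_def)
    ultimately show ?thesis unfolding N_def[symmetric] by argo
  qed
  have "L2_norm \<Omega> (\<lambda>x. U j x - U k x) \<le> 2 * (1/2) ^ k" if "k \<le> j" for j k
  proof -
    have "(L2_norm \<Omega> (\<lambda>x. U j x - U k x))\<^sup>2 \<le> 2 * (1/4) ^ k + 2 * (1/4) ^ j"
      using par[OF U[of k] U[of j]] JU[of j] JU[of k] by argo
    also have "\<dots> \<le> 4 * (1/4) ^ k"
      using power_decreasing[OF that, of "1/4 :: real"] by simp
    also have "\<dots> = (2 * (1/2) ^ k)\<^sup>2"
      by (simp add: power_mult_distrib power2_eq_square flip: power_mult_distrib)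
    finally show ?thesis by (rule power2_le_imp_le) simp
  qed
  from L2_complete[OF U this] obtain u where u: "u \<in> L2 \<Omega>"
    and conv: "\<And>k. L2_norm \<Omega> (\<lambda>x. u x - U k x) \<le> 2 * (1/2) ^ k" by blast
  have "J u \<le> I"
  proof (rule LIMSEQ_le_const)
    let ?e = "\<lambda>k. 2 * (1/2) ^ k :: real"
    show "(\<lambda>k. I + (1/4) ^ k + 2 * (\<bar>C\<bar> + L2_norm \<Omega> u) * ?e k) \<longlonglongrightarrow> I"
      by (auto intro!: tendsto_eq_intros LIMSEQ_realpow_zero)
    have "J u \<le> I + (1/4) ^ k + 2 * (\<bar>C\<bar> + L2_norm \<Omega> u) * ?e k" for k
    proof -
      let ?d = "\<lambda>x. u x - U k x"
      have d: "?d \<in> L2 \<Omega>" by (rule L2_diff[OF u U])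
      have "J (U k) = J u - 2 * (L2_inner \<Omega> u ?d - D ?d) + (L2_norm \<Omega> ?d)\<^sup>2"
        using J_expand[OF u d, of "-1"] by simp
      moreover have "- D ?d \<le> \<bar>C\<bar> * L2_norm \<Omega> ?d"
        using C[OF d] mult_right_mono[OF abs_ge_self[of C] L2_norm_nonneg[of \<Omega> ?d]] by linarith
      moreover have "L2_inner \<Omega> u ?d \<le> L2_norm \<Omega> u * L2_norm \<Omega> ?d"
        using L2_Cauchy_Schwarz[OF u d] by linarith
      moreover have "(\<bar>C\<bar> + L2_norm \<Omega> u) * L2_norm \<Omega> ?d \<le> (\<bar>C\<bar> + L2_norm \<Omega> u) * ?e k"
        by (intro mult_left_mono conv) simp
      moreover have "0 \<le> (L2_norm \<Omega> ?d)\<^sup>2" by simp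
      ultimately show ?thesis using JU[of k] unfolding distrib_right mult.assoc by argo
    qed
    then show "\<exists>N. \<forall>k\<ge>N. J u \<le> I + (1/4) ^ k + 2 * (\<bar>C\<bar> + L2_norm \<Omega> u) * ?e k" by blast
  qed
  then have min: "J u \<le> J (\<lambda>x. u x + t * h x)" if "h \<in> L2 \<Omega>" for t h
    using I[OF L2_add[OF u L2_scale[OF that, of t]]] by linarith
  show thesis
  proof (rule that[OF u])
    fix h assume h: "h \<in> L2 \<Omega>"
    \<comment> \<open>The constant term of the quadratic is \<open>0\<close> because
      \<open>u\<close> is a minimizer, so the discriminant bound kills the linear
      coefficient.\<close>
    have "0 \<le> 0 + 2 * t * (L2_inner \<Omega> u h - D h) + t\<^sup>2 * (L2_norm \<Omega> h)\<^sup>2" for t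
      using min[OF h, of t] J_expand[OF u h, of t] by simp
    then have "(L2_inner \<Omega> u h - D h)\<^sup>2 \<le> 0 * (L2_norm \<Omega> h)\<^sup>2"
      by (rule quadratic_nonneg_imp_discriminant)
    then show "D h = L2_inner \<Omega> u h" by simp
  qed
qed

end

section \<open>Smooth functions and density in \<open>C\<^sub>0\<close>\<close>

lemma partial_deriv_eq:
  assumes "(\<phi> has_derivative \<phi>') (at x)"
  shows "partial_deriv i \<phi> x = \<phi>' (axis i 1)"
  using frechet_derivative_at[OF assms] by simp

text \<open>\<open>frechet_derivative\<close> is a choice operator; by uniqueness of derivatives an
  explicit formula may take its place, which is how all the closure properties below are
  proved.\<close>

lemma Ck_Suc_I:
  assumes "\<And>x. (\<phi> has_derivative \<phi>' x) (at x)" and "\<And>i. Ck k (\<lambda>x. \<phi>' x (axis i 1))"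
  shows "Ck (Suc k) \<phi>"
proof -
  have "partial_deriv i \<phi> = (\<lambda>x. \<phi>' x (axis i 1))" for i
    using partial_deriv_eq[OF assms(1)] by (rule ext)
  then show ?thesis using assms by (auto simp: differentiable_def simp del: frechet_derivative_at)
qed

lemma Ck_Suc_D:
  assumes "Ck (Suc k) \<phi>"
  shows "(\<phi> has_derivative frechet_derivative \<phi> (at x)) (at x)" "Ck k (partial_deriv i \<phi>)"
  using assms by (auto simp: frechet_derivative_works)

lemma Ck_continuous: "Ck k \<phi> \<Longrightarrow> continuous_on UNIV \<phi>"
  by (cases k) (auto intro: differentiable_imp_continuous_on simp: differentiable_on_def)

lemma Ck_Suc_imp: "Ck (Suc k) \<phi> \<Longrightarrow> Ck k \<phi>"
proof (induction k arbitrary: \<phi>)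
  case 0
  then show ?case using Ck_continuous[OF 0] by (simp del: Ck.simps(2))
next
  case (Suc k)
  then show ?case using Ck.simps(2)[of "Suc k" \<phi>] Ck.simps(2)[of k \<phi>] by blast
qed

lemma Ck_bounded_linear:
  assumes T: "bounded_linear T"
  shows "Ck k \<phi> \<Longrightarrow> Ck k (\<lambda>x. T (\<phi> x))"
proof (induction k arbitrary: \<phi>)
  case 0
  then show ?case by (simp add: bounded_linear.continuous_on[OF T])
next
  case (Suc k)
  show ?case
    by (rule Ck_Suc_I[OF bounded_linear.has_derivative[OF T Ck_Suc_D(1)[OF Suc.prems]]])
      (rule Suc.IH[OF Ck_Suc_D(2)[OF Suc.prems]])
qed

lemma Ck_const: "Ck k (\<lambda>_. c)"
proof (induction k arbitrary: c)
  case (Suc k)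
  show ?case by (rule Ck_Suc_I[of _ "\<lambda>_ _. 0"]) (auto intro: Suc)
qed simp

lemma Ck_linear_map:
  assumes "bounded_linear T"
  shows "Ck k T"
proof (cases k)
  case 0
  then show ?thesis using assms by (simp add: linear_continuous_on)
next
  case (Suc m)
  show ?thesis unfolding Suc
    by (rule Ck_Suc_I[of _ "\<lambda>_. T"]) (auto intro: bounded_linear_imp_has_derivative assms Ck_const)
qed

lemma Ck_add: "Ck k \<phi> \<Longrightarrow> Ck k \<psi> \<Longrightarrow> Ck k (\<lambda>x. \<phi> x + \<psi> x)"
proof (induction k arbitrary: \<phi> \<psi>)
  case 0
  then show ?case by (simp add: continuous_on_add)
next
  case (Suc k)
  show ?case
    by (rule Ck_Suc_I[OF has_derivative_add[OF Ck_Suc_D(1)[OF Suc.prems(1)] Ck_Suc_D(1)[OF Suc.prems(2)]]])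
      (rule Suc.IH[OF Ck_Suc_D(2)[OF Suc.prems(1)] Ck_Suc_D(2)[OF Suc.prems(2)]])
qed

lemma Ck_mult:
  fixes \<phi> \<psi> :: "real ^ 'n \<Rightarrow> real"
  shows "Ck k \<phi> \<Longrightarrow> Ck k \<psi> \<Longrightarrow> Ck k (\<lambda>x. \<phi> x * \<psi> x)"
proof (induction k arbitrary: \<phi> \<psi>)
  case 0
  then show ?case by (simp add: continuous_on_mult)
next
  case (Suc k)
  show ?case
    by (rule Ck_Suc_I[OF has_derivative_mult[OF Ck_Suc_D(1)[OF Suc.prems(1)] Ck_Suc_D(1)[OF Suc.prems(2)]]])
      (intro Ck_add Suc.IH Ck_Suc_D(2) Suc.prems Ck_Suc_imp)
qed

lemma Ck_real_polynomial_function: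
  assumes "real_polynomial_function p"
  shows "Ck k p"
  using assms by induction (auto intro: Ck_linear_map Ck_const Ck_add Ck_mult)

lemma Ck_translate: "Ck k \<phi> \<Longrightarrow> Ck k (\<lambda>x. \<phi> (x + a))"
proof (induction k arbitrary: \<phi>)
  case 0
  then show ?case
    using continuous_on_compose2[of UNIV \<phi> UNIV "\<lambda>x. x + a"] by (simp add: continuous_intros)
next
  case (Suc k)
  have "((\<lambda>x. \<phi> (x + a)) has_derivative frechet_derivative \<phi> (at (x + a))) (at x)" for x
    by (rule has_derivative_compose[of "\<lambda>x. x + a" "\<lambda>h. h" x UNIV, OF _ Ck_Suc_D(1)[OF Suc.prems]])
      (auto intro!: derivative_eq_intros)
  then show ?case by (rule Ck_Suc_I) (rule Suc.IH[OF Ck_Suc_D(2)[OF Suc.prems]])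
qed

text \<open>Serves to glue a smooth function on an open set to zero outside a compact subset. In the
  induction, the partial derivatives of \<open>\<phi>\<close> agree locally with those of the local
  representatives.\<close>

lemma Ck_local:
  assumes "\<And>x. \<exists>U g. open U \<and> x \<in> U \<and> (\<forall>y\<in>U. g y = \<phi> y) \<and> Ck k g"
  shows "Ck k \<phi>"
  using assms
proof (induction k arbitrary: \<phi>)
  case 0
  show ?case unfolding Ck.simps continuous_on_eq_continuous_at[OF open_UNIV]
  proof
    fix x
    obtain U g where U: "open U" "x \<in> U" and eq: "\<And>y. y \<in> U \<Longrightarrow> g y = \<phi> y" and g: "Ck 0 g"
      using 0 by meson
    have "isCont g x" using g by (simp add: continuous_on_eq_continuous_at)
    then show "isCont \<phi> x"
      using isCont_cong[OF eventually_mono[OF eventually_nhds_in_open[OF U] eq]] by simp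
  qed
next
  case (Suc k)
  have loc: "\<exists>U g. open U \<and> x \<in> U \<and> Ck (Suc k) g \<and>
      (\<forall>y\<in>U. (\<phi> has_derivative frechet_derivative g (at y)) (at y))" for x
  proof -
    obtain U g where U: "open U" "x \<in> U" and eq: "\<And>y. y \<in> U \<Longrightarrow> g y = \<phi> y" and g: "Ck (Suc k) g"
      using Suc.prems by meson
    show ?thesis
      using has_derivative_transform_within_open[OF Ck_Suc_D(1)[OF g] U(1) _ eq] U g by blast
  qed
  have "\<phi> differentiable (at x)" for x
    using loc[of x] by (auto simp: differentiable_def)
  moreover have "Ck k (partial_deriv i \<phi>)" for i
  proof (rule Suc.IH)
    fix x
    obtain U g where U: "open U" "x \<in> U" "Ck (Suc k) g"
      and der: "\<And>y. y \<in> U \<Longrightarrow> (\<phi> has_derivative frechet_derivative g (at y)) (at y)"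
      using loc by meson
    show "\<exists>U g. open U \<and> x \<in> U \<and> (\<forall>y\<in>U. g y = partial_deriv i \<phi> y) \<and> Ck k g"
      using U Ck_Suc_D(2)[OF U(3), of i] partial_deriv_eq[OF der]
      by (intro exI[of _ U] exI[of _ "partial_deriv i g"]) simp
  qed
  ultimately show ?case by simp
qed

text \<open>The functions \<open>P(1/t) exp(-1/t)\<close>, extended by zero to \<open>t \<le> 0\<close>, are closed under differentiation.\<close>

definition flat_exp :: "real poly \<Rightarrow> real \<Rightarrow> real" where
  "flat_exp P t = (if t > 0 then poly P (1 / t) * exp (- 1 / t) else 0)"

lemma poly_exp_tendsto_0: "((\<lambda>s. poly P s * exp (- s)) \<longlongrightarrow> (0 :: real)) at_top"
proof -
  have "((\<lambda>s. \<Sum>i\<le>degree P. coeff P i * (s ^ i / exp s)) \<longlongrightarrow> (\<Sum>i\<le>degree P. coeff P i * 0)) at_top"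
    by (intro tendsto_intros tendsto_power_div_exp_0)
  moreover have "(\<Sum>i\<le>degree P. coeff P i * (s ^ i / exp s)) = poly P s * exp (- s)" for s
    by (simp add: poly_altdef sum_distrib_right exp_minus divide_inverse mult.assoc)
  ultimately show ?thesis by simp
qed

text \<open>With \<open>s = 1 / t\<close> the derivative of \<open>P(s) exp(-s)\<close> in
  \<open>s\<close> is \<open>(P' - P) exp(-s)\<close>, and \<open>ds/dt = -s^2\<close>; this
  accounts for the polynomial \<open>s^2 (P - P')\<close>.\<close>

lemma flat_exp_has_derivative:
  "(flat_exp P has_real_derivative flat_exp (monom 1 2 * (P - pderiv P)) t) (at t)"
proof (cases t "0::real" rule: linorder_cases)
  case less
  have "((\<lambda>_. 0) has_real_derivative 0) (at t)" by simp
  then have "(flat_exp P has_real_derivative 0) (at t)"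
    by (rule DERIV_cong_ev[THEN iffD1, rotated -1, OF _ refl _ refl])
      (use eventually_nhds_in_open[OF open_lessThan[of 0], of t] less in
        \<open>auto elim!: eventually_mono simp: flat_exp_def\<close>)
  then show ?thesis using less by (simp add: flat_exp_def)
next
  case greater
  have "((\<lambda>t. poly P (1 / t) * exp (- 1 / t)) has_real_derivative
      poly (pderiv P) (1 / t) * (- 1 / t\<^sup>2) * exp (- 1 / t) + poly P (1 / t) * (exp (- 1 / t) * (1 / t\<^sup>2))) (at t)"
    using greater by (auto intro!: derivative_eq_intros DERIV_chain2[OF poly_DERIV] simp: power2_eq_square)
  then have "(flat_exp P has_real_derivative
      poly (pderiv P) (1 / t) * (- 1 / t\<^sup>2) * exp (- 1 / t) + poly P (1 / t) * (exp (- 1 / t) * (1 / t\<^sup>2))) (at t)"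
    by (rule DERIV_cong_ev[THEN iffD1, rotated -1, OF _ refl _ refl])
      (use eventually_nhds_in_open[OF open_greaterThan[of 0], of t] greater in
        \<open>auto elim!: eventually_mono simp: flat_exp_def\<close>)
  then show ?thesis using greater
    by (simp add: flat_exp_def poly_monom power_one_over field_simps)
next
  case equal
  \<comment> \<open>For \<open>s = 1 / h\<close> the right difference quotient at \<open>0\<close>
    is \<open>s P(s) exp(-s)\<close>, again a polynomial times a decaying exponential.\<close>
  have "((\<lambda>h. flat_exp P h / h) \<longlongrightarrow> 0) (at_right 0)"
  proof (rule Lim_transform_eventually)
    have "((\<lambda>s. poly (monom 1 1 * P) s * exp (- s)) \<longlongrightarrow> (0 :: real)) at_top"
      by (rule poly_exp_tendsto_0)
    from filterlim_compose[OF this filterlim_inverse_at_top_right]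
    show "((\<lambda>h. poly (monom 1 1 * P) (inverse h) * exp (- inverse h)) \<longlongrightarrow> (0 :: real)) (at_right 0)" .
    show "eventually (\<lambda>h. poly (monom 1 1 * P) (inverse h) * exp (- inverse h) = flat_exp P h / h) (at_right 0)"
      using eventually_at_right_less[of "0 :: real"]
      by eventually_elim (simp add: flat_exp_def poly_monom field_simps)
  qed
  moreover have "((\<lambda>h. flat_exp P h / h) \<longlongrightarrow> 0) (at_left 0)"
    by (rule Lim_transform_eventually[OF tendsto_const])
      (use eventually_at_left_real[of "-1" 0] in \<open>auto elim!: eventually_mono simp: flat_exp_def\<close>)
  ultimately have "((\<lambda>h. flat_exp P h / h) \<longlongrightarrow> 0) (at 0)"
    by (simp add: filterlim_at_split)
  then show ?thesis using equal by (simp add: DERIV_def flat_exp_def)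
qed

text \<open>The polynomial varies in the induction because each differentiation changes it.\<close>

lemma Ck_flat_exp: "Ck k p \<Longrightarrow> Ck k (\<lambda>x. flat_exp P (p x))"
proof (induction k arbitrary: P)
  case 0
  have "continuous_on UNIV (flat_exp P)"
    using flat_exp_has_derivative by (auto intro!: continuous_at_imp_continuous_on DERIV_isCont)
  then show ?case using 0 by (auto intro: continuous_on_compose2)
next
  case (Suc k)
  have "((\<lambda>x. flat_exp P (p x)) has_derivative
      (\<lambda>h. flat_exp (monom 1 2 * (P - pderiv P)) (p x) * frechet_derivative p (at x) h)) (at x)" for x
    using has_derivative_compose[OF Ck_Suc_D(1)[OF Suc.prems]
        flat_exp_has_derivative[unfolded has_field_derivative_def]] .
  then show ?case
    by (rule Ck_Suc_I) (intro Ck_mult Suc.IH Ck_Suc_imp[OF Suc.prems] Ck_Suc_D(2)[OF Suc.prems])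
qed

section \<open>Test functions, \<open>C0\<close> and density\<close>

lemma test_functions_iff:
  "\<phi> \<in> test_functions \<Omega> \<longleftrightarrow> (\<forall>k. Ck k \<phi>) \<and> (\<exists>K. compact K \<and> K \<subseteq> \<Omega> \<and> (\<forall>x. x \<notin> K \<longrightarrow> \<phi> x = 0))"
proof
  assume "\<phi> \<in> test_functions \<Omega>"
  then have "\<forall>k. Ck k \<phi>" "compact (closure {x. \<phi> x \<noteq> 0})" "closure {x. \<phi> x \<noteq> 0} \<subseteq> \<Omega>"
    by (auto simp: test_functions_def)
  moreover have "\<phi> x = 0" if "x \<notin> closure {x. \<phi> x \<noteq> 0}" for x
    using that closure_subset[of "{x. \<phi> x \<noteq> 0}"] by blast
  ultimately show "(\<forall>k. Ck k \<phi>) \<and> (\<exists>K. compact K \<and> K \<subseteq> \<Omega> \<and> (\<forall>x. x \<notin> K \<longrightarrow> \<phi> x = 0))"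
    by blast
next
  assume "(\<forall>k. Ck k \<phi>) \<and> (\<exists>K. compact K \<and> K \<subseteq> \<Omega> \<and> (\<forall>x. x \<notin> K \<longrightarrow> \<phi> x = 0))"
  then obtain K where K: "\<And>k. Ck k \<phi>" "compact K" "K \<subseteq> \<Omega>" "\<And>x. x \<notin> K \<Longrightarrow> \<phi> x = 0" by blast
  have "closure {x. \<phi> x \<noteq> 0} \<subseteq> K"
    using K by (intro closure_minimal compact_imp_closed) auto
  moreover from this have "compact (closure {x. \<phi> x \<noteq> 0})"
    using compact_Int_closed[OF K(2) closed_closure] by (metis Int_absorb1)
  ultimately show "\<phi> \<in> test_functions \<Omega>" using K by (auto simp: test_functions_def)
qed

lemma test_functions_has_derivative:
  "\<phi> \<in> test_functions \<Omega> \<Longrightarrow> (\<phi> has_derivative frechet_derivative \<phi> (at x)) (at x)"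
  using Ck_Suc_D(1)[of 0 \<phi>] by (simp add: test_functions_def del: Ck.simps)

lemma test_functions_bounded_linear:
  assumes T: "bounded_linear T" and \<phi>: "\<phi> \<in> test_functions \<Omega>"
  shows "(\<lambda>x. T (\<phi> x)) \<in> test_functions \<Omega>"
  using \<phi> bounded_linear.linear[OF T] unfolding test_functions_iff
  by (metis Ck_bounded_linear[OF T] linear_0)

lemma test_functions_add:
  assumes "\<phi> \<in> test_functions \<Omega>" "\<psi> \<in> test_functions \<Omega>"
  shows "(\<lambda>x. \<phi> x + \<psi> x) \<in> test_functions \<Omega>"
proof -
  obtain K L where "compact K" "K \<subseteq> \<Omega>" "\<And>x. x \<notin> K \<Longrightarrow> \<phi> x = 0"
    "compact L" "L \<subseteq> \<Omega>" "\<And>x. x \<notin> L \<Longrightarrow> \<psi> x = 0"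
    using assms by (auto simp: test_functions_iff)
  then have "compact (K \<union> L)" "K \<union> L \<subseteq> \<Omega>" "\<And>x. x \<notin> K \<union> L \<Longrightarrow> \<phi> x + \<psi> x = 0"
    by auto
  then show ?thesis using assms Ck_add unfolding test_functions_iff by blast
qed

lemma test_functions_scale: "\<phi> \<in> test_functions \<Omega> \<Longrightarrow> (\<lambda>x. c *\<^sub>R \<phi> x) \<in> test_functions \<Omega>"
  by (rule test_functions_bounded_linear[OF bounded_linear_scaleR_right])

lemma test_functions_zero: "(\<lambda>_. 0) \<in> test_functions \<Omega>"
  unfolding test_functions_iff using Ck_const by (auto intro!: exI[of _ "{}"])

lemma test_functions_diff:
  assumes "\<phi> \<in> test_functions \<Omega>" "\<psi> \<in> test_functions \<Omega>"
  shows "(\<lambda>x. \<phi> x - \<psi> x) \<in> test_functions \<Omega>"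
  using test_functions_add[OF assms(1) test_functions_scale[OF assms(2), of "-1"]] by simp

lemma test_functions_sum:
  assumes "\<And>i. i \<in> I \<Longrightarrow> \<phi> i \<in> test_functions \<Omega>"
  shows "(\<lambda>x. \<Sum>i\<in>I. \<phi> i x) \<in> test_functions \<Omega>"
  using assms by (induction I rule: infinite_finite_induct) (auto intro: test_functions_zero test_functions_add)

text \<open>At a point outside \<open>\<Omega>\<close>, the set where
  \<open>\<bar>\<phi>\<bar>\<close> is at least \<open>e\<close> is compact, hence closed, and
  misses the point; so \<open>\<phi>\<close> is smaller than \<open>e\<close> nearby.\<close>

lemma C0_continuous:
  assumes "open \<Omega>" and \<phi>: "\<phi> \<in> C0 \<Omega>"
  shows "continuous_on UNIV \<phi>"
  unfolding continuous_on_eq_continuous_at[OF open_UNIV]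
proof
  fix x
  show "isCont \<phi> x"
  proof (cases "x \<in> \<Omega>")
    case True
    then show ?thesis using assms by (simp add: C0_def continuous_on_eq_continuous_at)
  next
    case False
    then have x0: "\<phi> x = 0" using \<phi> by (simp add: C0_def)
    show ?thesis unfolding continuous_at_eps_delta
    proof (intro allI impI)
      fix e :: real assume e: "e > 0"
      have "closed {x \<in> \<Omega>. e \<le> \<bar>\<phi> x\<bar>}"
        using \<phi> e by (auto simp: C0_def intro: compact_imp_closed)
      then have "open (- {x \<in> \<Omega>. e \<le> \<bar>\<phi> x\<bar>})" "x \<in> - {x \<in> \<Omega>. e \<le> \<bar>\<phi> x\<bar>}"
        using False by auto
      then obtain d where d: "d > 0" "ball x d \<subseteq> - {x \<in> \<Omega>. e \<le> \<bar>\<phi> x\<bar>}"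
        using open_contains_ball by blast
      have "dist (\<phi> y) (\<phi> x) < e" if "dist y x < d" for y
      proof -
        have "y \<in> ball x d" using that by (simp add: dist_commute)
        then have "y \<notin> \<Omega> \<or> \<bar>\<phi> y\<bar> < e" using d(2) by force
        then show ?thesis using x0 \<phi> e by (auto simp: C0_def)
      qed
      then show "\<exists>d>0. \<forall>y. dist y x < d \<longrightarrow> dist (\<phi> y) (\<phi> x) < e" using d(1) by blast
    qed
  qed
qed

text \<open>Boundedness of \<open>\<Omega>\<close> makes the closed superlevel sets compact, so that
  membership in \<open>C0\<close> can be verified by continuity rules.\<close>

lemma C0_iff:
  assumes "open \<Omega>" "bounded \<Omega>"
  shows "\<phi> \<in> C0 \<Omega> \<longleftrightarrow> continuous_on UNIV \<phi> \<and> (\<forall>x. x \<notin> \<Omega> \<longrightarrow> \<phi> x = 0)"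
proof
  assume "\<phi> \<in> C0 \<Omega>"
  then show "continuous_on UNIV \<phi> \<and> (\<forall>x. x \<notin> \<Omega> \<longrightarrow> \<phi> x = 0)"
    using C0_continuous[OF assms(1)] by (auto simp: C0_def)
next
  assume \<phi>: "continuous_on UNIV \<phi> \<and> (\<forall>x. x \<notin> \<Omega> \<longrightarrow> \<phi> x = 0)"
  have "compact {x \<in> \<Omega>. e \<le> \<bar>\<phi> x\<bar>}" if "e > 0" for e
  proof -
    have "{x \<in> \<Omega>. e \<le> \<bar>\<phi> x\<bar>} = {x. e \<le> \<bar>\<phi> x\<bar>}" using \<phi> that by force
    moreover have "closed {x. e \<le> \<bar>\<phi> x\<bar>}"
      using \<phi> by (intro closed_Collect_le continuous_intros) auto
    moreover have "bounded {x \<in> \<Omega>. e \<le> \<bar>\<phi> x\<bar>}" using assms(2) by (rule bounded_subset) auto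
    ultimately show ?thesis by (simp add: compact_eq_bounded_closed)
  qed
  then show "\<phi> \<in> C0 \<Omega>" using \<phi> by (auto simp: C0_def intro: continuous_on_subset)
qed

lemma test_functions_subset_C0:
  assumes "open \<Omega>" "bounded \<Omega>" "\<phi> \<in> test_functions \<Omega>"
  shows "\<phi> \<in> C0 \<Omega>"
  using assms(3) Ck_continuous unfolding C0_iff[OF assms(1,2)] test_functions_iff by blast

text \<open>
  If \<open>p\<close> is a polynomial close to \<open>\<zeta> - \<epsilon>/2\<close>, then \<open>p exp(-\<kappa>/p)\<close> for \<open>p > 0\<close>, extended by zero, is
  smooth, lies between \<open>p\<^sup>+ - \<kappa>\<close> and \<open>p\<^sup>+\<close>, and vanishes where \<open>\<zeta>\<close> is small.
\<close>

lemma test_functions_dense_nonneg: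
  assumes \<Omega>: "open \<Omega>" "bounded \<Omega>" and \<zeta>: "\<zeta> \<in> C0 \<Omega>" and pos: "\<And>x. 0 \<le> \<zeta> x" and "0 < \<epsilon>"
  shows "\<exists>\<psi>\<in>test_functions \<Omega>. \<forall>x. 0 \<le> \<psi> x \<and> \<psi> x \<le> \<zeta> x \<and> \<zeta> x - \<epsilon> \<le> \<psi> x"
proof -
  \<comment> \<open>The error budget has four parts: two for the downward shift of
    \<open>\<zeta>\<close>, one for the polynomial approximation and one for the exponential factor.
    After the shift and the approximation, \<open>p \<le> \<zeta> - \<delta>\<close>, so
    \<open>p\<close> is not positive where \<open>\<zeta> < \<delta>\<close>.\<close>
  define \<delta> where "\<delta> = \<epsilon> / 4"
  have \<delta>: "\<delta> > 0" "\<epsilon> = 4 * \<delta>" using \<open>0 < \<epsilon>\<close> by (auto simp: \<delta>_def)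
  have \<zeta>0: "\<zeta> x = 0" if "x \<notin> \<Omega>" for x using \<zeta> that by (simp add: C0_def)
  have "compact (closure \<Omega>)" using \<Omega>(2) by simp
  moreover have "continuous_on (closure \<Omega>) (\<lambda>x. \<zeta> x - 2 * \<delta>)"
    using C0_continuous[OF \<Omega>(1) \<zeta>] by (auto intro!: continuous_intros intro: continuous_on_subset)
  ultimately obtain p where poly: "real_polynomial_function p"
    and p: "\<And>x. x \<in> closure \<Omega> \<Longrightarrow> \<bar>\<zeta> x - 2 * \<delta> - p x\<bar> < \<delta>"
    using Stone_Weierstrass_real_polynomial_function \<delta>(1) by blast
  have p_bounds: "\<zeta> x - 3 * \<delta> \<le> p x" "p x \<le> \<zeta> x - \<delta>" if "x \<in> \<Omega>" for x
    using p[of x] that closure_subset[of \<Omega>] by auto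
  define h where "h x = p x * flat_exp [:1:] (p x / \<delta>)" for x
  have h0: "h x = 0" if "p x \<le> 0" for x
    using that \<delta> by (simp add: h_def flat_exp_def zero_less_divide_iff)
  have h_le: "0 \<le> h x \<and> h x \<le> p x \<and> p x - \<delta> \<le> h x" if "p x > 0" for x
  proof -
    have hx: "h x = p x * exp (- (\<delta> / p x))" using that \<delta> by (simp add: h_def flat_exp_def)
    \<comment> \<open>The bound \<open>exp (- s) \<ge> 1 - s\<close> limits the loss caused by the
      exponential factor to \<open>\<delta>\<close>.\<close>
    moreover have "p x * (1 + - (\<delta> / p x)) \<le> p x * exp (- (\<delta> / p x))"
      using that exp_ge_add_one_self[of "- (\<delta> / p x)"] by (intro mult_left_mono) simp_all
    moreover have "p x * (1 + - (\<delta> / p x)) = p x - \<delta>" using that by (simp add: field_simps)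
    moreover have "p x * exp (- (\<delta> / p x)) \<le> p x"
      using that \<delta> by (simp add: mult_left_le)
    moreover have "0 \<le> h x" using that by (simp add: hx)
    ultimately show ?thesis unfolding hx by linarith
  qed
  have smooth_h: "Ck k h" for k
  proof -
    have "Ck k (\<lambda>x. p x * (1 / \<delta>))"
      by (intro Ck_mult Ck_real_polynomial_function[OF poly] Ck_const)
    then show ?thesis
      unfolding h_def[abs_def]
      by (intro Ck_mult Ck_real_polynomial_function[OF poly] Ck_flat_exp) simp
  qed
  \<comment> \<open>The polynomial is controlled on the closure of \<open>\<Omega>\<close> only, so
    \<open>h\<close> has to be cut off outside. Smoothness survives because \<open>\<Omega>\<close>
    and the complement of the compact set \<open>K\<close> form an open cover and
    \<open>\<psi>\<close> vanishes on the latter.\<close>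
  define \<psi> where "\<psi> x = (if x \<in> \<Omega> then h x else 0)" for x
  define K where "K = {x \<in> \<Omega>. \<delta> \<le> \<bar>\<zeta> x\<bar>}"
  have K: "compact K" "K \<subseteq> \<Omega>" using \<zeta> \<delta> by (auto simp: C0_def K_def)
  have \<psi>0: "\<psi> x = 0" if "x \<notin> K" for x
    using that p_bounds(2)[of x] h0[of x] pos[of x] by (auto simp: \<psi>_def K_def)
  have "Ck k \<psi>" for k
  proof (rule Ck_local)
    fix x
    show "\<exists>U g. open U \<and> x \<in> U \<and> (\<forall>y\<in>U. g y = \<psi> y) \<and> Ck k g"
    proof (cases "x \<in> \<Omega>")
      case True
      then show ?thesis using \<Omega> smooth_h by (intro exI[of _ \<Omega>] exI[of _ h]) (simp add: \<psi>_def)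
    next
      case False
      then show ?thesis using K compact_imp_closed[OF K(1)] \<psi>0 Ck_const
        by (intro exI[of _ "- K"] exI[of _ "\<lambda>_. 0"]) auto
    qed
  qed
  then have "\<psi> \<in> test_functions \<Omega>" unfolding test_functions_iff using K \<psi>0 by blast
  moreover have "0 \<le> \<psi> x \<and> \<psi> x \<le> \<zeta> x \<and> \<zeta> x - \<epsilon> \<le> \<psi> x" for x
  proof (cases "x \<in> \<Omega>")
    case True
    then show ?thesis
      using p_bounds[OF True] h0[of x] h_le[of x] pos[of x] \<delta> by (cases "p x \<le> 0") (auto simp: \<psi>_def)
  next
    case False
    then show ?thesis using \<zeta>0 \<delta> by (simp add: \<psi>_def)
  qed
  ultimately show ?thesis by blast
qed

text \<open>Positive and negative parts are approximated from below separately. The bound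
  \<open>\<bar>\<psi>\<bar> \<le> \<bar>\<phi>\<bar>\<close> later preserves both supports and the
  constraint on Euclidean norms of fields.\<close>

lemma test_functions_dense:
  assumes \<Omega>: "open \<Omega>" "bounded \<Omega>" and \<phi>: "\<phi> \<in> C0 \<Omega>" and "0 < \<epsilon>"
  shows "\<exists>\<psi>\<in>test_functions \<Omega>. \<forall>x. \<bar>\<psi> x\<bar> \<le> \<bar>\<phi> x\<bar> \<and> \<bar>\<psi> x - \<phi> x\<bar> \<le> \<epsilon>"
proof -
  have "(\<lambda>x. max (\<phi> x) 0) \<in> C0 \<Omega>" "(\<lambda>x. max (- \<phi> x) 0) \<in> C0 \<Omega>"
    using \<phi> by (auto simp: C0_iff[OF \<Omega>] intro!: continuous_intros)
  then obtain \<psi>1 \<psi>2 where "\<psi>1 \<in> test_functions \<Omega>" "\<psi>2 \<in> test_functions \<Omega>"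
    and bounds: "\<And>x. 0 \<le> \<psi>1 x \<and> \<psi>1 x \<le> max (\<phi> x) 0 \<and> max (\<phi> x) 0 - \<epsilon> \<le> \<psi>1 x"
      "\<And>x. 0 \<le> \<psi>2 x \<and> \<psi>2 x \<le> max (- \<phi> x) 0 \<and> max (- \<phi> x) 0 - \<epsilon> \<le> \<psi>2 x"
    using test_functions_dense_nonneg[OF \<Omega> _ _ \<open>0 < \<epsilon>\<close>, of "\<lambda>x. max (\<phi> x) 0"]
      test_functions_dense_nonneg[OF \<Omega> _ _ \<open>0 < \<epsilon>\<close>, of "\<lambda>x. max (- \<phi> x) 0"] by force
  moreover have "\<bar>\<psi>1 x - \<psi>2 x\<bar> \<le> \<bar>\<phi> x\<bar> \<and> \<bar>\<psi>1 x - \<psi>2 x - \<phi> x\<bar> \<le> \<epsilon>" for x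
    using bounds[of x] by linarith
  ultimately show ?thesis
    by (intro bexI[of _ "\<lambda>x. \<psi>1 x - \<psi>2 x"] test_functions_diff) auto
qed

section \<open>Truncation and total variation\<close>

lemma partial_deriv_test_functions:
  assumes \<phi>: "\<phi> \<in> test_functions \<Omega>"
  shows "partial_deriv i \<phi> \<in> test_functions \<Omega>"
proof -
  obtain K where K: "compact K" "K \<subseteq> \<Omega>" "\<And>x. x \<notin> K \<Longrightarrow> \<phi> x = 0" and Ck: "\<And>k. Ck k \<phi>"
    using \<phi> by (auto simp: test_functions_iff)
  have "partial_deriv i \<phi> x = 0" if "x \<notin> K" for x
  proof -
    have "(\<phi> has_derivative (\<lambda>_. 0)) (at x)"
      by (rule has_derivative_transform_within_open[of "\<lambda>_. 0" _ _ _ "- K"])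
        (use K that compact_imp_closed[OF K(1)] in auto)
    then show ?thesis by (rule partial_deriv_eq)
  qed
  then show ?thesis unfolding test_functions_iff using K(1,2) Ck_Suc_D(2)[OF Ck] by blast
qed

lemma frechet_derivative_test_functions:
  assumes \<phi>: "\<phi> \<in> test_functions \<Omega>"
  shows "(\<lambda>x. frechet_derivative \<phi> (at x) c) \<in> test_functions \<Omega>"
proof -
  have "frechet_derivative \<phi> (at x) c = (\<Sum>i\<in>UNIV. c $ i *\<^sub>R partial_deriv i \<phi> x)" for x
  proof -
    have lin: "linear (frechet_derivative \<phi> (at x))"
      using test_functions_has_derivative[OF \<phi>] by (rule has_derivative_linear)
    have "frechet_derivative \<phi> (at x) c = frechet_derivative \<phi> (at x) (\<Sum>i\<in>UNIV. c $ i *\<^sub>R axis i 1)"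
      by (simp add: basis_expansion flip: scalar_mult_eq_scaleR)
    also have "\<dots> = (\<Sum>i\<in>UNIV. c $ i *\<^sub>R partial_deriv i \<phi> x)"
      by (simp add: linear_sum[OF lin] linear_cmul[OF lin])
    finally show ?thesis .
  qed
  then show ?thesis
    using test_functions_sum[of UNIV "\<lambda>i x. c $ i *\<^sub>R partial_deriv i \<phi> x"]
      test_functions_scale[OF partial_deriv_test_functions[OF \<phi>]] by simp
qed

lemma test_functions_continuous: "\<phi> \<in> test_functions \<Omega> \<Longrightarrow> continuous_on UNIV \<phi>"
  using Ck_continuous unfolding test_functions_iff by blast

lemma test_functions_measurable:
  "\<phi> \<in> test_functions \<Omega> \<Longrightarrow> \<phi> \<in> borel_measurable borel"
  by (intro borel_measurable_continuous_onI test_functions_continuous)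

lemma test_functions_bounded:
  assumes \<phi>: "\<phi> \<in> test_functions \<Omega>"
  obtains B where "B > 0" "\<And>x. norm (\<phi> x) \<le> B"
proof -
  obtain K where K: "compact K" "\<And>x. x \<notin> K \<Longrightarrow> \<phi> x = 0"
    using \<phi> by (auto simp: test_functions_iff)
  have "compact (\<phi> ` K)"
    using compact_continuous_image[OF continuous_on_subset[OF test_functions_continuous[OF \<phi>] subset_UNIV] K(1)] .
  then obtain B where B: "B > 0" "\<And>x. x \<in> K \<Longrightarrow> norm (\<phi> x) \<le> B"
    using compact_imp_bounded bounded_pos by (metis imageI)
  then have "norm (\<phi> x) \<le> B" for x using K(2)[of x] by (cases "x \<in> K") auto
  then show thesis using that B(1) by blast
qed

lemma test_functions_translate:
  assumes \<phi>: "\<phi> \<in> test_functions \<Omega>" and K: "compact K" "\<And>x. x \<in> K \<Longrightarrow> x - a \<in> \<Omega>"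
    and supp: "\<And>x. x \<notin> K \<Longrightarrow> \<phi> x = 0"
  shows "(\<lambda>x. \<phi> (x + a)) \<in> test_functions \<Omega>"
proof -
  have "compact ((\<lambda>x. x - a) ` K)" using K(1) by (intro compact_continuous_image continuous_intros)
  moreover have "(\<lambda>x. x - a) ` K \<subseteq> \<Omega>" using K(2) by blast
  moreover have "\<phi> (x + a) = 0" if "x \<notin> (\<lambda>x. x - a) ` K" for x
    using that by (intro supp) (metis add_diff_cancel_right' imageI)
  ultimately show ?thesis
    using \<phi> Ck_translate unfolding test_functions_iff by blast
qed

section \<open>Derivatives and integrals along translations\<close>

lemma test_functions_line_derivative:
  fixes \<phi> :: "real ^ 'n \<Rightarrow> real"
  assumes \<phi>: "\<phi> \<in> test_functions \<Omega>"
  shows "((\<lambda>t. \<phi> (x + t *\<^sub>R c)) has_real_derivative frechet_derivative \<phi> (at (x + t *\<^sub>R c)) c) (at t)"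
proof -
  have "((\<lambda>t. x + t *\<^sub>R c) has_derivative (\<lambda>h. h *\<^sub>R c)) (at t)"
    by (auto intro!: derivative_eq_intros)
  from has_derivative_compose[OF this test_functions_has_derivative[OF \<phi>]]
  have "((\<lambda>t. \<phi> (x + t *\<^sub>R c)) has_derivative (\<lambda>h. frechet_derivative \<phi> (at (x + t *\<^sub>R c)) (h *\<^sub>R c))) (at t)" .
  moreover have "frechet_derivative \<phi> (at (x + t *\<^sub>R c)) (h *\<^sub>R c) = frechet_derivative \<phi> (at (x + t *\<^sub>R c)) c * h" for h
    using has_derivative_linear[OF test_functions_has_derivative[OF \<phi>]] by (simp add: linear_cmul)
  ultimately show ?thesis by (simp add: has_field_derivative_def)
qed

lemma frechet_derivative_translate:
  fixes \<phi> :: "real ^ 'n \<Rightarrow> real"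
  assumes \<phi>: "\<phi> \<in> test_functions \<Omega>"
  shows "frechet_derivative (\<lambda>x. \<phi> (x + a)) (at x) = frechet_derivative \<phi> (at (x + a))"
proof -
  have "((\<lambda>x. \<phi> (x + a)) has_derivative frechet_derivative \<phi> (at (x + a))) (at x)"
    by (rule has_derivative_compose[of "\<lambda>x. x + a" "\<lambda>h. h" x UNIV, OF _ test_functions_has_derivative[OF \<phi>]])
      (auto intro!: derivative_eq_intros)
  then show ?thesis by (rule frechet_derivative_at[symmetric])
qed

lemma test_functions_line_diff:
  fixes \<phi> :: "real ^ 'n \<Rightarrow> real"
  assumes \<phi>: "\<phi> \<in> test_functions \<Omega>" and B: "\<And>x. \<bar>frechet_derivative \<phi> (at x) c\<bar> \<le> B"
  shows "\<bar>\<phi> (x + s *\<^sub>R c) - \<phi> (x + t *\<^sub>R c)\<bar> \<le> B * \<bar>s - t\<bar>"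
  using field_differentiable_bound[of UNIV "\<lambda>t. \<phi> (x + t *\<^sub>R c)"
      "\<lambda>t. frechet_derivative \<phi> (at (x + t *\<^sub>R c)) c" B s t]
    test_functions_line_derivative[OF \<phi>] B by simp

lemma integrable_times_bounded:
  fixes f g :: "'a \<Rightarrow> real"
  assumes f: "integrable M f" and g: "g \<in> borel_measurable M" and B: "\<And>x. \<bar>g x\<bar> \<le> B"
  shows "integrable M (\<lambda>x. f x * g x)"
proof (rule Bochner_Integration.integrable_bound)
  show "integrable M (\<lambda>x. B * f x)" using f by simp
  show "(\<lambda>x. f x * g x) \<in> borel_measurable M" using f g by measurable
  have "\<bar>f x * g x\<bar> \<le> \<bar>B * f x\<bar>" for x
    using B[of x] mult_right_mono[of "\<bar>g x\<bar>" "\<bar>B\<bar>" "\<bar>f x\<bar>"] by (simp add: abs_mult mult.commute)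
  then show "AE x in M. norm (f x * g x) \<le> norm (B * f x)" by simp
qed

lemma lborel_integral_translate:
  fixes f :: "'a::euclidean_space \<Rightarrow> real"
  assumes "f \<in> borel_measurable borel"
  shows "(LINT x|lborel. f (x + a)) = (LINT x|lborel. f x)"
  using integral_distr[of "(+) a" lborel borel f] assms by (simp add: lborel_distr_plus add.commute)

lemma lborel_integrable_translate:
  fixes f :: "'a::euclidean_space \<Rightarrow> real"
  assumes "integrable lborel f" and "f \<in> borel_measurable borel"
  shows "integrable lborel (\<lambda>x. f (x + a))"
  using integrable_distr_eq[of "(+) a" lborel borel f] assms by (simp add: lborel_distr_plus add.commute)

text \<open>All derivatives fall on the test function, so integrability of \<open>W\<close> is
  enough: the difference quotients of \<open>\<phi>\<close> are bounded by the supremum of its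
  directional derivative, and dominated convergence applies.\<close>

lemma pairing_line_derivative:
  fixes \<phi> :: "real ^ 'n \<Rightarrow> real"
  assumes W: "integrable lborel W" and \<phi>: "\<phi> \<in> test_functions \<Omega>"
  shows "((\<lambda>t. LINT x|lborel. W x * \<phi> (x + t *\<^sub>R c)) has_real_derivative
    (LINT x|lborel. W x * frechet_derivative \<phi> (at (x + t *\<^sub>R c)) c)) (at t)"
  unfolding DERIV_def tendsto_at_iff_sequentially
proof (intro allI impI)
  fix h :: "nat \<Rightarrow> real" assume h: "\<forall>n. h n \<in> UNIV - {0}" and lim: "h \<longlonglongrightarrow> 0"
  obtain B where B: "B > 0" "\<And>x. norm (frechet_derivative \<phi> (at x) c) \<le> B"
    using test_functions_bounded[OF frechet_derivative_test_functions[OF \<phi>]] by blast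
  obtain A where A: "\<And>x. norm (\<phi> x) \<le> A" using test_functions_bounded[OF \<phi>] by blast
  have [measurable]: "\<phi> \<in> borel_measurable borel" by (rule test_functions_measurable[OF \<phi>])
  have [measurable]: "W \<in> borel_measurable borel" using W by simp
  have [measurable]: "(\<lambda>x. frechet_derivative \<phi> (at x) c) \<in> borel_measurable borel"
    by (rule test_functions_measurable[OF frechet_derivative_test_functions[OF \<phi>]])
  have meas': "(\<lambda>x. frechet_derivative \<phi> (at (x + t *\<^sub>R c)) c) \<in> borel_measurable borel"
    using measurable_compose[of "\<lambda>x. x + t *\<^sub>R c" borel borel "\<lambda>x. frechet_derivative \<phi> (at x) c" borel]
    by simp
  define q where "q n x = (\<phi> (x + (t + h n) *\<^sub>R c) - \<phi> (x + t *\<^sub>R c)) / h n" for n x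
  have int: "integrable lborel (\<lambda>x. W x * \<phi> (x + s *\<^sub>R c))" for s
    using A by (intro integrable_times_bounded[OF W, of _ A]) auto
  have "(\<lambda>n. LINT x|lborel. W x * q n x) \<longlonglongrightarrow> (LINT x|lborel. W x * frechet_derivative \<phi> (at (x + t *\<^sub>R c)) c)"
  proof (rule integral_dominated_convergence[where w = "\<lambda>x. B * \<bar>W x\<bar>"])
    show "(\<lambda>x. W x * frechet_derivative \<phi> (at (x + t *\<^sub>R c)) c) \<in> borel_measurable lborel"
      using meas' by simp
    show "(\<lambda>x. W x * q n x) \<in> borel_measurable lborel" for n unfolding q_def by measurable
    show "integrable lborel (\<lambda>x. B * \<bar>W x\<bar>)" using W by simp
    show "AE x in lborel. (\<lambda>n. W x * q n x) \<longlonglongrightarrow> W x * frechet_derivative \<phi> (at (x + t *\<^sub>R c)) c"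
    proof (rule AE_I2)
      fix x
      have "(q' \<longlongrightarrow> D) (at 0) \<Longrightarrow> (\<lambda>n. q' (h n)) \<longlonglongrightarrow> D" for q' :: "real \<Rightarrow> real" and D
        using h lim unfolding tendsto_at_iff_sequentially comp_def by blast
      from this[OF test_functions_line_derivative[OF \<phi>, unfolded DERIV_def]]
      show "(\<lambda>n. W x * q n x) \<longlonglongrightarrow> W x * frechet_derivative \<phi> (at (x + t *\<^sub>R c)) c"
        unfolding q_def by (rule tendsto_mult_left)
    qed
    have "\<bar>q n x\<bar> \<le> B" for n x
      using test_functions_line_diff[OF \<phi>, of c B x "t + h n" t] B h
      by (simp add: q_def abs_divide divide_le_eq)
    from mult_right_mono[OF this abs_ge_zero]
    show "AE x in lborel. norm (W x * q n x) \<le> B * \<bar>W x\<bar>" for n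
      by (intro AE_I2) (simp add: abs_mult mult.commute)
  qed
  moreover have "(LINT x|lborel. W x * q n x)
      = ((LINT x|lborel. W x * \<phi> (x + (t + h n) *\<^sub>R c)) - (LINT x|lborel. W x * \<phi> (x + t *\<^sub>R c))) / h n" for n
    using int by (simp add: q_def right_diff_distrib flip: Bochner_Integration.integral_diff)
  ultimately show "((\<lambda>h. ((LINT x|lborel. W x * \<phi> (x + (t + h) *\<^sub>R c)) - (LINT x|lborel. W x * \<phi> (x + t *\<^sub>R c))) / h) \<circ> h)
      \<longlonglongrightarrow> (LINT x|lborel. W x * frechet_derivative \<phi> (at (x + t *\<^sub>R c)) c)"
    by (simp add: comp_def)
qed

text \<open>Needed for the secant slopes, which are merely measurable and have to be replaced by
  continuous functions before test functions can approximate them.\<close>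

lemma borel_measurable_AE_limit_continuous:
  fixes m :: "'a::euclidean_space \<Rightarrow> real"
  assumes "m \<in> borel_measurable borel"
  obtains g where "\<And>k::nat. continuous_on UNIV (g k)" "AE x in lborel. (\<lambda>k. g k x) \<longlonglongrightarrow> m x"
proof -
  have "m \<in> borel_measurable (lebesgue_on UNIV)"
    using assms by (simp add: measurable_completion lebesgue_on_UNIV_eq)
  then have "m measurable_on UNIV" by (simp add: measurable_on_iff_borel_measurable)
  then obtain N g where N: "negligible N" and g: "\<And>k::nat. continuous_on UNIV (g k)"
    and lim: "\<And>x. x \<notin> N \<Longrightarrow> (\<lambda>k. g k x) \<longlonglongrightarrow> m x"
    unfolding measurable_on_def by auto
  have "AE x in lebesgue. x \<notin> N"
    using N by (intro AE_not_in) (simp add: negligible_iff_null_sets)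
  then have "AE x in lborel. x \<notin> N" by (simp add: AE_completion_iff)
  then have "AE x in lborel. (\<lambda>k. g k x) \<longlonglongrightarrow> m x" by eventually_elim (rule lim)
  then show thesis using that g by blast
qed

section \<open>Truncation and variation in a single direction\<close>

definition clip :: "real \<Rightarrow> real \<Rightarrow> real \<Rightarrow> real" where
  "clip a b t = max a (min b t)"

lemma clip_measurable [measurable]: "clip a b \<in> borel_measurable borel"
  unfolding clip_def[abs_def] by measurable

lemma clip_bounded: "\<bar>clip a b t\<bar> \<le> \<bar>a\<bar> + \<bar>b\<bar>"
  by (auto simp: clip_def)

lemma clip_secant:
  assumes "s \<noteq> t"
  shows "0 \<le> (clip a b s - clip a b t) / (s - t)" "(clip a b s - clip a b t) / (s - t) \<le> 1"
  using assms by (auto simp: clip_def divide_simps max_def min_def)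

context bounded_open
begin

text \<open>
  Difference quotients of \<open>clip u\<close> in the direction \<open>c\<close> are those of \<open>u\<close> times a secant slope
  \<open>m \<in> [0, 1]\<close>, which is moved onto the test function. The mean value theorem turns the difference
  quotient of \<open>u\<close> back into a derivative along \<open>c\<close> of a translated test function.
\<close>

lemma clip_directional_derivative_lborel:
  assumes U: "integrable lborel U" and \<zeta>: "\<zeta> \<in> test_functions \<Omega>" and "\<delta> > 0"
  shows "\<exists>\<psi>\<in>test_functions \<Omega>. (\<forall>x. \<bar>\<psi> x\<bar> \<le> \<bar>\<zeta> x\<bar> + \<delta>) \<and>
    (LINT x|lborel. indicator \<Omega> x * clip a b (U x) * frechet_derivative \<zeta> (at x) c)
      \<le> (LINT x|lborel. U x * frechet_derivative \<psi> (at x) c) + \<delta>"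
proof -
  have [measurable]: "\<zeta> \<in> borel_measurable borel" by (rule test_functions_measurable[OF \<zeta>])
  have [measurable]: "U \<in> borel_measurable borel" using U by simp
  \<comment> \<open>The truncation of \<open>0\<close> need not be \<open>0\<close>; the indicator
    of the bounded set \<open>\<Omega>\<close> makes the truncated function integrable on the whole
    space.\<close>
  define V where "V x = indicator \<Omega> x * clip a b (U x)" for x
  have [measurable]: "V \<in> borel_measurable borel" unfolding V_def by measurable
  have "emeasure lborel \<Omega> < \<infinity>"
    using emeasure_bounded_finite[OF bounded_\<Omega>] .
  then have "integrable lborel (\<lambda>x. indicator \<Omega> x :: real)" by (simp add: integrable_indicator_iff)
  then have V: "integrable lborel V"
    unfolding V_def by (rule integrable_times_bounded) (use clip_bounded in auto)
  obtain K where K: "compact K" "K \<subseteq> \<Omega>" "\<And>x. x \<notin> K \<Longrightarrow> \<zeta> x = 0"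
    using \<zeta> by (auto simp: test_functions_iff)
  obtain d where d: "d > 0" "(\<Union>x\<in>K. ball x d) \<subseteq> \<Omega>"
    using compact_subset_open_imp_ball_epsilon_subset[OF K(1) open_\<Omega> K(2)] by blast
  obtain A where A: "A > 0" "\<And>x. norm (\<zeta> x) \<le> A" using test_functions_bounded[OF \<zeta>] by blast
  obtain B where B: "B > 0" "\<And>x. \<bar>frechet_derivative \<zeta> (at x) c\<bar> \<le> B"
    using test_functions_bounded[OF frechet_derivative_test_functions[OF \<zeta>]] by auto
  define H where "H t = (LINT x|lborel. V x * \<zeta> (x + t *\<^sub>R c))" for t
  define D where "D = (LINT x|lborel. V x * frechet_derivative \<zeta> (at x) c)"
  have "((\<lambda>t. (H (0 + t) - H 0) / t) \<longlongrightarrow> D) (at 0)"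
    using pairing_line_derivative[OF V \<zeta>, of c 0] unfolding H_def D_def DERIV_def by simp
  then have "((\<lambda>t. (H t - H 0) / t) \<longlongrightarrow> D) (at_right 0)"
    by (auto intro: filterlim_mono at_le simp: at_within_le_at)
  then have "eventually (\<lambda>t. (H t - H 0) / t > D - \<delta> / 2) (at_right 0)"
    using \<open>\<delta> > 0\<close> by (intro order_tendstoD) auto
  moreover have "((\<lambda>t. t * norm c) \<longlongrightarrow> 0) (at_right 0)" "((\<lambda>t. t * B) \<longlongrightarrow> 0) (at_right 0)"
    by (auto intro!: tendsto_eq_intros)
  then have "eventually (\<lambda>t. t * norm c < d) (at_right 0)" "eventually (\<lambda>t. t * B < \<delta>) (at_right 0)"
    using d(1) \<open>\<delta> > 0\<close> by (auto intro: order_tendstoD)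
  moreover have "eventually (\<lambda>t::real. 0 < t) (at_right 0)" by (rule eventually_at_right_less)
  \<comment> \<open>One step size meets three demands: the difference quotient is close to
    \<open>D\<close>, translating \<open>K\<close> by at most \<open>t *\<^sub>R c\<close> stays
    inside \<open>\<Omega>\<close>, and the translation changes \<open>\<zeta>\<close> by less than
    \<open>\<delta>\<close>.\<close>
  ultimately have "eventually (\<lambda>t. (H t - H 0) / t > D - \<delta> / 2 \<and> t * norm c < d \<and> t * B < \<delta> \<and> 0 < t) (at_right 0)"
    by eventually_elim auto
  then obtain t where t: "(H t - H 0) / t > D - \<delta> / 2" "t * norm c < d" "t * B < \<delta>" "0 < t"
    using eventually_happens'[OF trivial_limit_at_right_real] by blast
  have shift_in: "x - s *\<^sub>R c \<in> \<Omega>" if "x \<in> K" "0 \<le> s" "s \<le> t" for x s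
  proof -
    have "norm (s *\<^sub>R c) \<le> t * norm c" using that by (simp add: mult_right_mono)
    then have "x - s *\<^sub>R c \<in> ball x d" using t(2) by (simp add: dist_norm)
    then show ?thesis using d(2) that(1) by blast
  qed
  define W where "W x = U (x - t *\<^sub>R c) - U x" for x
  \<comment> \<open>The value \<open>0\<close> where the denominator vanishes is harmless, since
    \<open>W\<close> is zero there and so is the increment of the truncation.\<close>
  define m where "m x = (if U (x - t *\<^sub>R c) = U x then 0
    else (clip a b (U (x - t *\<^sub>R c)) - clip a b (U x)) / (U (x - t *\<^sub>R c) - U x))" for x
  have [measurable]: "m \<in> borel_measurable borel" unfolding m_def by measurable
  have m01: "0 \<le> m x" "m x \<le> 1" for x using clip_secant by (auto simp: m_def)
  have Ut: "integrable lborel (\<lambda>x. U (x - t *\<^sub>R c))"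
    using lborel_integrable_translate[OF U, of "- t *\<^sub>R c"] by simp
  then have W: "integrable lborel W" unfolding W_def using U by simp
  have [measurable]: "W \<in> borel_measurable borel" using W by simp
  have Vt: "integrable lborel (\<lambda>x. V (x - t *\<^sub>R c))"
    using lborel_integrable_translate[OF V, of "- t *\<^sub>R c"] by simp
  have Ht: "H t = (LINT x|lborel. V (x - t *\<^sub>R c) * \<zeta> x)"
    unfolding H_def
    using lborel_integral_translate[of "\<lambda>x. V x * \<zeta> (x + t *\<^sub>R c)" "- t *\<^sub>R c"] by simp
  have "H t - H 0 = (LINT x|lborel. V (x - t *\<^sub>R c) * \<zeta> x - V x * \<zeta> x)"
    unfolding Ht unfolding H_def using A(2)
    by (subst Bochner_Integration.integral_diff)
      (auto intro!: integrable_times_bounded[OF V] integrable_times_bounded[OF Vt])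
  also have "\<dots> = (LINT x|lborel. W x * (m x * \<zeta> x))"
  proof (rule Bochner_Integration.integral_cong)
    fix x
    \<comment> \<open>On \<open>K\<close> both \<open>x\<close> and its translate lie in
      \<open>\<Omega>\<close>, so the indicators disappear; off \<open>K\<close> the factor
      \<open>\<zeta> x\<close> is zero.\<close>
    show "V (x - t *\<^sub>R c) * \<zeta> x - V x * \<zeta> x = W x * (m x * \<zeta> x)"
    proof (cases "x \<in> K")
      case True
      then have "V (x - t *\<^sub>R c) = clip a b (U (x - t *\<^sub>R c))" "V x = clip a b (U x)"
        using shift_in[OF True, of t] K(2) t(4) by (auto simp: V_def)
      moreover have "W x * m x = clip a b (U (x - t *\<^sub>R c)) - clip a b (U x)"
        by (simp add: W_def m_def)
      ultimately show ?thesis by (metis left_diff_distrib mult.assoc)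
    next
      case False
      then show ?thesis using K(3) by simp
    qed
  qed simp
  finally have HW: "H t - H 0 = (LINT x|lborel. W x * (m x * \<zeta> x))" .
  obtain g where g: "\<And>k::nat. continuous_on UNIV (g k)" and glim: "AE x in lborel. (\<lambda>k. g k x) \<longlonglongrightarrow> m x"
    using borel_measurable_AE_limit_continuous[of m] by auto
  \<comment> \<open>Truncating the continuous approximants of \<open>m\<close> to the unit interval
    keeps \<open>\<bar>\<phi> k\<bar> \<le> \<bar>\<zeta>\<bar>\<close> and does not disturb the
    limit, as \<open>m\<close> takes values there.\<close>
  define \<phi> where "\<phi> k x = clip 0 1 (g k x) * \<zeta> x" for k x
  have \<phi>_le: "\<bar>\<phi> k x\<bar> \<le> \<bar>\<zeta> x\<bar>" for k x
    by (auto simp: \<phi>_def clip_def abs_mult intro!: mult_left_le_one_le)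
  have "\<phi> k \<in> C0 \<Omega>" for k
    using g[of k] test_functions_continuous[OF \<zeta>] K(2,3) unfolding C0_iff[OF open_\<Omega> bounded_\<Omega>] \<phi>_def clip_def
    by (auto intro!: continuous_intros)
  then have "\<exists>\<psi>\<in>test_functions \<Omega>. \<forall>x. \<bar>\<psi> x\<bar> \<le> \<bar>\<phi> k x\<bar> \<and> \<bar>\<psi> x - \<phi> k x\<bar> \<le> 1 / Suc k" for k
    by (intro test_functions_dense open_\<Omega> bounded_\<Omega>) auto
  then obtain \<psi> where \<psi>: "\<And>k. \<psi> k \<in> test_functions \<Omega>" "\<And>k x. \<bar>\<psi> k x\<bar> \<le> \<bar>\<phi> k x\<bar>"
    "\<And>k x. \<bar>\<psi> k x - \<phi> k x\<bar> \<le> 1 / Suc k" by metis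
  have \<psi>_le: "\<bar>\<psi> k x\<bar> \<le> \<bar>\<zeta> x\<bar>" for k x using \<psi>(2) \<phi>_le order_trans by blast
  have [measurable]: "\<psi> k \<in> borel_measurable borel" for k by (rule test_functions_measurable[OF \<psi>(1)])
  have "(\<lambda>k. LINT x|lborel. W x * \<psi> k x) \<longlonglongrightarrow> (LINT x|lborel. W x * (m x * \<zeta> x))"
  proof (rule integral_dominated_convergence[where w = "\<lambda>x. \<bar>W x\<bar> * A"])
    show "(\<lambda>x. W x * (m x * \<zeta> x)) \<in> borel_measurable lborel" by measurable
    show "(\<lambda>x. W x * \<psi> k x) \<in> borel_measurable lborel" for k by measurable
    show "integrable lborel (\<lambda>x. \<bar>W x\<bar> * A)" using W by simp
    show "AE x in lborel. (\<lambda>k. W x * \<psi> k x) \<longlonglongrightarrow> W x * (m x * \<zeta> x)"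
      using glim
    proof eventually_elim
      case (elim x)
      have "(\<lambda>k. \<phi> k x) \<longlonglongrightarrow> clip 0 1 (m x) * \<zeta> x"
        unfolding \<phi>_def clip_def by (intro tendsto_intros elim)
      moreover have "clip 0 1 (m x) = m x" using m01[of x] by (simp add: clip_def)
      moreover have "(\<lambda>k. \<psi> k x - \<phi> k x) \<longlonglongrightarrow> 0"
        by (rule tendsto_rabs_zero_cancel, rule tendsto_sandwich[OF _ _ tendsto_const lim_1_over_n[THEN LIMSEQ_Suc]])
          (use \<psi>(3) in auto)
      ultimately have "(\<lambda>k. \<phi> k x + (\<psi> k x - \<phi> k x)) \<longlonglongrightarrow> m x * \<zeta> x + 0"
        by (intro tendsto_add) auto
      then show ?case by (intro tendsto_mult_left) simp
    qed
    show "AE x in lborel. norm (W x * \<psi> k x) \<le> \<bar>W x\<bar> * A" for k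
      using \<psi>_le[of k] A(2) by (intro AE_I2) (auto simp: abs_mult intro!: mult_left_mono intro: order_trans)
  qed
  \<comment> \<open>The tolerance carries the factor \<open>t\<close> because the estimate is
    divided by \<open>t\<close> at the end.\<close>
  then have "eventually (\<lambda>k. (LINT x|lborel. W x * \<psi> k x) > (LINT x|lborel. W x * (m x * \<zeta> x)) - t * \<delta> / 2) sequentially"
    using t(4) \<open>\<delta> > 0\<close> by (intro order_tendstoD) auto
  then obtain k where k: "(LINT x|lborel. W x * \<psi> k x) > (LINT x|lborel. W x * (m x * \<zeta> x)) - t * \<delta> / 2"
    by (auto simp: eventually_sequentially)
  define G where "G s = (LINT x|lborel. U x * \<psi> k (x + s *\<^sub>R c))" for s
  have "(LINT x|lborel. W x * \<psi> k x) = (LINT x|lborel. U (x - t *\<^sub>R c) * \<psi> k x) - (LINT x|lborel. U x * \<psi> k x)"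
    using order_trans[OF \<psi>_le A(2)[simplified]] unfolding W_def left_diff_distrib
    by (subst Bochner_Integration.integral_diff)
      (auto intro!: integrable_times_bounded[OF U] integrable_times_bounded[OF Ut])
  also have "(LINT x|lborel. U (x - t *\<^sub>R c) * \<psi> k x) = G t"
    unfolding G_def
    using lborel_integral_translate[of "\<lambda>x. U x * \<psi> k (x + t *\<^sub>R c)" "- t *\<^sub>R c"] by simp
  also have "(LINT x|lborel. U x * \<psi> k x) = G 0" by (simp add: G_def)
  finally have WG: "(LINT x|lborel. W x * \<psi> k x) = G t - G 0" .
  \<comment> \<open>The intermediate translation satisfies \<open>z < t\<close>, so the translated
    test function is still supported in \<open>\<Omega>\<close> and differs little in size from
    \<open>\<zeta>\<close>.\<close>
  have "\<exists>z. 0 < z \<and> z < t \<and> G t - G 0 = (t - 0) * (LINT x|lborel. U x * frechet_derivative (\<psi> k) (at (x + z *\<^sub>R c)) c)"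
    using pairing_line_derivative[OF U \<psi>(1)] t(4) unfolding G_def by (intro MVT2) auto
  then obtain z where z: "0 < z" "z < t"
    "G t - G 0 = t * (LINT x|lborel. U x * frechet_derivative (\<psi> k) (at (x + z *\<^sub>R c)) c)" by auto
  define \<psi>' where "\<psi>' x = \<psi> k (x + z *\<^sub>R c)" for x
  have "\<psi> k x = 0" if "x \<notin> K" for x using \<psi>_le[of k x] K(3)[OF that] by simp
  then have "\<psi>' \<in> test_functions \<Omega>"
    unfolding \<psi>'_def[abs_def]
    using shift_in z K(1) by (intro test_functions_translate[OF \<psi>(1)]) auto
  moreover have "\<bar>\<psi>' x\<bar> \<le> \<bar>\<zeta> x\<bar> + \<delta>" for x
  proof -
    have "\<bar>\<psi>' x\<bar> \<le> \<bar>\<zeta> (x + z *\<^sub>R c)\<bar>" using \<psi>_le by (simp add: \<psi>'_def)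
    moreover have "\<bar>\<zeta> (x + z *\<^sub>R c) - \<zeta> x\<bar> \<le> B * z"
      using test_functions_line_diff[OF \<zeta> B(2), of x z 0] z(1) by simp
    moreover have "B * z \<le> B * t" using z B(1) by simp
    ultimately show ?thesis using t(3) by (simp add: mult.commute)
  qed
  moreover have "D \<le> (LINT x|lborel. U x * frechet_derivative \<psi>' (at x) c) + \<delta>"
  proof -
    have "t * D - t * \<delta> / 2 < H t - H 0" using t(1,4) by (simp add: field_simps)
    also have "\<dots> < G t - G 0 + t * \<delta> / 2" using k WG HW by simp
    also have "G t - G 0 = t * (LINT x|lborel. U x * frechet_derivative \<psi>' (at x) c)"
      unfolding z(3) \<psi>'_def[abs_def] frechet_derivative_translate[OF \<psi>(1)] ..
    finally have "t * D < t * ((LINT x|lborel. U x * frechet_derivative \<psi>' (at x) c) + \<delta>)"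
      by (simp add: algebra_simps)
    then show ?thesis using t(4) by simp
  qed
  ultimately show ?thesis unfolding D_def V_def by blast
qed

end

section \<open>Divergence of fields of test functions\<close>

lemma divergence_component:
  assumes \<phi>: "\<phi> \<in> test_functions \<Omega>"
  shows "divergence \<phi> x = (\<Sum>i\<in>UNIV. partial_deriv i (\<lambda>x. \<phi> x $ i) x)"
proof -
  have "partial_deriv i (\<lambda>x. \<phi> x $ i) x = partial_deriv i \<phi> x $ i" for i
    by (rule partial_deriv_eq)
      (rule bounded_linear.has_derivative[OF bounded_linear_vec_nth test_functions_has_derivative[OF \<phi>]])
  then show ?thesis by (simp add: divergence_def)
qed

lemma component_test_functions:
  "\<phi> \<in> test_functions \<Omega> \<Longrightarrow> (\<lambda>x. \<phi> x $ i) \<in> test_functions \<Omega>"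
  by (rule test_functions_bounded_linear[OF bounded_linear_vec_nth])

lemma divergence_test_functions:
  assumes \<phi>: "\<phi> \<in> test_functions \<Omega>"
  shows "divergence \<phi> \<in> test_functions \<Omega>"
proof -
  have "divergence \<phi> = (\<lambda>x. \<Sum>i\<in>UNIV. partial_deriv i (\<lambda>x. \<phi> x $ i) x)"
    using divergence_component[OF \<phi>] by (rule ext)
  then show ?thesis
    using test_functions_sum[OF partial_deriv_test_functions[OF component_test_functions[OF \<phi>]]] by simp
qed

lemma scaleR_test_functions:
  "\<psi> \<in> test_functions \<Omega> \<Longrightarrow> (\<lambda>x. \<psi> x *\<^sub>R c) \<in> test_functions \<Omega>"
  by (rule test_functions_bounded_linear[OF bounded_linear_scaleR_left])

lemma divergence_scaleR_const:
  assumes \<psi>: "\<psi> \<in> test_functions \<Omega>"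
  shows "divergence (\<lambda>x. \<psi> x *\<^sub>R c) x = frechet_derivative \<psi> (at x) c"
proof -
  have lin: "linear (frechet_derivative \<psi> (at x))"
    using test_functions_has_derivative[OF \<psi>] by (rule has_derivative_linear)
  have "partial_deriv i (\<lambda>x. \<psi> x *\<^sub>R c) x = partial_deriv i \<psi> x *\<^sub>R c" for i
    by (rule partial_deriv_eq)
      (rule bounded_linear.has_derivative[OF bounded_linear_scaleR_left test_functions_has_derivative[OF \<psi>]])
  then have "divergence (\<lambda>x. \<psi> x *\<^sub>R c) x = (\<Sum>i\<in>UNIV. c $ i *\<^sub>R partial_deriv i \<psi> x)"
    by (simp add: divergence_def mult.commute)
  also have "\<dots> = frechet_derivative \<psi> (at x) (\<Sum>i\<in>UNIV. c $ i *\<^sub>R axis i 1)"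
    by (simp add: linear_sum[OF lin] linear_cmul[OF lin])
  also have "\<dots> = frechet_derivative \<psi> (at x) c"
    by (simp add: basis_expansion flip: scalar_mult_eq_scaleR)
  finally show ?thesis .
qed

lemma divergence_add:
  assumes "\<phi> \<in> test_functions \<Omega>" "\<psi> \<in> test_functions \<Omega>"
  shows "divergence (\<lambda>x. \<phi> x + \<psi> x) x = divergence \<phi> x + divergence \<psi> x"
proof -
  have "partial_deriv i (\<lambda>x. \<phi> x + \<psi> x) x = partial_deriv i \<phi> x + partial_deriv i \<psi> x" for i
    by (rule partial_deriv_eq[OF has_derivative_add[OF assms[THEN test_functions_has_derivative]]])
  then show ?thesis by (simp add: divergence_def sum.distrib)
qed

lemma divergence_scale:
  assumes "\<phi> \<in> test_functions \<Omega>"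
  shows "divergence (\<lambda>x. r *\<^sub>R \<phi> x) x = r * divergence \<phi> x"
proof -
  have "partial_deriv i (\<lambda>x. r *\<^sub>R \<phi> x) x = r *\<^sub>R partial_deriv i \<phi> x" for i
    by (rule partial_deriv_eq[OF has_derivative_scaleR_right[OF test_functions_has_derivative[OF assms]]])
  then show ?thesis by (simp add: divergence_def sum_distrib_left)
qed

lemma finite_net_unit_ball:
  assumes "0 < \<delta>"
  obtains C :: "'a::euclidean_space set" where "finite C" "cball 0 1 \<subseteq> (\<Union>c\<in>C. ball c \<delta>)"
proof -
  have "compact (cball (0 :: 'a) 1)" by simp
  then show thesis using that assms unfolding compact_eq_totally_bounded by blast
qed

section \<open>From one direction to vector fields\<close>

context bounded_open
begin

lemma test_functions_integrable_mult:
  fixes u :: "real ^ 'n \<Rightarrow> real"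
  assumes u: "integrable (lebesgue_on \<Omega>) u" and \<phi>: "\<phi> \<in> test_functions \<Omega>"
  shows "integrable (lebesgue_on \<Omega>) (\<lambda>x. u x * \<phi> x)"
proof -
  obtain B where "\<And>x. norm (\<phi> x) \<le> B" using test_functions_bounded[OF \<phi>] by blast
  moreover have "\<phi> \<in> borel_measurable (lebesgue_on \<Omega>)"
    using test_functions_measurable[OF \<phi>]
    by (intro measurable_restrict_space1 measurable_completion) simp
  ultimately show ?thesis by (intro integrable_times_bounded[OF u]) auto
qed

text \<open>Moves integrals over \<open>\<Omega>\<close> to the whole space with a Borel integrand,
  the setting of the translation argument.\<close>

lemma integral_lebesgue_on_eq_lborel:
  fixes f :: "real ^ 'n \<Rightarrow> real"
  assumes f: "f \<in> borel_measurable (lebesgue_on \<Omega>)" and F: "F \<in> borel_measurable borel"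
    and eq: "AE x in lebesgue_on \<Omega>. f x = F x"
  shows "(LINT x|lebesgue_on \<Omega>. f x) = (LINT x|lborel. indicator \<Omega> x * F x)"
proof -
  have F': "F \<in> borel_measurable lebesgue" using F by (intro measurable_completion) simp
  have "(LINT x|lebesgue_on \<Omega>. f x) = (LINT x|lebesgue_on \<Omega>. F x)"
    using f measurable_restrict_space1[OF F'] eq by (rule integral_cong_AE)
  also have "\<dots> = (LINT x|lebesgue. indicator \<Omega> x * F x)"
    by (subst integral_restrict_space) auto
  also have "\<dots> = (LINT x|lborel. indicator \<Omega> x * F x)"
    by (rule integral_completion) (use F in measurable)
  finally show ?thesis .
qed

text \<open>A function on \<open>\<Omega>\<close> is Lebesgue measurable with irrelevant values
  elsewhere; for translations it is replaced by a Borel function extended by zero.\<close>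

lemma integrable_lebesgue_on_borel_representative:
  fixes u :: "real ^ 'n \<Rightarrow> real"
  assumes u: "integrable (lebesgue_on \<Omega>) u"
  obtains U where "integrable lborel U" "AE x in lebesgue_on \<Omega>. u x = U x" "\<And>x. x \<notin> \<Omega> \<Longrightarrow> U x = 0"
proof -
  have int: "integrable lebesgue (\<lambda>x. indicator \<Omega> x * u x)"
    using u by (subst (asm) integrable_restrict_space) auto
  then obtain U where U: "U \<in> borel_measurable lborel" and eq: "AE x in lborel. indicator \<Omega> x * u x = U x"
    using completion_ex_borel_measurable_real[of "\<lambda>x. indicator \<Omega> x * u x" lborel] by auto
  have [measurable]: "U \<in> borel_measurable borel" using U by simp
  define V where "V x = indicator \<Omega> x * U x" for x
  have [measurable]: "V \<in> borel_measurable borel" unfolding V_def by measurable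
  have eq': "AE x in lebesgue. indicator \<Omega> x * u x = V x"
    using AE_completion[OF eq] by eventually_elim (auto simp: V_def indicator_def)
  have "integrable lebesgue V"
    using int by (rule integrable_cong_AE_imp)
      (use eq' in \<open>auto intro: measurable_completion elim: eventually_mono\<close>)
  then have "integrable lborel V" by (simp add: integrable_completion)
  moreover have "AE x in lebesgue_on \<Omega>. u x = V x"
    using eq' by (subst AE_restrict_space_iff) (auto elim: eventually_mono)
  ultimately show thesis using that[of V] by (simp add: V_def)
qed

lemma clip_measurable_lebesgue_on:
  "u \<in> borel_measurable (lebesgue_on \<Omega>) \<Longrightarrow> (\<lambda>x. clip a b (u x)) \<in> borel_measurable (lebesgue_on \<Omega>)"
  using measurable_compose[OF _ clip_measurable] .

lemma clip_integrable:
  assumes "u \<in> borel_measurable (lebesgue_on \<Omega>)"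
  shows "integrable (lebesgue_on \<Omega>) (\<lambda>x. clip a b (u x))"
  using clip_measurable_lebesgue_on[OF assms] clip_bounded
  by (intro integrable_const_bound[of _ "\<bar>a\<bar> + \<bar>b\<bar>"]) auto

lemma clip_directional_derivative:
  fixes u :: "real ^ 'n \<Rightarrow> real"
  assumes u: "integrable (lebesgue_on \<Omega>) u" and \<zeta>: "\<zeta> \<in> test_functions \<Omega>" and "\<delta> > 0"
  shows "\<exists>\<psi>\<in>test_functions \<Omega>. (\<forall>x. \<bar>\<psi> x\<bar> \<le> \<bar>\<zeta> x\<bar> + \<delta>) \<and>
    (LINT x|lebesgue_on \<Omega>. clip a b (u x) * divergence (\<lambda>x. \<zeta> x *\<^sub>R c) x)
      \<le> (LINT x|lebesgue_on \<Omega>. u x * divergence (\<lambda>x. \<psi> x *\<^sub>R c) x) + \<delta>"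
proof -
  obtain U where U: "integrable lborel U" and eq: "AE x in lebesgue_on \<Omega>. u x = U x"
    and U0: "\<And>x. x \<notin> \<Omega> \<Longrightarrow> U x = 0"
    using integrable_lebesgue_on_borel_representative[OF u] by blast
  have [measurable]: "U \<in> borel_measurable borel" using U by simp
  have meas: "divergence (\<lambda>x. \<psi> x *\<^sub>R c) \<in> borel_measurable borel" if "\<psi> \<in> test_functions \<Omega>" for \<psi>
    by (rule test_functions_measurable[OF divergence_test_functions[OF scaleR_test_functions[OF that]]])
  obtain \<psi> where \<psi>: "\<psi> \<in> test_functions \<Omega>" "\<forall>x. \<bar>\<psi> x\<bar> \<le> \<bar>\<zeta> x\<bar> + \<delta>"
    and le: "(LINT x|lborel. indicator \<Omega> x * clip a b (U x) * frechet_derivative \<zeta> (at x) c)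
      \<le> (LINT x|lborel. U x * frechet_derivative \<psi> (at x) c) + \<delta>"
    using clip_directional_derivative_lborel[OF U \<zeta> \<open>\<delta> > 0\<close>] by blast
  have "(LINT x|lebesgue_on \<Omega>. clip a b (u x) * divergence (\<lambda>x. \<zeta> x *\<^sub>R c) x)
      = (LINT x|lborel. indicator \<Omega> x * (clip a b (U x) * divergence (\<lambda>x. \<zeta> x *\<^sub>R c) x))"
  proof (rule integral_lebesgue_on_eq_lborel)
    show "(\<lambda>x. clip a b (u x) * divergence (\<lambda>x. \<zeta> x *\<^sub>R c) x) \<in> borel_measurable (lebesgue_on \<Omega>)"
      using test_functions_integrable_mult[OF clip_integrable divergence_test_functions[OF scaleR_test_functions[OF \<zeta>]]] u
      by blast
    show "AE x in lebesgue_on \<Omega>. clip a b (u x) * divergence (\<lambda>x. \<zeta> x *\<^sub>R c) x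
        = clip a b (U x) * divergence (\<lambda>x. \<zeta> x *\<^sub>R c) x"
      using eq by eventually_elim simp
  qed (use meas[OF \<zeta>] in measurable)
  also have "\<dots> = (LINT x|lborel. indicator \<Omega> x * clip a b (U x) * frechet_derivative \<zeta> (at x) c)"
    by (simp add: divergence_scaleR_const[OF \<zeta>] mult.assoc)
  also note le
  also have "(LINT x|lborel. U x * frechet_derivative \<psi> (at x) c)
      = (LINT x|lborel. indicator \<Omega> x * (U x * divergence (\<lambda>x. \<psi> x *\<^sub>R c) x))"
    using U0 by (intro Bochner_Integration.integral_cong)
      (auto simp: divergence_scaleR_const[OF \<psi>(1)] indicator_def)
  also have "\<dots> = (LINT x|lebesgue_on \<Omega>. u x * divergence (\<lambda>x. \<psi> x *\<^sub>R c) x)"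
  proof (rule integral_lebesgue_on_eq_lborel[symmetric])
    show "(\<lambda>x. u x * divergence (\<lambda>x. \<psi> x *\<^sub>R c) x) \<in> borel_measurable (lebesgue_on \<Omega>)"
      using test_functions_integrable_mult[OF u divergence_test_functions[OF scaleR_test_functions[OF \<psi>(1)]]]
      by blast
    show "AE x in lebesgue_on \<Omega>. u x * divergence (\<lambda>x. \<psi> x *\<^sub>R c) x
        = U x * divergence (\<lambda>x. \<psi> x *\<^sub>R c) x"
      using eq by eventually_elim simp
  qed (use meas[OF \<psi>(1)] in measurable)
  finally show ?thesis using \<psi> by blast
qed

text \<open>Minus the action of the distributional gradient of \<open>u\<close> on the field
  \<open>\<phi>\<close>.\<close>

definition pairing :: "(real ^ 'n \<Rightarrow> real) \<Rightarrow> (real ^ 'n \<Rightarrow> real ^ 'n) \<Rightarrow> real" where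
  "pairing u \<phi> = (LINT x|lebesgue_on \<Omega>. u x * divergence \<phi> x)"

lemma pairing_add:
  assumes u: "integrable (lebesgue_on \<Omega>) u" and "\<phi> \<in> test_functions \<Omega>" "\<psi> \<in> test_functions \<Omega>"
  shows "pairing u (\<lambda>x. \<phi> x + \<psi> x) = pairing u \<phi> + pairing u \<psi>"
  using test_functions_integrable_mult[OF u divergence_test_functions] assms(2,3)
  by (simp add: pairing_def divergence_add distrib_left)

lemma pairing_scale:
  assumes "\<phi> \<in> test_functions \<Omega>"
  shows "pairing u (\<lambda>x. r *\<^sub>R \<phi> x) = r * pairing u \<phi>"
  using assms by (simp add: pairing_def divergence_scale mult.left_commute)

lemma pairing_sum:
  assumes u: "integrable (lebesgue_on \<Omega>) u" and "\<And>i. i \<in> I \<Longrightarrow> \<phi> i \<in> test_functions \<Omega>"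
  shows "pairing u (\<lambda>x. \<Sum>i\<in>I. \<phi> i x) = (\<Sum>i\<in>I. pairing u (\<phi> i))"
proof -
  have zero: "pairing u (\<lambda>_. 0) = 0"
    using pairing_scale[OF test_functions_zero, of u 0] by simp
  show ?thesis
    using assms(2)
    by (induction I rule: infinite_finite_induct)
      (auto simp: zero pairing_add[OF u _ test_functions_sum])
qed

lemma BV_D:
  assumes "u \<in> BV \<Omega>"
  shows "integrable (lebesgue_on \<Omega>) u" "bdd_above (BV_values \<Omega> u)"
  using assms by (auto simp: BV_def)

lemma zero_in_BV_values: "0 \<in> BV_values \<Omega> u"
proof -
  have "pairing u (\<lambda>_. 0) = 0"
    using pairing_scale[OF test_functions_zero, of u 0] by simp
  then show ?thesis
    using test_functions_zero by (auto simp: BV_values_def pairing_def intro!: exI[of _ "\<lambda>_. 0"])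
qed

lemma BV_seminorm_nonneg: "u \<in> BV \<Omega> \<Longrightarrow> 0 \<le> BV_seminorm \<Omega> u"
  unfolding BV_seminorm_def by (rule cSup_upper[OF zero_in_BV_values BV_D(2)])

lemma pairing_le_BV_seminorm:
  assumes u: "u \<in> BV \<Omega>" and \<phi>: "\<phi> \<in> test_functions \<Omega>" and B: "0 < B" "\<And>x. norm (\<phi> x) \<le> B"
  shows "pairing u \<phi> \<le> B * BV_seminorm \<Omega> u"
proof -
  have "pairing u (\<lambda>x. (1 / B) *\<^sub>R \<phi> x) \<in> BV_values \<Omega> u"
    using B test_functions_scale[OF \<phi>, of "1 / B"] by (auto simp: BV_values_def pairing_def)
  then have "pairing u (\<lambda>x. (1 / B) *\<^sub>R \<phi> x) \<le> BV_seminorm \<Omega> u"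
    unfolding BV_seminorm_def using BV_D(2)[OF u] by (rule cSup_upper)
  then show ?thesis using B(1) by (simp add: pairing_scale[OF \<phi>] field_simps)
qed

text \<open>The field is split into its \<open>n\<close> coordinate fields, each bounded by
  \<open>B\<close>, and the directional estimate is applied to each of them.\<close>

lemma pairing_clip_le_crude:
  fixes u :: "real ^ 'n \<Rightarrow> real"
  assumes u: "u \<in> BV \<Omega>" and \<phi>: "\<phi> \<in> test_functions \<Omega>" and B: "0 \<le> B" "\<And>x. norm (\<phi> x) \<le> B"
  shows "pairing (\<lambda>x. clip a b (u x)) \<phi> \<le> CARD('n) * (B * BV_seminorm \<Omega> u)"
proof -
  have int: "integrable (lebesgue_on \<Omega>) (\<lambda>x. clip a b (u x))"
    using clip_integrable BV_D(1)[OF u] by blast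
  have comp: "(\<lambda>x. \<phi> x $ i) \<in> test_functions \<Omega>" for i by (rule component_test_functions[OF \<phi>])
  have dir: "(\<lambda>x. (\<phi> x $ i) *\<^sub>R (axis i 1 :: real ^ 'n)) \<in> test_functions \<Omega>" for i
    by (rule scaleR_test_functions[OF comp])
  have "pairing (\<lambda>x. clip a b (u x)) (\<lambda>x. (\<phi> x $ i) *\<^sub>R axis i 1) \<le> B * BV_seminorm \<Omega> u" for i
  proof (rule field_le_epsilon)
    fix e :: real assume "e > 0"
    \<comment> \<open>The error is \<open>\<delta> * BV_seminorm \<Omega> u\<close> from the
      enlarged bound \<open>B + \<delta>\<close> plus the additive \<open>\<delta>\<close>; the
      denominator adds up both.\<close>
    define \<delta> where "\<delta> = e / (BV_seminorm \<Omega> u + 1)"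
    have "BV_seminorm \<Omega> u + 1 > 0" using BV_seminorm_nonneg[OF u] by simp
    then have \<delta>: "\<delta> > 0" "\<delta> * (BV_seminorm \<Omega> u + 1) = e"
      using \<open>e > 0\<close> by (simp_all add: \<delta>_def)
    obtain \<psi> where \<psi>: "\<psi> \<in> test_functions \<Omega>" "\<And>x. \<bar>\<psi> x\<bar> \<le> \<bar>\<phi> x $ i\<bar> + \<delta>"
      and le: "pairing (\<lambda>x. clip a b (u x)) (\<lambda>x. (\<phi> x $ i) *\<^sub>R axis i 1)
        \<le> pairing u (\<lambda>x. \<psi> x *\<^sub>R axis i 1) + \<delta>"
      using clip_directional_derivative[OF BV_D(1)[OF u] comp \<delta>(1)] unfolding pairing_def by blast
    have "norm (\<psi> x *\<^sub>R (axis i 1 :: real ^ 'n)) \<le> B + \<delta>" for x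
      using \<psi>(2)[of x] component_le_norm_cart[of "\<phi> x" i] B(2)[of x] by (simp add: norm_axis_1)
    then have "pairing u (\<lambda>x. \<psi> x *\<^sub>R axis i 1) \<le> (B + \<delta>) * BV_seminorm \<Omega> u"
      using B(1) \<delta>(1) by (intro pairing_le_BV_seminorm[OF u scaleR_test_functions[OF \<psi>(1)]]) auto
    then show "pairing (\<lambda>x. clip a b (u x)) (\<lambda>x. (\<phi> x $ i) *\<^sub>R axis i 1) \<le> B * BV_seminorm \<Omega> u + e"
      using le \<delta>(2) by (simp add: distrib_right distrib_left)
  qed
  then have "(\<Sum>i\<in>UNIV. pairing (\<lambda>x. clip a b (u x)) (\<lambda>x. (\<phi> x $ i) *\<^sub>R axis i 1))
      \<le> (\<Sum>i\<in>(UNIV :: 'n set). B * BV_seminorm \<Omega> u)"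
    by (intro sum_mono)
  moreover have "\<phi> = (\<lambda>x. \<Sum>i\<in>UNIV. (\<phi> x $ i) *\<^sub>R axis i 1)"
    by (simp add: basis_expansion flip: scalar_mult_eq_scaleR)
  then have "pairing (\<lambda>x. clip a b (u x)) \<phi>
      = (\<Sum>i\<in>UNIV. pairing (\<lambda>x. clip a b (u x)) (\<lambda>x. (\<phi> x $ i) *\<^sub>R axis i 1))"
    using pairing_sum[OF int, of UNIV "\<lambda>i x. (\<phi> x $ i) *\<^sub>R axis i 1"] dir by simp
  ultimately show ?thesis by simp
qed

text \<open>
  The coordinatewise bound loses a factor \<open>n\<close>. It suffices, however, for the error in approximating
  a field \<open>\<phi>\<close> by \<open>\<Sum>c. \<zeta>\<^sub>c c\<close> with \<open>\<zeta>\<^sub>c \<ge> 0\<close> and \<open>\<Sum>c. \<zeta>\<^sub>c \<le> 1\<close>, to which the directional estimate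
  applies term by term. The weights come from a partition of unity on the unit ball, in the values of \<open>\<phi>\<close>.
\<close>

lemma field_directional_decomposition:
  fixes \<phi> :: "real ^ 'n \<Rightarrow> real ^ 'n"
  assumes \<phi>: "\<phi> \<in> test_functions \<Omega>" and \<phi>1: "\<And>x. norm (\<phi> x) \<le> 1" and "0 < \<delta>"
  obtains C :: "(real ^ 'n) set" and \<zeta> where "finite C" "\<And>c. c \<in> C \<Longrightarrow> \<zeta> c \<in> test_functions \<Omega>"
    "\<And>x. (\<Sum>c\<in>C. \<bar>\<zeta> c x\<bar>) \<le> 1"
    "\<And>x. norm (\<phi> x - (\<Sum>c\<in>C. \<zeta> c x *\<^sub>R sgn c)) \<le> 3 * \<delta>"
proof -
  obtain C :: "(real ^ 'n) set" where C: "finite C" "cball 0 1 \<subseteq> (\<Union>c\<in>C. ball c \<delta>)"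
    using finite_net_unit_ball[OF \<open>0 < \<delta>\<close>] .
  \<comment> \<open>Hat functions on the balls of the net; dividing them by their sum gives the
    partition of unity.\<close>
  define b where "b c v = max 0 (\<delta> - norm (v - c))" for c v :: "real ^ 'n"
  define S where "S v = (\<Sum>c\<in>C. b c v)" for v
  have b0: "0 \<le> b c v" for c v by (simp add: b_def)
  have S_pos: "S v > 0" if "norm v \<le> 1" for v
  proof -
    have "v \<in> cball 0 1" using that by simp
    then obtain c where c: "c \<in> C" "v \<in> ball c \<delta>" using C(2) by blast
    then have "0 < b c v" by (simp add: b_def dist_norm norm_minus_commute)
    also have "\<dots> \<le> S v" unfolding S_def using C(1) c(1) b0 by (intro member_le_sum) auto
    finally show ?thesis .
  qed
  define \<theta> where "\<theta> c x = b c (\<phi> x) / S (\<phi> x)" for c x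
  have \<theta>0: "0 \<le> \<theta> c x" for c x using b0 S_pos[OF \<phi>1, of x] by (simp add: \<theta>_def)
  have \<theta>_sum: "(\<Sum>c\<in>C. \<theta> c x) = 1" for x
    using S_pos[OF \<phi>1, of x] by (simp add: \<theta>_def S_def flip: sum_divide_distrib)
  have cont: "continuous_on UNIV \<phi>" by (rule test_functions_continuous[OF \<phi>])
  \<comment> \<open>The factor \<open>norm (\<phi> x)\<close> makes the weights vanish outside
    \<open>\<Omega>\<close>, as the weights of the partition alone do not, and it allows the net
    points to be replaced by their unit directions \<open>sgn c\<close>.\<close>
  have "continuous_on UNIV (\<lambda>x. \<theta> c x * norm (\<phi> x))" for c
    unfolding \<theta>_def S_def b_def
    by (intro continuous_intros cont) (use S_pos[OF \<phi>1] in \<open>auto simp: S_def b_def less_imp_neq[symmetric]\<close>)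
  moreover have "\<phi> x = 0" if "x \<notin> \<Omega>" for x using \<phi> that unfolding test_functions_iff by blast
  ultimately have C0: "(\<lambda>x. \<theta> c x * norm (\<phi> x)) \<in> C0 \<Omega>" for c
    by (simp add: C0_iff[OF open_\<Omega> bounded_\<Omega>])
  \<comment> \<open>The approximation errors of all weights together stay below
    \<open>\<delta>\<close>; adding \<open>1\<close> keeps the denominator positive.\<close>
  define \<eta> where "\<eta> = \<delta> / (card C + 1)"
  have \<eta>: "\<eta> > 0" "card C * \<eta> \<le> \<delta>" using \<open>0 < \<delta>\<close> by (auto simp: \<eta>_def field_simps)
  have "\<forall>c. \<exists>\<psi>\<in>test_functions \<Omega>. \<forall>x. \<bar>\<psi> x\<bar> \<le> \<bar>\<theta> c x * norm (\<phi> x)\<bar> \<and> \<bar>\<psi> x - \<theta> c x * norm (\<phi> x)\<bar> \<le> \<eta>"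
    using test_functions_dense[OF open_\<Omega> bounded_\<Omega> C0 \<eta>(1)] by blast
  then obtain \<zeta> where \<zeta>: "\<And>c. \<zeta> c \<in> test_functions \<Omega>" "\<And>c x. \<bar>\<zeta> c x\<bar> \<le> \<bar>\<theta> c x * norm (\<phi> x)\<bar>"
    "\<And>c x. \<bar>\<zeta> c x - \<theta> c x * norm (\<phi> x)\<bar> \<le> \<eta>"
    by metis
  show thesis
  proof (rule that[OF C(1)])
    show "\<zeta> c \<in> test_functions \<Omega>" for c by (rule \<zeta>(1))
    show "(\<Sum>c\<in>C. \<bar>\<zeta> c x\<bar>) \<le> 1" for x
    proof -
      have "(\<Sum>c\<in>C. \<bar>\<zeta> c x\<bar>) \<le> (\<Sum>c\<in>C. \<theta> c x * norm (\<phi> x))"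
        using \<zeta>(2)[of _ x] \<theta>0 by (intro sum_mono) (simp add: abs_mult)
      also have "\<dots> = norm (\<phi> x)" using \<theta>_sum by (simp flip: sum_distrib_right)
      finally show ?thesis using \<phi>1[of x] by simp
    qed
    show "norm (\<phi> x - (\<Sum>c\<in>C. \<zeta> c x *\<^sub>R sgn c)) \<le> 3 * \<delta>" for x
    proof -
      have "\<phi> x = (\<Sum>c\<in>C. \<theta> c x *\<^sub>R \<phi> x)" using \<theta>_sum by (simp flip: scaleR_sum_left)
      then have "norm (\<phi> x - (\<Sum>c\<in>C. \<zeta> c x *\<^sub>R sgn c)) = norm (\<Sum>c\<in>C. \<theta> c x *\<^sub>R \<phi> x - \<zeta> c x *\<^sub>R sgn c)"
        by (simp add: sum_subtractf)
      also have "\<dots> \<le> (\<Sum>c\<in>C. \<theta> c x * (2 * \<delta>) + \<eta>)"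
      proof (rule sum_norm_le)
        fix c assume "c \<in> C"
        have "norm (\<theta> c x *\<^sub>R (\<phi> x - norm (\<phi> x) *\<^sub>R sgn c)) \<le> \<theta> c x * (2 * \<delta>)"
        proof (cases "norm (\<phi> x - c) < \<delta>")
          case True
          have c: "norm c *\<^sub>R sgn c = c" by (cases "c = 0") (simp_all add: sgn_div_norm)
          \<comment> \<open>Where the weight is nonzero, one \<open>\<delta>\<close> comes from
            \<open>\<phi> x - c\<close> and another from the difference of the norms of
            \<open>c\<close> and \<open>\<phi> x\<close>.\<close>
          have "norm (\<phi> x - norm (\<phi> x) *\<^sub>R sgn c) = norm ((\<phi> x - c) + (norm c - norm (\<phi> x)) *\<^sub>R sgn c)"
            by (simp add: scaleR_diff_left c)
          also have "\<dots> \<le> norm (\<phi> x - c) + \<bar>norm c - norm (\<phi> x)\<bar> * norm (sgn c)"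
            by (rule norm_triangle_le) simp
          also have "\<bar>norm c - norm (\<phi> x)\<bar> * norm (sgn c) \<le> \<bar>norm c - norm (\<phi> x)\<bar> * 1"
            by (intro mult_left_mono) (simp_all add: norm_sgn)
          also have "\<bar>norm c - norm (\<phi> x)\<bar> * 1 \<le> norm (\<phi> x - c)"
            using norm_triangle_ineq3[of c "\<phi> x"] by (simp add: norm_minus_commute)
          finally show ?thesis using True \<theta>0 by (simp add: mult_left_mono)
        next
          case False
          then have "\<theta> c x = 0" by (simp add: \<theta>_def b_def)
          then show ?thesis by simp
        qed
        moreover have "norm ((\<theta> c x * norm (\<phi> x) - \<zeta> c x) *\<^sub>R sgn c) \<le> \<eta> * 1"
          using \<zeta>(3)[of c x] unfolding norm_scaleR
          by (intro mult_mono) (auto simp: norm_sgn abs_minus_commute)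
        moreover have "\<theta> c x *\<^sub>R \<phi> x - \<zeta> c x *\<^sub>R sgn c
            = \<theta> c x *\<^sub>R (\<phi> x - norm (\<phi> x) *\<^sub>R sgn c) + (\<theta> c x * norm (\<phi> x) - \<zeta> c x) *\<^sub>R sgn c"
          by (simp add: algebra_simps)
        ultimately show "norm (\<theta> c x *\<^sub>R \<phi> x - \<zeta> c x *\<^sub>R sgn c) \<le> \<theta> c x * (2 * \<delta>) + \<eta>"
          using norm_triangle_mono by fastforce
      qed
      also have "\<dots> = 2 * \<delta> + card C * \<eta>"
        using \<theta>_sum by (simp add: sum.distrib flip: sum_distrib_right)
      also have "\<dots> \<le> 3 * \<delta>" using \<eta>(2) by simp
      finally show ?thesis .
    qed
  qed
qed

text \<open>The directional estimates are summed before the seminorm of \<open>u\<close> is applied: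
  as the weights have total size at most \<open>1\<close>, the fields
  \<open>\<psi> c x *\<^sub>R sgn c\<close> add up to a single field of norm at most
  \<open>1 + \<delta>\<close>. Hence the number of directions does not enter the constant. The
  remainder field is of size \<open>3 * \<delta>\<close> and may pass through the crude
  bound.\<close>

lemma pairing_clip_le:
  fixes u :: "real ^ 'n \<Rightarrow> real"
  assumes u: "u \<in> BV \<Omega>" and \<phi>: "\<phi> \<in> test_functions \<Omega>" and \<phi>1: "\<And>x. norm (\<phi> x) \<le> 1"
  shows "pairing (\<lambda>x. clip a b (u x)) \<phi> \<le> BV_seminorm \<Omega> u"
proof (rule field_le_epsilon)
  fix e :: real assume "e > 0"
  define T where "T = BV_seminorm \<Omega> u"
  have T: "0 \<le> T" using BV_seminorm_nonneg[OF u] by (simp add: T_def)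
  \<comment> \<open>The denominator collects the crude bound for the remainder, the excess of
    \<open>1 + \<delta>\<close> over \<open>1\<close>, and the additive errors.\<close>
  define \<delta> where "\<delta> = e / (3 * CARD('n) * T + T + 1)"
  have "3 * CARD('n) * T + T + 1 > 0" using T by (simp add: add_nonneg_pos)
  then have \<delta>: "\<delta> > 0" and \<delta>e: "\<delta> * (3 * CARD('n) * T + T + 1) = e"
    using \<open>e > 0\<close> by (simp_all add: \<delta>_def)
  let ?w = "\<lambda>x. clip a b (u x)"
  have int: "integrable (lebesgue_on \<Omega>) ?w" using clip_integrable BV_D(1)[OF u] by blast
  obtain C :: "(real ^ 'n) set" and \<zeta> where C: "finite C" and \<zeta>: "\<And>c. c \<in> C \<Longrightarrow> \<zeta> c \<in> test_functions \<Omega>"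
    and \<zeta>_sum: "\<And>x. (\<Sum>c\<in>C. \<bar>\<zeta> c x\<bar>) \<le> 1"
    and approx: "\<And>x. norm (\<phi> x - (\<Sum>c\<in>C. \<zeta> c x *\<^sub>R sgn c)) \<le> 3 * \<delta>"
    by (rule field_directional_decomposition[OF \<phi> \<phi>1 \<delta>]) blast
  have dir: "(\<lambda>x. \<zeta> c x *\<^sub>R sgn c) \<in> test_functions \<Omega>" if "c \<in> C" for c
    by (rule scaleR_test_functions[OF \<zeta>[OF that]])
  have sum_dir: "(\<lambda>x. \<Sum>c\<in>C. \<zeta> c x *\<^sub>R sgn c) \<in> test_functions \<Omega>"
    by (rule test_functions_sum[OF dir])
  \<comment> \<open>Summed over all directions, the error per direction is at most
    \<open>\<delta>\<close>, both in the pointwise bounds and in the integrals.\<close>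
  define \<eta> where "\<eta> = \<delta> / (card C + 1)"
  have \<eta>: "\<eta> > 0" "card C * \<eta> \<le> \<delta>" using \<delta> by (auto simp: \<eta>_def field_simps)
  have "\<forall>c\<in>C. \<exists>\<psi>\<in>test_functions \<Omega>. (\<forall>x. \<bar>\<psi> x\<bar> \<le> \<bar>\<zeta> c x\<bar> + \<eta>) \<and>
      pairing ?w (\<lambda>x. \<zeta> c x *\<^sub>R sgn c) \<le> pairing u (\<lambda>x. \<psi> x *\<^sub>R sgn c) + \<eta>"
    using clip_directional_derivative[OF BV_D(1)[OF u] \<zeta> \<eta>(1)] unfolding pairing_def by blast
  then obtain \<psi> where \<psi>: "\<And>c. c \<in> C \<Longrightarrow> \<psi> c \<in> test_functions \<Omega>"
    "\<And>c x. c \<in> C \<Longrightarrow> \<bar>\<psi> c x\<bar> \<le> \<bar>\<zeta> c x\<bar> + \<eta>"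
    "\<And>c. c \<in> C \<Longrightarrow> pairing ?w (\<lambda>x. \<zeta> c x *\<^sub>R sgn c) \<le> pairing u (\<lambda>x. \<psi> c x *\<^sub>R sgn c) + \<eta>"
    by metis
  have \<psi>_dir: "(\<lambda>x. \<psi> c x *\<^sub>R sgn c) \<in> test_functions \<Omega>" if "c \<in> C" for c
    by (rule scaleR_test_functions[OF \<psi>(1)[OF that]])
  have "pairing ?w \<phi> = pairing ?w (\<lambda>x. (\<phi> x - (\<Sum>c\<in>C. \<zeta> c x *\<^sub>R sgn c)) + (\<Sum>c\<in>C. \<zeta> c x *\<^sub>R sgn c))"
    by simp
  also have "\<dots> = pairing ?w (\<lambda>x. \<phi> x - (\<Sum>c\<in>C. \<zeta> c x *\<^sub>R sgn c)) + (\<Sum>c\<in>C. pairing ?w (\<lambda>x. \<zeta> c x *\<^sub>R sgn c))"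
    unfolding pairing_add[OF int test_functions_diff[OF \<phi> sum_dir] sum_dir]
    by (simp add: pairing_sum[OF int dir])
  also have "\<dots> \<le> CARD('n) * (3 * \<delta> * T) + (T * (1 + \<delta>) + \<delta>)"
  proof (rule add_mono)
    show "pairing ?w (\<lambda>x. \<phi> x - (\<Sum>c\<in>C. \<zeta> c x *\<^sub>R sgn c)) \<le> CARD('n) * (3 * \<delta> * T)"
      unfolding T_def using \<delta> approx
      by (intro pairing_clip_le_crude[OF u test_functions_diff[OF \<phi> sum_dir]]) auto
    have "(\<Sum>c\<in>C. pairing ?w (\<lambda>x. \<zeta> c x *\<^sub>R sgn c)) \<le> (\<Sum>c\<in>C. pairing u (\<lambda>x. \<psi> c x *\<^sub>R sgn c) + \<eta>)"
      by (rule sum_mono[OF \<psi>(3)])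
    also have "\<dots> = pairing u (\<lambda>x. \<Sum>c\<in>C. \<psi> c x *\<^sub>R sgn c) + card C * \<eta>"
      by (simp add: sum.distrib pairing_sum[OF BV_D(1)[OF u] \<psi>_dir])
    also have "pairing u (\<lambda>x. \<Sum>c\<in>C. \<psi> c x *\<^sub>R sgn c) \<le> (1 + \<delta>) * T"
      unfolding T_def
    proof (rule pairing_le_BV_seminorm[OF u test_functions_sum[OF \<psi>_dir]])
      fix x
      have "norm (\<Sum>c\<in>C. \<psi> c x *\<^sub>R sgn c) \<le> (\<Sum>c\<in>C. \<bar>\<zeta> c x\<bar> + \<eta>)"
      proof (rule sum_norm_le)
        fix c assume "c \<in> C"
        have "norm (\<psi> c x *\<^sub>R sgn c) \<le> \<bar>\<psi> c x\<bar> * 1"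
          unfolding norm_scaleR by (intro mult_left_mono) (simp_all add: norm_sgn)
        then show "norm (\<psi> c x *\<^sub>R sgn c) \<le> \<bar>\<zeta> c x\<bar> + \<eta>" using \<psi>(2)[OF \<open>c \<in> C\<close>, of x] by simp
      qed
      also have "\<dots> \<le> 1 + \<delta>" using \<zeta>_sum[of x] \<eta>(2) by (simp add: sum.distrib)
      finally show "norm (\<Sum>c\<in>C. \<psi> c x *\<^sub>R sgn c) \<le> 1 + \<delta>" .
    qed (use \<delta> in auto)
    finally show "(\<Sum>c\<in>C. pairing ?w (\<lambda>x. \<zeta> c x *\<^sub>R sgn c)) \<le> T * (1 + \<delta>) + \<delta>"
      using \<eta>(2) by (simp add: mult.commute)
  qed
  also have "\<dots> = T + e" by (simp add: algebra_simps flip: \<delta>e)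
  finally show "pairing ?w \<phi> \<le> BV_seminorm \<Omega> u + e" by (simp add: T_def)
qed

lemma BV_clip:
  assumes u: "u \<in> BV \<Omega>"
  shows "(\<lambda>x. clip a b (u x)) \<in> BV \<Omega>" "BV_seminorm \<Omega> (\<lambda>x. clip a b (u x)) \<le> BV_seminorm \<Omega> u"
proof -
  have "y \<le> BV_seminorm \<Omega> u" if y: "y \<in> BV_values \<Omega> (\<lambda>x. clip a b (u x))" for y
  proof -
    obtain \<phi> where \<phi>: "\<phi> \<in> test_functions \<Omega>" "\<And>x. x \<in> \<Omega> \<Longrightarrow> norm (\<phi> x) \<le> 1"
      and y: "y = pairing (\<lambda>x. clip a b (u x)) \<phi>"
      using y by (auto simp: BV_values_def pairing_def)
    have "norm (\<phi> x) \<le> 1" for x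
    proof (cases "x \<in> \<Omega>")
      case False
      then have "\<phi> x = 0" using \<phi>(1) unfolding test_functions_iff by blast
      then show ?thesis by simp
    qed (rule \<phi>(2))
    then show ?thesis unfolding y by (rule pairing_clip_le[OF u \<phi>(1)])
  qed
  then show "(\<lambda>x. clip a b (u x)) \<in> BV \<Omega>" "BV_seminorm \<Omega> (\<lambda>x. clip a b (u x)) \<le> BV_seminorm \<Omega> u"
    using zero_in_BV_values[of "\<lambda>x. clip a b (u x)"] clip_integrable BV_D(1)[OF u]
    by (auto simp: BV_def BV_seminorm_def intro!: bdd_aboveI cSup_least)
qed

end

section \<open>The gradient measure\<close>

context bounded_open
begin

section \<open>\<open>C0\<close> with the supremum norm\<close>

lemma subspace_C0: "subspace (C0 \<Omega>)"
  by (auto simp: subspace_def C0_iff[OF open_\<Omega> bounded_\<Omega>] plus_fun_def scaleR_fun_def zero_fun_def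
      intro: continuous_intros)

lemma C0_bounded:
  assumes "\<phi> \<in> C0 \<Omega>"
  shows "bdd_above (range (\<lambda>x. \<bar>\<phi> x\<bar>))"
proof -
  obtain \<psi> where \<psi>: "\<psi> \<in> test_functions \<Omega>" "\<And>x. \<bar>\<psi> x - \<phi> x\<bar> \<le> 1"
    using test_functions_dense[OF open_\<Omega> bounded_\<Omega> assms zero_less_one] by blast
  obtain B where "\<And>x. norm (\<psi> x) \<le> B" using test_functions_bounded[OF \<psi>(1)] by blast
  then have "\<bar>\<phi> x\<bar> \<le> B + 1" for x using \<psi>(2)[of x] by (smt (verit) real_norm_def)
  then show ?thesis by (auto intro!: bdd_aboveI[of _ "B + 1"])
qed

lemma C0_norm_upper: "\<phi> \<in> C0 \<Omega> \<Longrightarrow> \<bar>\<phi> x\<bar> \<le> C0_norm \<phi>"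
  unfolding C0_norm_def by (rule cSUP_upper[OF UNIV_I C0_bounded])

lemma C0_norm_least: "(\<And>x. \<bar>\<phi> x\<bar> \<le> B) \<Longrightarrow> C0_norm \<phi> \<le> B"
  unfolding C0_norm_def by (rule cSUP_least) auto

lemma C0_norm_nonneg: "\<phi> \<in> C0 \<Omega> \<Longrightarrow> 0 \<le> C0_norm \<phi>"
  using C0_norm_upper[of \<phi> undefined] by linarith

lemma C0_norm_convex:
  assumes "0 \<le> c"
  shows "convex_on (C0 \<Omega>) (\<lambda>\<phi>. C0_norm \<phi> * c)"
  unfolding convex_on_def
proof (intro conjI ballI allI impI)
  show "convex (C0 \<Omega>)" by (rule subspace_imp_convex[OF subspace_C0])
next
  fix \<phi> \<psi> :: "real ^ 'n \<Rightarrow> real" and p q :: real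
  assume \<phi>: "\<phi> \<in> C0 \<Omega>" "\<psi> \<in> C0 \<Omega>" and pq: "0 \<le> p" "0 \<le> q"
  have "\<bar>(p *\<^sub>R \<phi> + q *\<^sub>R \<psi>) x\<bar> \<le> p * C0_norm \<phi> + q * C0_norm \<psi>" for x
  proof -
    have "\<bar>p * \<phi> x + q * \<psi> x\<bar> \<le> p * \<bar>\<phi> x\<bar> + q * \<bar>\<psi> x\<bar>"
      using abs_triangle_ineq[of "p * \<phi> x" "q * \<psi> x"] pq by (simp add: abs_mult)
    also have "\<dots> \<le> p * C0_norm \<phi> + q * C0_norm \<psi>"
      using C0_norm_upper \<phi> pq by (intro add_mono mult_left_mono) auto
    finally show ?thesis by simp
  qed
  then have "C0_norm (p *\<^sub>R \<phi> + q *\<^sub>R \<psi>) \<le> p * C0_norm \<phi> + q * C0_norm \<psi>"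
    by (rule C0_norm_least)
  then show "C0_norm (p *\<^sub>R \<phi> + q *\<^sub>R \<psi>) * c \<le> p * (C0_norm \<phi> * c) + q * (C0_norm \<psi> * c)"
    using mult_right_mono[OF _ assms] by (fastforce simp: algebra_simps)
qed

text \<open>The case \<open>B = 0\<close>, in which the field cannot be rescaled, is reached from
  the bounds \<open>B + \<delta>\<close>.\<close>

lemma pairing_le_BV_seminorm_nonneg:
  assumes u: "u \<in> BV \<Omega>" and \<phi>: "\<phi> \<in> test_functions \<Omega>" and B: "0 \<le> B" "\<And>x. norm (\<phi> x) \<le> B"
  shows "pairing u \<phi> \<le> B * BV_seminorm \<Omega> u"
proof (rule field_le_epsilon)
  fix e :: real assume "e > 0"
  define \<delta> where "\<delta> = e / (BV_seminorm \<Omega> u + 1)"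
  have "BV_seminorm \<Omega> u + 1 > 0" using BV_seminorm_nonneg[OF u] by simp
  then have \<delta>: "\<delta> > 0" "\<delta> * (BV_seminorm \<Omega> u + 1) = e"
    using \<open>e > 0\<close> by (simp_all add: \<delta>_def)
  have "norm (\<phi> x) \<le> B + \<delta>" for x using B(2)[of x] \<delta>(1) by simp
  then have "pairing u \<phi> \<le> (B + \<delta>) * BV_seminorm \<Omega> u"
    using B(1) \<delta>(1) by (intro pairing_le_BV_seminorm[OF u \<phi>]) auto
  then show "pairing u \<phi> \<le> B * BV_seminorm \<Omega> u + e"
    using \<delta> by (simp add: distrib_right distrib_left)
qed

section \<open>Real measures and the existence of the gradient\<close>

lemma real_measures_D:
  assumes "m \<in> real_measures \<Omega>"
  shows "\<And>\<phi> \<psi>. \<phi> \<in> C0 \<Omega> \<Longrightarrow> \<psi> \<in> C0 \<Omega> \<Longrightarrow> m (\<lambda>x. \<phi> x + \<psi> x) = m \<phi> + m \<psi>"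
    "\<And>\<phi> c. \<phi> \<in> C0 \<Omega> \<Longrightarrow> m (\<lambda>x. c * \<phi> x) = c * m \<phi>"
    "\<And>\<phi>. \<phi> \<notin> C0 \<Omega> \<Longrightarrow> m \<phi> = 0"
  using assms unfolding real_measures_def bounded_linear_functional_def by blast+

text \<open>The constant in the definition may be negative; with its absolute value the estimate is
  monotone and holds for every pointwise bound \<open>B\<close>.\<close>

lemma real_measures_bound:
  assumes "m \<in> real_measures \<Omega>"
  obtains C where "0 \<le> C" "\<And>\<phi> B. \<phi> \<in> C0 \<Omega> \<Longrightarrow> (\<And>x. \<bar>\<phi> x\<bar> \<le> B) \<Longrightarrow> \<bar>m \<phi>\<bar> \<le> C * B"
proof -
  obtain C where C: "\<And>\<phi>. \<phi> \<in> C0 \<Omega> \<Longrightarrow> \<bar>m \<phi>\<bar> \<le> C * C0_norm \<phi>"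
    using assms unfolding real_measures_def bounded_linear_functional_def by blast
  have "\<bar>m \<phi>\<bar> \<le> \<bar>C\<bar> * B" if "\<phi> \<in> C0 \<Omega>" "\<And>x. \<bar>\<phi> x\<bar> \<le> B" for \<phi> B
  proof -
    have "C * C0_norm \<phi> \<le> \<bar>C\<bar> * C0_norm \<phi>"
      using C0_norm_nonneg[OF that(1)] by (intro mult_right_mono) auto
    also have "\<dots> \<le> \<bar>C\<bar> * B" using C0_norm_least[OF that(2)] by (intro mult_left_mono) auto
    finally show ?thesis using C[OF that(1)] by linarith
  qed
  then show thesis using that[of "\<bar>C\<bar>"] by auto
qed

lemma C0_add: "\<phi> \<in> C0 \<Omega> \<Longrightarrow> \<psi> \<in> C0 \<Omega> \<Longrightarrow> (\<lambda>x. \<phi> x + \<psi> x) \<in> C0 \<Omega>"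
  using subspace_add[OF subspace_C0] by (simp add: plus_fun_def)

lemma C0_scale: "\<phi> \<in> C0 \<Omega> \<Longrightarrow> (\<lambda>x. c * \<phi> x) \<in> C0 \<Omega>"
  using subspace_scale[OF subspace_C0, of \<phi> c] by (simp add: scaleR_fun_def)

lemma real_measures_diff:
  assumes m: "m \<in> real_measures \<Omega>" and "\<phi> \<in> C0 \<Omega>" "\<psi> \<in> C0 \<Omega>"
  shows "m (\<lambda>x. \<phi> x - \<psi> x) = m \<phi> - m \<psi>"
  using real_measures_D(1)[OF m assms(2) C0_scale[OF assms(3), of "-1"]]
    real_measures_D(2)[OF m assms(3), of "-1"] by simp

lemma test_functions_C0: "\<psi> \<in> test_functions \<Omega> \<Longrightarrow> \<psi> \<in> C0 \<Omega>"
  by (rule test_functions_subset_C0[OF open_\<Omega> bounded_\<Omega>])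

text \<open>Uniform density of the test functions and continuity of both functionals give equality
  on \<open>C0\<close>, and off \<open>C0\<close> both are zero by convention. This is the
  uniqueness behind \<open>BV_gradient\<close>.\<close>

lemma real_measures_eqI:
  assumes m: "m \<in> real_measures \<Omega>" and n: "n \<in> real_measures \<Omega>"
    and eq: "\<And>\<psi>. \<psi> \<in> test_functions \<Omega> \<Longrightarrow> m \<psi> = n \<psi>"
  shows "m = n"
proof
  fix \<phi>
  show "m \<phi> = n \<phi>"
  proof (cases "\<phi> \<in> C0 \<Omega>")
    case True
    obtain C where C: "0 \<le> C" "\<And>\<phi> B. \<phi> \<in> C0 \<Omega> \<Longrightarrow> (\<And>x. \<bar>\<phi> x\<bar> \<le> B) \<Longrightarrow> \<bar>m \<phi>\<bar> \<le> C * B"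
      using real_measures_bound[OF m] by blast
    obtain C' where C': "0 \<le> C'" "\<And>\<phi> B. \<phi> \<in> C0 \<Omega> \<Longrightarrow> (\<And>x. \<bar>\<phi> x\<bar> \<le> B) \<Longrightarrow> \<bar>n \<phi>\<bar> \<le> C' * B"
      using real_measures_bound[OF n] by blast
    have "\<bar>m \<phi> - n \<phi>\<bar> \<le> 0 + e" if "e > 0" for e
    proof -
      define \<delta> where "\<delta> = e / (C + C' + 1)"
      have \<delta>: "\<delta> > 0" "\<delta> * (C + C' + 1) = e" using \<open>e > 0\<close> C(1) C'(1) by (simp_all add: \<delta>_def)
      obtain \<psi> where \<psi>: "\<psi> \<in> test_functions \<Omega>" "\<And>x. \<bar>\<psi> x - \<phi> x\<bar> \<le> \<delta>"
        using test_functions_dense[OF open_\<Omega> bounded_\<Omega> True \<delta>(1)] by blast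
      have \<psi>0: "\<psi> \<in> C0 \<Omega>" by (rule test_functions_C0[OF \<psi>(1)])
      have d: "(\<lambda>x. \<psi> x - \<phi> x) \<in> C0 \<Omega>"
        using C0_add[OF \<psi>0 C0_scale[OF True, of "-1"]] by simp
      have "\<bar>m \<psi> - m \<phi>\<bar> \<le> C * \<delta>" "\<bar>n \<psi> - n \<phi>\<bar> \<le> C' * \<delta>"
        using C(2)[OF d \<psi>(2)] C'(2)[OF d \<psi>(2)]
        by (simp_all add: real_measures_diff[OF m \<psi>0 True] real_measures_diff[OF n \<psi>0 True])
      then have "\<bar>m \<phi> - n \<phi>\<bar> \<le> C * \<delta> + C' * \<delta>" using eq[OF \<psi>(1)] by linarith
      also have "\<dots> \<le> e" using \<delta> by (simp add: algebra_simps)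
      finally show ?thesis by simp
    qed
    then have "\<bar>m \<phi> - n \<phi>\<bar> \<le> 0" by (rule field_le_epsilon)
    then show ?thesis by simp
  qed (use real_measures_D(3)[OF m] real_measures_D(3)[OF n] in simp)
qed

lemma vector_measures_D: "\<mu> \<in> vector_measures \<Omega> \<Longrightarrow> \<mu> i \<in> real_measures \<Omega>"
  by (simp add: vector_measures_def)

lemma pairing_scaleR_axis:
  assumes "\<psi> \<in> test_functions \<Omega>"
  shows "pairing u (\<lambda>x. \<psi> x *\<^sub>R axis i 1) = (LINT x|lebesgue_on \<Omega>. u x * partial_deriv i \<psi> x)"
  by (simp add: pairing_def divergence_scaleR_const[OF assms])

lemma BV_gradient_eqI:
  assumes \<mu>: "\<mu> \<in> vector_measures \<Omega>"
    and eq: "\<And>i \<psi>. \<psi> \<in> test_functions \<Omega> \<Longrightarrow> \<mu> i \<psi> = - pairing u (\<lambda>x. \<psi> x *\<^sub>R axis i 1)"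
  shows "BV_gradient \<Omega> u = \<mu>"
  unfolding BV_gradient_def
proof (rule the_equality)
  show "\<mu> \<in> vector_measures \<Omega> \<and> (\<forall>i. \<forall>\<psi>\<in>test_functions \<Omega>. \<mu> i \<psi> = - (LINT x|lebesgue_on \<Omega>. u x * partial_deriv i \<psi> x))"
    using \<mu> eq by (simp add: pairing_scaleR_axis)
  fix \<nu> :: "'n \<Rightarrow> (real ^ 'n \<Rightarrow> real) \<Rightarrow> real"
  assume \<nu>: "\<nu> \<in> vector_measures \<Omega> \<and> (\<forall>i. \<forall>\<psi>\<in>test_functions \<Omega>. \<nu> i \<psi> = - (LINT x|lebesgue_on \<Omega>. u x * partial_deriv i \<psi> x))"
  have "\<nu> i = \<mu> i" for i
    by (rule real_measures_eqI) (use \<nu> \<mu> eq in \<open>auto simp: vector_measures_D pairing_scaleR_axis\<close>)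
  then show "\<nu> = \<mu>" by (rule ext)
qed

text \<open>On test functions the distributional derivative is bounded by the supremum norm times
  the seminorm of \<open>u\<close>, so it extends to \<open>C0\<close> with the same bound.\<close>

lemma BV_partial_exists:
  assumes u: "u \<in> BV \<Omega>"
  shows "\<exists>m\<in>real_measures \<Omega>. \<forall>\<psi>\<in>test_functions \<Omega>. m \<psi> = - pairing u (\<lambda>x. \<psi> x *\<^sub>R axis i 1)"
proof -
  define T where "T \<psi> = - pairing u (\<lambda>x. \<psi> x *\<^sub>R axis i 1)" for \<psi> :: "real ^ 'n \<Rightarrow> real"
  have T_add: "T (\<lambda>x. \<phi> x + \<psi> x) = T \<phi> + T \<psi>" if "\<phi> \<in> test_functions \<Omega>" "\<psi> \<in> test_functions \<Omega>" for \<phi> \<psi>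
    using pairing_add[OF BV_D(1)[OF u] scaleR_test_functions[OF that(1)] scaleR_test_functions[OF that(2)]]
    by (simp add: T_def scaleR_add_left)
  have T_scale: "T (\<lambda>x. c * \<psi> x) = c * T \<psi>" if "\<psi> \<in> test_functions \<Omega>" for c \<psi>
    using pairing_scale[OF scaleR_test_functions[OF that]] by (simp add: T_def flip: scaleR_scaleR)
  have T_le: "T \<psi> \<le> C0_norm \<psi> * BV_seminorm \<Omega> u" if \<psi>: "\<psi> \<in> test_functions \<Omega>" for \<psi>
  proof -
    have "T \<psi> = pairing u (\<lambda>x. (-1) *\<^sub>R (\<psi> x *\<^sub>R axis i 1))"
      unfolding T_def pairing_scale[OF scaleR_test_functions[OF \<psi>]] by simp
    also have "\<dots> \<le> C0_norm \<psi> * BV_seminorm \<Omega> u"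
    proof (rule pairing_le_BV_seminorm_nonneg[OF u test_functions_scale[OF scaleR_test_functions[OF \<psi>]]])
      show "norm ((-1) *\<^sub>R (\<psi> x *\<^sub>R (axis i 1 :: real ^ 'n))) \<le> C0_norm \<psi>" for x
        using C0_norm_upper[OF test_functions_C0[OF \<psi>], of x] by (simp add: norm_axis_1)
    qed (rule C0_norm_nonneg[OF test_functions_C0[OF \<psi>]])
    finally show ?thesis .
  qed
  define G where "G = (\<lambda>\<psi>. (\<psi>, T \<psi>)) ` test_functions \<Omega>"
  have "subspace G"
  proof (rule subspaceI)
    have "T (\<lambda>_. 0) = 0" using T_scale[OF test_functions_zero, of 0] by simp
    then show "0 \<in> G"
      unfolding G_def zero_prod_def zero_fun_def
      by (intro image_eqI[of _ _ "\<lambda>_. 0"]) (simp_all add: test_functions_zero)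
  next
    fix y z assume "y \<in> G" "z \<in> G"
    then obtain \<phi> \<psi> where "\<phi> \<in> test_functions \<Omega>" "\<psi> \<in> test_functions \<Omega>" "y = (\<phi>, T \<phi>)" "z = (\<psi>, T \<psi>)"
      by (auto simp: G_def)
    then show "y + z \<in> G"
      using test_functions_add[of \<phi> \<Omega> \<psi>] T_add[of \<phi> \<psi>] by (auto simp: G_def plus_fun_def)
  next
    fix c :: real and y assume "y \<in> G"
    then obtain \<psi> where "\<psi> \<in> test_functions \<Omega>" "y = (\<psi>, T \<psi>)" by (auto simp: G_def)
    then show "c *\<^sub>R y \<in> G"
      using test_functions_scale[of \<psi> \<Omega> c] T_scale[of \<psi> c] by (auto simp: G_def scaleR_fun_def)
  qed
  then have "subfunctional_graph (C0 \<Omega>) (\<lambda>\<phi>. C0_norm \<phi> * BV_seminorm \<Omega> u) G"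
    using T_le test_functions_C0 by (auto simp: subfunctional_graph_def G_def)
  then obtain F where F_le: "\<And>\<phi>. \<phi> \<in> C0 \<Omega> \<Longrightarrow> F \<phi> \<le> C0_norm \<phi> * BV_seminorm \<Omega> u"
    and F_add: "\<And>\<phi> \<psi>. \<phi> \<in> C0 \<Omega> \<Longrightarrow> \<psi> \<in> C0 \<Omega> \<Longrightarrow> F (\<phi> + \<psi>) = F \<phi> + F \<psi>"
    and F_scale: "\<And>\<phi> c. \<phi> \<in> C0 \<Omega> \<Longrightarrow> F (c *\<^sub>R \<phi>) = c * F \<phi>"
    and F_T: "\<And>\<psi> a. (\<psi>, a) \<in> G \<Longrightarrow> F \<psi> = a"
    by (rule Hahn_Banach_convex[OF subspace_C0 C0_norm_convex[OF BV_seminorm_nonneg[OF u]]]) blast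
  \<comment> \<open>The extension is reset to zero off \<open>C0\<close>, as membership in
    \<open>real_measures\<close> requires.\<close>
  define m where "m \<phi> = (if \<phi> \<in> C0 \<Omega> then F \<phi> else 0)" for \<phi>
  have "\<bar>m \<phi>\<bar> \<le> BV_seminorm \<Omega> u * C0_norm \<phi>" if "\<phi> \<in> C0 \<Omega>" for \<phi>
  proof -
    have "C0_norm ((-1) *\<^sub>R \<phi>) = C0_norm \<phi>" by (simp add: C0_norm_def)
    then show ?thesis
      using F_le[OF that] F_le[OF subspace_scale[OF subspace_C0 that, of "-1"]] F_scale[OF that, of "-1"] that
      by (simp add: m_def mult.commute abs_le_iff)
  qed
  then have "m \<in> real_measures \<Omega>"
    using F_add F_scale C0_add C0_scale
    by (auto simp: real_measures_def bounded_linear_functional_def m_def plus_fun_def scaleR_fun_def)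
  moreover have "m \<psi> = T \<psi>" if "\<psi> \<in> test_functions \<Omega>" for \<psi>
    using F_T[of \<psi> "T \<psi>"] that test_functions_C0 by (auto simp: m_def G_def)
  ultimately show ?thesis unfolding T_def by blast
qed

lemma BV_gradient:
  assumes u: "u \<in> BV \<Omega>"
  shows "BV_gradient \<Omega> u \<in> vector_measures \<Omega>"
    "\<And>i \<psi>. \<psi> \<in> test_functions \<Omega> \<Longrightarrow> BV_gradient \<Omega> u i \<psi> = - pairing u (\<lambda>x. \<psi> x *\<^sub>R axis i 1)"
proof -
  obtain \<mu> where \<mu>: "\<And>i. \<mu> i \<in> real_measures \<Omega>"
    "\<And>i \<psi>. \<psi> \<in> test_functions \<Omega> \<Longrightarrow> \<mu> i \<psi> = - pairing u (\<lambda>x. \<psi> x *\<^sub>R axis i 1)"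
    using BV_partial_exists[OF u] by metis
  then have "\<mu> \<in> vector_measures \<Omega>" by (simp add: vector_measures_def)
  moreover from this have "BV_gradient \<Omega> u = \<mu>" using \<mu>(2) by (rule BV_gradient_eqI)
  ultimately show "BV_gradient \<Omega> u \<in> vector_measures \<Omega>"
    "\<And>i \<psi>. \<psi> \<in> test_functions \<Omega> \<Longrightarrow> BV_gradient \<Omega> u i \<psi> = - pairing u (\<lambda>x. \<psi> x *\<^sub>R axis i 1)"
    using \<mu>(2) by simp_all
qed

lemma real_measures_add:
  assumes m: "m \<in> real_measures \<Omega>" and n: "n \<in> real_measures \<Omega>"
  shows "m + n \<in> real_measures \<Omega>"
proof -
  obtain C where C: "\<And>\<phi>. \<phi> \<in> C0 \<Omega> \<Longrightarrow> \<bar>m \<phi>\<bar> \<le> C * C0_norm \<phi>"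
    using m unfolding real_measures_def bounded_linear_functional_def by blast
  obtain C' where C': "\<And>\<phi>. \<phi> \<in> C0 \<Omega> \<Longrightarrow> \<bar>n \<phi>\<bar> \<le> C' * C0_norm \<phi>"
    using n unfolding real_measures_def bounded_linear_functional_def by blast
  have "\<bar>m \<phi> + n \<phi>\<bar> \<le> (C + C') * C0_norm \<phi>" if "\<phi> \<in> C0 \<Omega>" for \<phi>
    using C[OF that] C'[OF that] abs_triangle_ineq[of "m \<phi>" "n \<phi>"] unfolding distrib_right by linarith
  then show ?thesis
    using real_measures_D[OF m] real_measures_D[OF n]
    by (auto simp: real_measures_def bounded_linear_functional_def distrib_left)
qed

lemma real_measures_scale:
  assumes m: "m \<in> real_measures \<Omega>"
  shows "c *\<^sub>R m \<in> real_measures \<Omega>"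
proof -
  obtain C where C: "\<And>\<phi>. \<phi> \<in> C0 \<Omega> \<Longrightarrow> \<bar>m \<phi>\<bar> \<le> C * C0_norm \<phi>"
    using m unfolding real_measures_def bounded_linear_functional_def by blast
  have "\<bar>c * m \<phi>\<bar> \<le> (\<bar>c\<bar> * C) * C0_norm \<phi>" if "\<phi> \<in> C0 \<Omega>" for \<phi>
    using mult_left_mono[OF C[OF that] abs_ge_zero[of c]] by (simp add: abs_mult mult.assoc)
  then show ?thesis
    using real_measures_D[OF m]
    by (auto simp: real_measures_def bounded_linear_functional_def distrib_left mult.left_commute)
qed

lemma subspace_vector_measures: "subspace (vector_measures \<Omega>)"
proof (rule subspaceI)
  have "(0 :: (real ^ 'n \<Rightarrow> real) \<Rightarrow> real) \<in> real_measures \<Omega>"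
    by (auto simp: real_measures_def bounded_linear_functional_def intro: exI[of _ 0])
  then show "0 \<in> vector_measures \<Omega>" by (simp add: vector_measures_def)
qed (simp_all add: vector_measures_def real_measures_add real_measures_scale)

text \<open>Coefficients \<open>1\<close> and \<open>-1\<close> give differences,
  \<open>1 - t\<close> and \<open>t\<close> convex combinations, \<open>t\<close> and
  \<open>0\<close> multiples. Linearity of the gradient follows from its uniqueness.\<close>

lemma BV_linear_combination:
  assumes u: "u \<in> BV \<Omega>" and v: "v \<in> BV \<Omega>"
  shows "(\<lambda>x. a * u x + b * v x) \<in> BV \<Omega>"
    "BV_seminorm \<Omega> (\<lambda>x. a * u x + b * v x) \<le> \<bar>a\<bar> * BV_seminorm \<Omega> u + \<bar>b\<bar> * BV_seminorm \<Omega> v"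
    "BV_gradient \<Omega> (\<lambda>x. a * u x + b * v x) = a *\<^sub>R BV_gradient \<Omega> u + b *\<^sub>R BV_gradient \<Omega> v"
proof -
  let ?w = "\<lambda>x. a * u x + b * v x"
  have lin: "pairing ?w \<phi> = a * pairing u \<phi> + b * pairing v \<phi>" if "\<phi> \<in> test_functions \<Omega>" for \<phi>
    using test_functions_integrable_mult[OF BV_D(1)[OF u] divergence_test_functions[OF that]]
      test_functions_integrable_mult[OF BV_D(1)[OF v] divergence_test_functions[OF that]]
    by (simp add: pairing_def distrib_right mult.assoc)
  have "y \<le> \<bar>a\<bar> * BV_seminorm \<Omega> u + \<bar>b\<bar> * BV_seminorm \<Omega> v" if y: "y \<in> BV_values \<Omega> ?w" for y
  proof -
    obtain \<phi> where \<phi>: "\<phi> \<in> test_functions \<Omega>" "\<And>x. x \<in> \<Omega> \<Longrightarrow> norm (\<phi> x) \<le> 1" and y: "y = pairing ?w \<phi>"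
      using y by (auto simp: BV_values_def pairing_def)
    have \<phi>1: "norm (\<phi> x) \<le> 1" for x
    proof (cases "x \<in> \<Omega>")
      case False
      then have "\<phi> x = 0" using \<phi>(1) unfolding test_functions_iff by blast
      then show ?thesis by simp
    qed (rule \<phi>(2))
    have "c * pairing w \<phi> \<le> \<bar>c\<bar> * BV_seminorm \<Omega> w" if "w \<in> BV \<Omega>" for c w
      unfolding pairing_scale[OF \<phi>(1), symmetric]
      by (rule pairing_le_BV_seminorm_nonneg[OF that test_functions_scale[OF \<phi>(1)]])
        (use \<phi>1 in \<open>auto intro: mult_left_le\<close>)
    then show ?thesis unfolding y lin[OF \<phi>(1)] using u v by (intro add_mono)
  qed
  then show BV: "?w \<in> BV \<Omega>"
    and "BV_seminorm \<Omega> ?w \<le> \<bar>a\<bar> * BV_seminorm \<Omega> u + \<bar>b\<bar> * BV_seminorm \<Omega> v"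
    using BV_D(1)[OF u] BV_D(1)[OF v] zero_in_BV_values[of ?w]
    by (auto simp: BV_def BV_seminorm_def intro!: bdd_aboveI cSup_least)
  show "BV_gradient \<Omega> ?w = a *\<^sub>R BV_gradient \<Omega> u + b *\<^sub>R BV_gradient \<Omega> v"
  proof (rule BV_gradient_eqI)
    show "a *\<^sub>R BV_gradient \<Omega> u + b *\<^sub>R BV_gradient \<Omega> v \<in> vector_measures \<Omega>"
      by (intro subspace_add subspace_scale subspace_vector_measures BV_gradient(1) u v)
    show "(a *\<^sub>R BV_gradient \<Omega> u + b *\<^sub>R BV_gradient \<Omega> v) i \<psi> = - pairing ?w (\<lambda>x. \<psi> x *\<^sub>R axis i 1)"
      if "\<psi> \<in> test_functions \<Omega>" for i \<psi>
      by (simp add: lin[OF scaleR_test_functions[OF that]] BV_gradient(2)[OF u that] BV_gradient(2)[OF v that])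
  qed
qed

section \<open>The total variation norm\<close>

definition measure_values :: "('n \<Rightarrow> (real ^ 'n \<Rightarrow> real) \<Rightarrow> real) \<Rightarrow> real set" where
  "measure_values \<mu> = {(\<Sum>i\<in>UNIV. \<mu> i (\<lambda>x. \<phi> x $ i)) | \<phi> :: real ^ 'n \<Rightarrow> real ^ 'n.
    (\<forall>i. (\<lambda>x. \<phi> x $ i) \<in> C0 \<Omega>) \<and> (\<forall>x\<in>\<Omega>. norm (\<phi> x) \<le> 1)}"

lemma total_variation_eq: "total_variation \<Omega> \<mu> = Sup (measure_values \<mu>)"
  by (simp add: total_variation_def measure_values_def)

lemma C0_field_norm_le:
  fixes \<phi> :: "real ^ 'n \<Rightarrow> real ^ 'n"
  assumes "\<And>i. (\<lambda>x. \<phi> x $ i) \<in> C0 \<Omega>" "\<forall>x\<in>\<Omega>. norm (\<phi> x) \<le> 1"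
  shows "norm (\<phi> x) \<le> 1"
proof (cases "x \<in> \<Omega>")
  case False
  then have "\<phi> x = 0" using assms(1) by (simp add: C0_def vec_eq_iff)
  then show ?thesis by simp
qed (use assms in simp)

lemma measure_values_bdd_above:
  assumes \<mu>: "\<mu> \<in> vector_measures \<Omega>"
  shows "bdd_above (measure_values \<mu>)"
proof -
  have "\<forall>i. \<exists>C. \<forall>\<phi>. \<phi> \<in> C0 \<Omega> \<longrightarrow> (\<forall>x. \<bar>\<phi> x\<bar> \<le> 1) \<longrightarrow> \<bar>\<mu> i \<phi>\<bar> \<le> C"
  proof
    fix i
    obtain C where "\<And>\<phi> B. \<phi> \<in> C0 \<Omega> \<Longrightarrow> (\<And>x. \<bar>\<phi> x\<bar> \<le> B) \<Longrightarrow> \<bar>\<mu> i \<phi>\<bar> \<le> C * B"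
      using real_measures_bound[OF vector_measures_D[OF \<mu>]] by blast
    from this[of _ 1] show "\<exists>C. \<forall>\<phi>. \<phi> \<in> C0 \<Omega> \<longrightarrow> (\<forall>x. \<bar>\<phi> x\<bar> \<le> 1) \<longrightarrow> \<bar>\<mu> i \<phi>\<bar> \<le> C" by auto
  qed
  then obtain C where C: "\<And>i \<phi>. \<phi> \<in> C0 \<Omega> \<Longrightarrow> (\<forall>x. \<bar>\<phi> x\<bar> \<le> 1) \<Longrightarrow> \<bar>\<mu> i \<phi>\<bar> \<le> C i" by metis
  show ?thesis
  proof (rule bdd_aboveI)
    fix y assume "y \<in> measure_values \<mu>"
    then obtain \<phi> :: "real ^ 'n \<Rightarrow> real ^ 'n" where \<phi>: "\<And>i. (\<lambda>x. \<phi> x $ i) \<in> C0 \<Omega>" "\<forall>x\<in>\<Omega>. norm (\<phi> x) \<le> 1"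
      and y: "y = (\<Sum>i\<in>UNIV. \<mu> i (\<lambda>x. \<phi> x $ i))" by (auto simp: measure_values_def)
    have "\<bar>\<phi> x $ i\<bar> \<le> 1" for x i
      using component_le_norm_cart[of "\<phi> x" i] C0_field_norm_le[OF \<phi>, of x] by linarith
    then have "\<bar>\<mu> i (\<lambda>x. \<phi> x $ i)\<bar> \<le> C i" for i using C[OF \<phi>(1)] by blast
    then have "\<mu> i (\<lambda>x. \<phi> x $ i) \<le> C i" for i using abs_le_D1 by blast
    then show "y \<le> (\<Sum>i\<in>UNIV. C i)" unfolding y by (intro sum_mono)
  qed
qed

lemma total_variation_upper:
  fixes \<phi> :: "real ^ 'n \<Rightarrow> real ^ 'n"
  assumes "\<mu> \<in> vector_measures \<Omega>" "\<And>i. (\<lambda>x. \<phi> x $ i) \<in> C0 \<Omega>" "\<And>x. x \<in> \<Omega> \<Longrightarrow> norm (\<phi> x) \<le> 1"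
  shows "(\<Sum>i\<in>UNIV. \<mu> i (\<lambda>x. \<phi> x $ i)) \<le> total_variation \<Omega> \<mu>"
  unfolding total_variation_eq
  by (rule cSup_upper[OF _ measure_values_bdd_above[OF assms(1)]])
    (use assms(2,3) in \<open>auto simp: measure_values_def\<close>)

lemma total_variation_least:
  assumes "\<And>\<phi> :: real ^ 'n \<Rightarrow> real ^ 'n. (\<And>i. (\<lambda>x. \<phi> x $ i) \<in> C0 \<Omega>) \<Longrightarrow> (\<And>x. norm (\<phi> x) \<le> 1) \<Longrightarrow>
    (\<Sum>i\<in>UNIV. \<mu> i (\<lambda>x. \<phi> x $ i)) \<le> B"
  shows "total_variation \<Omega> \<mu> \<le> B"
  unfolding total_variation_eq
proof (rule cSup_least)
  have "(\<Sum>i\<in>UNIV. \<mu> i (\<lambda>x. (0 :: real ^ 'n) $ i)) \<in> measure_values \<mu>"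
    using subspace_0[OF subspace_C0] unfolding measure_values_def
    by (intro CollectI exI[of _ "\<lambda>_. 0"]) (simp add: zero_fun_def)
  then show "measure_values \<mu> \<noteq> {}" by blast
  fix y assume "y \<in> measure_values \<mu>"
  then show "y \<le> B" using assms C0_field_norm_le by (auto simp: measure_values_def)
qed

text \<open>The sign of each coefficient is absorbed into the test field, which leaves its Euclidean
  norm at most \<open>1\<close>.\<close>

lemma total_variation_linear_combination:
  assumes \<mu>: "\<mu> \<in> vector_measures \<Omega>" and \<nu>: "\<nu> \<in> vector_measures \<Omega>"
  shows "total_variation \<Omega> (a *\<^sub>R \<mu> + b *\<^sub>R \<nu>) \<le> \<bar>a\<bar> * total_variation \<Omega> \<mu> + \<bar>b\<bar> * total_variation \<Omega> \<nu>"
proof (rule total_variation_least)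
  fix \<phi> :: "real ^ 'n \<Rightarrow> real ^ 'n"
  assume \<phi>: "\<And>i. (\<lambda>x. \<phi> x $ i) \<in> C0 \<Omega>" "\<And>x. norm (\<phi> x) \<le> 1"
  have *: "c * (\<Sum>i\<in>UNIV. \<rho> i (\<lambda>x. \<phi> x $ i)) \<le> \<bar>c\<bar> * total_variation \<Omega> \<rho>"
    if \<rho>: "\<rho> \<in> vector_measures \<Omega>" for c \<rho>
  proof -
    have "(\<lambda>x. (sgn c *\<^sub>R \<phi> x) $ i) \<in> C0 \<Omega>" for i using C0_scale[OF \<phi>(1)] by simp
    moreover have "norm (sgn c *\<^sub>R \<phi> x) \<le> 1" for x using \<phi>(2)[of x] by (simp add: abs_sgn_eq)
    ultimately have "(\<Sum>i\<in>UNIV. \<rho> i (\<lambda>x. (sgn c *\<^sub>R \<phi> x) $ i)) \<le> total_variation \<Omega> \<rho>"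
      by (rule total_variation_upper[OF \<rho>])
    then have "sgn c * (\<Sum>i\<in>UNIV. \<rho> i (\<lambda>x. \<phi> x $ i)) \<le> total_variation \<Omega> \<rho>"
      using real_measures_D(2)[OF vector_measures_D[OF \<rho>] \<phi>(1)] by (simp add: sum_distrib_left)
    from mult_left_mono[OF this abs_ge_zero[of c]] show ?thesis
      by (simp add: mult_sgn_abs mult.assoc[symmetric] mult.commute[of "\<bar>c\<bar>" "sgn c"])
  qed
  show "(\<Sum>i\<in>UNIV. (a *\<^sub>R \<mu> + b *\<^sub>R \<nu>) i (\<lambda>x. \<phi> x $ i))
      \<le> \<bar>a\<bar> * total_variation \<Omega> \<mu> + \<bar>b\<bar> * total_variation \<Omega> \<nu>"
    using *[OF \<mu>, of a] *[OF \<nu>, of b] by (simp add: sum.distrib flip: sum_distrib_left)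
qed

lemma BV_gradient_sum_test:
  assumes u: "u \<in> BV \<Omega>" and \<phi>: "\<phi> \<in> test_functions \<Omega>"
  shows "(\<Sum>i\<in>UNIV. BV_gradient \<Omega> u i (\<lambda>x. \<phi> x $ i)) = - pairing u \<phi>"
proof -
  have comp: "(\<lambda>x. \<phi> x $ i) \<in> test_functions \<Omega>" for i by (rule component_test_functions[OF \<phi>])
  have dir: "(\<lambda>x. (\<phi> x $ i) *\<^sub>R (axis i 1 :: real ^ 'n)) \<in> test_functions \<Omega>" for i
    by (rule scaleR_test_functions[OF comp])
  have "\<phi> = (\<lambda>x. \<Sum>i\<in>UNIV. (\<phi> x $ i) *\<^sub>R axis i 1)"
    by (simp add: basis_expansion flip: scalar_mult_eq_scaleR)
  then have "pairing u \<phi> = (\<Sum>i\<in>UNIV. pairing u (\<lambda>x. (\<phi> x $ i) *\<^sub>R axis i 1))"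
    using pairing_sum[OF BV_D(1)[OF u], of UNIV "\<lambda>i x. (\<phi> x $ i) *\<^sub>R axis i 1"] dir by simp
  then show ?thesis by (simp add: BV_gradient(2)[OF u comp] sum_negf)
qed

text \<open>One inequality holds because fields of test functions are admissible in the total
  variation. For the other, a field in \<open>C0\<close> is approximated componentwise with smaller
  absolute values, so that its Euclidean norm stays at most \<open>1\<close>.\<close>

lemma total_variation_BV_gradient:
  assumes u: "u \<in> BV \<Omega>"
  shows "total_variation \<Omega> (BV_gradient \<Omega> u) = BV_seminorm \<Omega> u"
proof (rule antisym)
  let ?\<mu> = "BV_gradient \<Omega> u"
  note \<mu> = BV_gradient(1)[OF u]
  show "BV_seminorm \<Omega> u \<le> total_variation \<Omega> ?\<mu>"
    unfolding BV_seminorm_def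
  proof (rule cSup_least)
    show "BV_values \<Omega> u \<noteq> {}" using zero_in_BV_values by blast
    fix y assume "y \<in> BV_values \<Omega> u"
    then obtain \<phi> where \<phi>: "\<phi> \<in> test_functions \<Omega>" "\<And>x. x \<in> \<Omega> \<Longrightarrow> norm (\<phi> x) \<le> 1" and y: "y = pairing u \<phi>"
      by (auto simp: BV_values_def pairing_def)
    have m: "(\<lambda>x. (-1) *\<^sub>R \<phi> x) \<in> test_functions \<Omega>" by (rule test_functions_scale[OF \<phi>(1)])
    have "y = (\<Sum>i\<in>UNIV. ?\<mu> i (\<lambda>x. ((-1) *\<^sub>R \<phi> x) $ i))"
      unfolding BV_gradient_sum_test[OF u m] pairing_scale[OF \<phi>(1)] y by simp
    also have "\<dots> \<le> total_variation \<Omega> ?\<mu>"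
      by (rule total_variation_upper[OF \<mu> test_functions_C0[OF component_test_functions[OF m]]]) (use \<phi>(2) in simp)
    finally show "y \<le> total_variation \<Omega> ?\<mu>" .
  qed
  show "total_variation \<Omega> ?\<mu> \<le> BV_seminorm \<Omega> u"
  proof (rule total_variation_least, rule field_le_epsilon)
    fix \<phi> :: "real ^ 'n \<Rightarrow> real ^ 'n" and e :: real
    assume \<phi>: "\<And>i. (\<lambda>x. \<phi> x $ i) \<in> C0 \<Omega>" "\<And>x. norm (\<phi> x) \<le> 1" and "e > 0"
    have "\<forall>i. \<exists>C\<ge>0. \<forall>\<phi> B. \<phi> \<in> C0 \<Omega> \<longrightarrow> (\<forall>x. \<bar>\<phi> x\<bar> \<le> B) \<longrightarrow> \<bar>?\<mu> i \<phi>\<bar> \<le> C * B"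
      using real_measures_bound[OF vector_measures_D[OF \<mu>]] by metis
    then obtain C where C: "\<And>i. 0 \<le> C i" "\<And>i \<phi> B. \<phi> \<in> C0 \<Omega> \<Longrightarrow> (\<forall>x. \<bar>\<phi> x\<bar> \<le> B) \<Longrightarrow> \<bar>?\<mu> i \<phi>\<bar> \<le> C i * B"
      by metis
    \<comment> \<open>With this choice the continuity errors of all components of the gradient add
      up to at most \<open>e\<close>.\<close>
    define \<delta> where "\<delta> = e / ((\<Sum>i\<in>UNIV. C i) + 1)"
    have "(\<Sum>i\<in>UNIV. C i) + 1 > 0" using C(1) by (simp add: add_nonneg_pos sum_nonneg)
    then have \<delta>: "\<delta> > 0" "\<delta> * ((\<Sum>i\<in>UNIV. C i) + 1) = e" using \<open>e > 0\<close> by (simp_all add: \<delta>_def)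
    have "\<forall>i. \<exists>\<psi>\<in>test_functions \<Omega>. \<forall>x. \<bar>\<psi> x\<bar> \<le> \<bar>\<phi> x $ i\<bar> \<and> \<bar>\<psi> x - \<phi> x $ i\<bar> \<le> \<delta>"
      using test_functions_dense[OF open_\<Omega> bounded_\<Omega> \<phi>(1) \<delta>(1)] by blast
    then obtain \<psi> where \<psi>: "\<And>i. \<psi> i \<in> test_functions \<Omega>" "\<And>i x. \<bar>\<psi> i x\<bar> \<le> \<bar>\<phi> x $ i\<bar>"
      "\<And>i x. \<bar>\<psi> i x - \<phi> x $ i\<bar> \<le> \<delta>" by metis
    define \<Psi> :: "real ^ 'n \<Rightarrow> real ^ 'n" where "\<Psi> x = (\<Sum>i\<in>UNIV. \<psi> i x *\<^sub>R axis i 1)" for x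
    have \<Psi>: "\<Psi> \<in> test_functions \<Omega>"
      unfolding \<Psi>_def[abs_def] by (rule test_functions_sum[OF scaleR_test_functions[OF \<psi>(1)]])
    have \<Psi>_nth: "\<Psi> x $ i = \<psi> i x" for x i
      by (simp add: \<Psi>_def axis_def if_distrib cong: if_cong)
    have "norm (\<Psi> x) \<le> norm (\<phi> x)" for x
      by (rule norm_le_componentwise_cart) (simp add: \<Psi>_nth \<psi>(2))
    then have \<Psi>1: "norm ((-1) *\<^sub>R \<Psi> x) \<le> 1" for x using \<phi>(2)[of x] order_trans by fastforce
    have "?\<mu> i (\<lambda>x. \<phi> x $ i) \<le> ?\<mu> i (\<lambda>x. \<Psi> x $ i) + C i * \<delta>" for i
    proof -
      have \<psi>0: "\<psi> i \<in> C0 \<Omega>" by (rule test_functions_C0[OF \<psi>(1)])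
      have d: "(\<lambda>x. \<psi> i x - \<phi> x $ i) \<in> C0 \<Omega>"
        using C0_add[OF \<psi>0 C0_scale[OF \<phi>(1)[of i], of "-1"]] by simp
      have "\<bar>?\<mu> i (\<psi> i) - ?\<mu> i (\<lambda>x. \<phi> x $ i)\<bar> \<le> C i * \<delta>"
        using C(2)[OF d, of \<delta>] \<psi>(3)[of i] real_measures_diff[OF vector_measures_D[OF \<mu>] \<psi>0 \<phi>(1)[of i]] by simp
      then show ?thesis by (simp add: \<Psi>_nth)
    qed
    then have "(\<Sum>i\<in>UNIV. ?\<mu> i (\<lambda>x. \<phi> x $ i)) \<le> (\<Sum>i\<in>UNIV. ?\<mu> i (\<lambda>x. \<Psi> x $ i) + C i * \<delta>)"
      by (intro sum_mono)
    also have "\<dots> = - pairing u \<Psi> + (\<Sum>i\<in>UNIV. C i) * \<delta>"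
      by (simp add: sum.distrib BV_gradient_sum_test[OF u \<Psi>] sum_distrib_right)
    also have "- pairing u \<Psi> = pairing u (\<lambda>x. (-1) *\<^sub>R \<Psi> x)" unfolding pairing_scale[OF \<Psi>] by simp
    also have "\<dots> \<le> 1 * BV_seminorm \<Omega> u"
      by (rule pairing_le_BV_seminorm[OF u test_functions_scale[OF \<Psi>] _ \<Psi>1]) simp
    also have "(\<Sum>i\<in>UNIV. C i) * \<delta> \<le> e" using \<delta> by (simp add: algebra_simps)
    finally show "(\<Sum>i\<in>UNIV. ?\<mu> i (\<lambda>x. \<phi> x $ i)) \<le> BV_seminorm \<Omega> u + e" by simp
  qed
qed

end

section \<open>Exact penalization and optimality conditions\<close>

text \<open>For \<open>a \<le> b\<close> this is the distance from \<open>t\<close> to the interval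
  between \<open>a\<close> and \<open>b\<close>.\<close>

definition excess :: "real \<Rightarrow> real \<Rightarrow> real \<Rightarrow> real" where
  "excess a b t = max 0 (max (a - t) (t - b))"

lemma excess_measurable [measurable]: "excess a b \<in> borel_measurable borel"
  unfolding excess_def[abs_def] by measurable

lemma excess_nonneg: "0 \<le> excess a b t"
  by (simp add: excess_def)

lemma excess_eq_0: "a \<le> t \<Longrightarrow> t \<le> b \<Longrightarrow> excess a b t = 0"
  by (simp add: excess_def)

lemma clip_diff_le_excess: "a \<le> b \<Longrightarrow> \<bar>clip a b t - t\<bar> \<le> excess a b t"
  by (auto simp: clip_def excess_def)

lemma clip_between: "a \<le> b \<Longrightarrow> a \<le> clip a b t \<and> clip a b t \<le> b"
  by (auto simp: clip_def)

lemma excess_convex: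
  assumes "0 \<le> p" "0 \<le> q" "p + q = 1"
  shows "excess a b (p * s + q * t) \<le> p * excess a b s + q * excess a b t"
proof -
  have "p * (a - s) \<le> p * excess a b s" "q * (a - t) \<le> q * excess a b t"
    "p * (s - b) \<le> p * excess a b s" "q * (t - b) \<le> q * excess a b t"
    using assms by (auto intro!: mult_left_mono simp: excess_def)
  moreover have "p * c + q * c = c" for c using assms(3) by (metis distrib_right mult_1)
  then have "p * (a - s) + q * (a - t) = a - (p * s + q * t)"
    "p * (s - b) + q * (t - b) = (p * s + q * t) - b"
    unfolding right_diff_distrib by (simp_all add: algebra_simps)
  moreover have "0 \<le> p * excess a b s + q * excess a b t"
    using assms excess_nonneg by simp
  ultimately show ?thesis unfolding excess_def[of a b "p * s + q * t"] by simp
qed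

lemma excess_add_le: "a \<le> t \<Longrightarrow> t \<le> b \<Longrightarrow> excess a b (t + h) \<le> \<bar>h\<bar>"
  by (auto simp: excess_def)

section \<open>First-order condition, penalty and multipliers\<close>

context bounded_open
begin

lemma L2_dominated:
  assumes v: "v \<in> L2 \<Omega>" and u: "u \<in> borel_measurable (lebesgue_on \<Omega>)"
    and le: "AE x in lebesgue_on \<Omega>. \<bar>u x\<bar> \<le> \<bar>v x\<bar>"
  shows "u \<in> L2 \<Omega>"
proof -
  have "integrable (lebesgue_on \<Omega>) (\<lambda>x. (u x)\<^sup>2)"
    by (rule Bochner_Integration.integrable_bound[OF L2_D(2)[OF v]])
      (use u le in \<open>auto elim!: eventually_mono simp: abs_le_square_iff\<close>)
  then show ?thesis using u by (simp add: L2_def)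
qed

lemma L2_const: "(\<lambda>_. c) \<in> L2 \<Omega>"
  by (rule L2_bounded[of _ "\<bar>c\<bar>"]) auto

lemma subspace_L2: "subspace (L2 \<Omega>)"
  by (rule subspaceI) (auto simp: plus_fun_def scaleR_fun_def zero_fun_def L2_const L2_add L2_scale)

lemma L2_excess:
  assumes u: "u \<in> L2 \<Omega>"
  shows "(\<lambda>x. excess a b (u x)) \<in> L2 \<Omega>"
proof (rule L2_dominated)
  show "(\<lambda>x. \<bar>u x\<bar> + (\<bar>a\<bar> + \<bar>b\<bar>)) \<in> L2 \<Omega>" by (intro L2_add L2_abs L2_const u)
  show "(\<lambda>x. excess a b (u x)) \<in> borel_measurable (lebesgue_on \<Omega>)"
    using measurable_compose[OF L2_D(1)[OF u] excess_measurable] .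
  show "AE x in lebesgue_on \<Omega>. \<bar>excess a b (u x)\<bar> \<le> \<bar>\<bar>u x\<bar> + (\<bar>a\<bar> + \<bar>b\<bar>)\<bar>"
    by (intro AE_I2) (auto simp: excess_def)
qed

text \<open>The Riesz theorem supplies a witness, so the choice in \<open>L2_gradient\<close> is
  meaningful.\<close>

lemma L2_gradient_Riesz:
  assumes "L2_continuously_differentiable \<Omega> f" and u: "u \<in> L2 \<Omega>"
  shows "L2_gradient \<Omega> f u \<in> L2 \<Omega>" "L2_has_derivative \<Omega> f (L2_inner \<Omega> (L2_gradient \<Omega> f u)) u"
proof -
  obtain D where D: "L2_has_derivative \<Omega> f D u"
    using assms unfolding L2_continuously_differentiable_def by blast
  then have "bounded_linear_functional (L2 \<Omega>) (L2_norm \<Omega>) D" by (simp add: L2_has_derivative_def)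
  then obtain g where g: "g \<in> L2 \<Omega>" "\<And>h. h \<in> L2 \<Omega> \<Longrightarrow> D h = L2_inner \<Omega> g h"
    using L2_Riesz by blast
  have "bounded_linear_functional (L2 \<Omega>) (L2_norm \<Omega>) (L2_inner \<Omega> g)"
    unfolding bounded_linear_functional_def
    using L2_inner_add_right[OF _ _ g(1)] L2_inner_scale_right L2_Cauchy_Schwarz[OF g(1)] by blast
  then have "g \<in> L2 \<Omega> \<and> L2_has_derivative \<Omega> f (L2_inner \<Omega> g) u"
    using D g by (simp add: L2_has_derivative_def)
  then have "L2_gradient \<Omega> f u \<in> L2 \<Omega> \<and> L2_has_derivative \<Omega> f (L2_inner \<Omega> (L2_gradient \<Omega> f u)) u"
    unfolding L2_gradient_def by (rule someI[where P = "\<lambda>g. g \<in> L2 \<Omega> \<and> L2_has_derivative \<Omega> f (L2_inner \<Omega> g) u"])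
  then show "L2_gradient \<Omega> f u \<in> L2 \<Omega>" "L2_has_derivative \<Omega> f (L2_inner \<Omega> (L2_gradient \<Omega> f u)) u"
    by blast+
qed

text \<open>Test optimality along the segment from \<open>ubar\<close> to \<open>v\<close> and
  divide by its parameter \<open>t\<close>; the seminorm needs no derivative since it is convex on
  the segment.\<close>

lemma first_order_condition:
  assumes f: "L2_has_derivative \<Omega> f (L2_inner \<Omega> g) ubar"
    and opt: "locally_optimal \<Omega> ua ub f ubar" and v: "v \<in> U_ad \<Omega> ua ub \<inter> BV \<Omega>"
  shows "0 \<le> L2_inner \<Omega> g (\<lambda>x. v x - ubar x) + BV_seminorm \<Omega> v - BV_seminorm \<Omega> ubar"
proof (rule field_le_epsilon)
  fix e :: real assume "e > 0"
  let ?h = "\<lambda>x. v x - ubar x"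
  obtain r where r: "r > 0" and ubar: "ubar \<in> U_ad \<Omega> ua ub" "ubar \<in> BV \<Omega>"
    and min: "\<And>u. u \<in> U_ad \<Omega> ua ub \<inter> BV \<Omega> \<Longrightarrow>
        BV_norm \<Omega> (\<lambda>x. u x - ubar x) + L2_norm \<Omega> (\<lambda>x. u x - ubar x) < r \<Longrightarrow>
        cost \<Omega> f ubar \<le> cost \<Omega> f u"
    using opt unfolding locally_optimal_def by blast
  have L2: "ubar \<in> L2 \<Omega>" "v \<in> L2 \<Omega>" using ubar v by (auto simp: U_ad_def)
  have h: "?h \<in> L2 \<Omega>" by (rule L2_diff[OF L2(2,1)])
  have hBV: "?h \<in> BV \<Omega>"
    using BV_linear_combination(1)[of v ubar 1 "-1"] v ubar(2) by simp
  define N where "N = BV_norm \<Omega> ?h + L2_norm \<Omega> ?h"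
  have "0 \<le> BV_norm \<Omega> ?h" using BV_seminorm_nonneg[OF hBV] by (simp add: BV_norm_def)
  then have N: "0 \<le> N" "L2_norm \<Omega> ?h \<le> N" using L2_norm_nonneg[of \<Omega> ?h] by (auto simp: N_def)
  \<comment> \<open>After division by \<open>t\<close> the remainder of \<open>f\<close> is at most
    \<open>\<epsilon> * N\<close>, hence at most \<open>e\<close>.\<close>
  define \<epsilon> where "\<epsilon> = e / (N + 1)"
  have \<epsilon>: "\<epsilon> > 0" "\<epsilon> * (N + 1) = e" using N(1) \<open>e > 0\<close> by (simp_all add: \<epsilon>_def)
  obtain \<delta> where \<delta>: "\<delta> > 0" and der: "\<And>k. k \<in> L2 \<Omega> \<Longrightarrow> L2_norm \<Omega> k < \<delta> \<Longrightarrow>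
      \<bar>f (\<lambda>x. ubar x + k x) - f ubar - L2_inner \<Omega> g k\<bar> \<le> \<epsilon> * L2_norm \<Omega> k"
    using f \<epsilon>(1) unfolding L2_has_derivative_def by blast
  \<comment> \<open>The bound \<open>1\<close> is for convex combinations, \<open>r\<close> puts the
    competitor into the neighbourhood of optimality, and \<open>\<delta>\<close> into the range of
    the derivative estimate.\<close>
  have "min 1 (min r \<delta> / (N + 1)) > 0" using r \<delta> N(1) by simp
  then obtain t where "0 < t" "t < min 1 (min r \<delta> / (N + 1))" using dense by blast
  then have t: "0 < t" "t \<le> 1" "t < min r \<delta> / (N + 1)" by simp_all
  from t(3) have "t * (N + 1) < min r \<delta>" using N(1) by (simp add: pos_less_divide_eq)
  then have tN: "t * N < r" "t * N < \<delta>" using t(1) by (simp_all add: algebra_simps)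
  let ?u = "\<lambda>x. ubar x + t * ?h x"
  have u_eq: "?u = (\<lambda>x. (1 - t) * ubar x + t * v x)" by (simp add: algebra_simps)
  have uBV: "?u \<in> BV \<Omega>" unfolding u_eq by (rule BV_linear_combination(1)) (use v ubar in auto)
  have semi: "BV_seminorm \<Omega> ?u \<le> (1 - t) * BV_seminorm \<Omega> ubar + t * BV_seminorm \<Omega> v"
    unfolding u_eq using BV_linear_combination(2)[of ubar v "1 - t" t] v ubar t by simp
  have "AE x in lebesgue_on \<Omega>. ua \<le> ?u x \<and> ?u x \<le> ub"
  proof -
    have "AE x in lebesgue_on \<Omega>. ua \<le> ubar x \<and> ubar x \<le> ub" "AE x in lebesgue_on \<Omega>. ua \<le> v x \<and> v x \<le> ub"
      using ubar v by (auto simp: U_ad_def)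
    then show ?thesis
    proof eventually_elim
      case (elim x)
      have "(1 - t) * ua + t * ua \<le> (1 - t) * ubar x + t * v x"
        "(1 - t) * ubar x + t * v x \<le> (1 - t) * ub + t * ub"
        using elim t by (auto intro!: add_mono mult_left_mono)
      then show ?case by (simp add: algebra_simps)
    qed
  qed
  then have "?u \<in> U_ad \<Omega> ua ub \<inter> BV \<Omega>"
    using uBV L2_add[OF L2(1) L2_scale[OF h]] by (simp add: U_ad_def)
  moreover have "BV_norm \<Omega> (\<lambda>x. ?u x - ubar x) + L2_norm \<Omega> (\<lambda>x. ?u x - ubar x) < r"
  proof -
    have "BV_seminorm \<Omega> (\<lambda>x. t * ?h x) \<le> t * BV_seminorm \<Omega> ?h"
      using BV_linear_combination(2)[OF hBV hBV, of t 0] t(1) by simp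
    then have "BV_norm \<Omega> (\<lambda>x. t * ?h x) \<le> t * BV_norm \<Omega> ?h"
      using t(1) by (simp add: BV_norm_def abs_mult distrib_left)
    then have "BV_norm \<Omega> (\<lambda>x. t * ?h x) + L2_norm \<Omega> (\<lambda>x. t * ?h x) \<le> t * N"
      using t(1) by (simp add: L2_norm_scale N_def distrib_left)
    then show ?thesis using tN(1) by simp
  qed
  ultimately have "cost \<Omega> f ubar \<le> cost \<Omega> f ?u" by (rule min)
  then have "0 \<le> f ?u - f ubar + t * (BV_seminorm \<Omega> v - BV_seminorm \<Omega> ubar)"
    using semi by (simp add: cost_def algebra_simps)
  moreover have "f ?u - f ubar \<le> t * L2_inner \<Omega> g ?h + t * (\<epsilon> * N)"
  proof -
    have tn: "L2_norm \<Omega> (\<lambda>x. t * ?h x) \<le> t * N"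
      using N(2) t(1) by (simp add: L2_norm_scale)
    have "\<bar>f ?u - f ubar - L2_inner \<Omega> g (\<lambda>x. t * ?h x)\<bar> \<le> \<epsilon> * L2_norm \<Omega> (\<lambda>x. t * ?h x)"
      using tn tN(2) by (intro der L2_scale h) simp
    also have "\<dots> \<le> \<epsilon> * (t * N)" using tn \<epsilon>(1) by (intro mult_left_mono) auto
    finally show ?thesis by (simp add: L2_inner_scale_right mult.left_commute abs_le_iff)
  qed
  ultimately have "0 \<le> t * (L2_inner \<Omega> g ?h + BV_seminorm \<Omega> v - BV_seminorm \<Omega> ubar + \<epsilon> * N)"
    by (simp add: algebra_simps)
  then have "0 \<le> L2_inner \<Omega> g ?h + BV_seminorm \<Omega> v - BV_seminorm \<Omega> ubar + \<epsilon> * N"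
    using t(1) by (simp add: zero_le_mult_iff)
  then show "0 \<le> L2_inner \<Omega> g ?h + BV_seminorm \<Omega> v - BV_seminorm \<Omega> ubar + e"
    using \<epsilon> by (simp add: distrib_left)
qed

lemma exact_penalty:
  assumes "ua \<le> ub" and g: "g \<in> L2 \<Omega>" and ubar: "ubar \<in> L2 \<Omega>"
    and first_order: "\<And>v. v \<in> U_ad \<Omega> ua ub \<inter> BV \<Omega> \<Longrightarrow>
      0 \<le> L2_inner \<Omega> g (\<lambda>x. v x - ubar x) + BV_seminorm \<Omega> v - BV_seminorm \<Omega> ubar"
    and v: "v \<in> BV \<Omega>" "v \<in> L2 \<Omega>"
  shows "0 \<le> L2_inner \<Omega> g (\<lambda>x. v x - ubar x) + BV_seminorm \<Omega> v - BV_seminorm \<Omega> ubar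
    + (LINT x|lebesgue_on \<Omega>. \<bar>g x\<bar> * excess ua ub (v x))"
proof -
  let ?w = "\<lambda>x. clip ua ub (v x)"
  have w: "?w \<in> L2 \<Omega>"
    using clip_measurable_lebesgue_on[OF L2_D(1)[OF v(2)]] clip_bounded
    by (intro L2_bounded[of _ "\<bar>ua\<bar> + \<bar>ub\<bar>"]) auto
  have "?w \<in> U_ad \<Omega> ua ub \<inter> BV \<Omega>"
    using w BV_clip(1)[OF v(1)] clip_between[OF assms(1)] by (auto simp: U_ad_def)
  from first_order[OF this] BV_clip(2)[OF v(1), of ua ub]
  have "0 \<le> L2_inner \<Omega> g (\<lambda>x. ?w x - ubar x) + BV_seminorm \<Omega> v - BV_seminorm \<Omega> ubar" by linarith
  moreover have "L2_inner \<Omega> g (\<lambda>x. ?w x - ubar x) = L2_inner \<Omega> g (\<lambda>x. v x - ubar x) + L2_inner \<Omega> g (\<lambda>x. ?w x - v x)"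
    using L2_inner_add_right[OF L2_diff[OF v(2) ubar] L2_diff[OF w v(2)] g] by (simp add: algebra_simps)
  moreover have "L2_inner \<Omega> g (\<lambda>x. ?w x - v x) \<le> (LINT x|lebesgue_on \<Omega>. \<bar>g x\<bar> * excess ua ub (v x))"
    unfolding L2_inner_def
  proof (rule integral_mono)
    fix x
    have "g x * (?w x - v x) \<le> \<bar>g x\<bar> * \<bar>?w x - v x\<bar>" using abs_ge_self[of "g x * (?w x - v x)"] by (simp add: abs_mult)
    also have "\<dots> \<le> \<bar>g x\<bar> * excess ua ub (v x)"
      using clip_diff_le_excess[OF assms(1)] by (intro mult_left_mono) auto
    finally show "g x * (?w x - v x) \<le> \<bar>g x\<bar> * excess ua ub (v x)" .
  qed (intro L2_mult_integrable L2_abs L2_excess L2_diff g v w)+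
  ultimately show ?thesis by linarith
qed

text \<open>The penalty vanishes if \<open>ubar + h\<close> is admissible, so
  \<open>(p, h) \<le> 0\<close> for such \<open>h\<close>. Take the \<open>h\<close> that moves
  \<open>ubar\<close> to \<open>ua\<close> exactly where \<open>p < 0\<close>, or to
  \<open>ub\<close> exactly where \<open>p > 0\<close>: then \<open>p * h\<close> is nonnegative, so
  its integral is zero, and up to sign it is the complementarity product.\<close>

lemma KKT_split:
  assumes "ua \<le> ub" and g: "g \<in> L2 \<Omega>" and p: "p \<in> L2 \<Omega>"
    and ubar: "ubar \<in> U_ad \<Omega> ua ub"
    and le: "\<And>h. h \<in> L2 \<Omega> \<Longrightarrow> L2_inner \<Omega> p h \<le> (LINT x|lebesgue_on \<Omega>. \<bar>g x\<bar> * excess ua ub (ubar x + h x))"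
  shows "L2_inner \<Omega> (\<lambda>x. max 0 (- p x)) (\<lambda>x. ua - ubar x) = 0"
    "L2_inner \<Omega> (\<lambda>x. max 0 (p x)) (\<lambda>x. ubar x - ub) = 0"
proof -
  have uL2: "ubar \<in> L2 \<Omega>" and bounds: "AE x in lebesgue_on \<Omega>. ua \<le> ubar x \<and> ubar x \<le> ub"
    using ubar by (auto simp: U_ad_def)
  have [measurable]: "p \<in> borel_measurable (lebesgue_on \<Omega>)" "ubar \<in> borel_measurable (lebesgue_on \<Omega>)"
    using L2_D(1) p uL2 by auto
  have nonpos: "L2_inner \<Omega> p h \<le> 0"
    if h: "h \<in> L2 \<Omega>" and "AE x in lebesgue_on \<Omega>. ua \<le> ubar x + h x \<and> ubar x + h x \<le> ub" for h
  proof -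
    have "(LINT x|lebesgue_on \<Omega>. \<bar>g x\<bar> * excess ua ub (ubar x + h x)) = 0"
      by (rule integral_eq_zero_AE, rule eventually_mono[OF that(2)]) (simp add: excess_eq_0)
    then show ?thesis using le[OF h] by simp
  qed
  have dom: "(\<lambda>x. if Q x then c - ubar x else 0) \<in> L2 \<Omega>"
    if [measurable]: "Measurable.pred (lebesgue_on \<Omega>) Q" for Q and c :: real
    by (rule L2_dominated[OF L2_diff[OF L2_const[of c] uL2]]) auto
  have "L2_inner \<Omega> (\<lambda>x. max 0 (- p x)) (\<lambda>x. ua - ubar x) = - L2_inner \<Omega> p (\<lambda>x. if p x < 0 then ua - ubar x else 0)"
    unfolding L2_inner_def Bochner_Integration.integral_minus[symmetric]
    by (rule Bochner_Integration.integral_cong) (auto simp: max_def)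
  moreover have "L2_inner \<Omega> p (\<lambda>x. if p x < 0 then ua - ubar x else 0) \<le> 0"
    by (rule nonpos[OF dom], measurable, rule eventually_mono[OF bounds]) (use \<open>ua \<le> ub\<close> in auto)
  moreover have "L2_inner \<Omega> p (\<lambda>x. if p x < 0 then ua - ubar x else 0) \<ge> 0"
    unfolding L2_inner_def
    by (rule integral_nonneg_AE, rule eventually_mono[OF bounds]) (auto simp: mult_nonpos_nonpos)
  ultimately show "L2_inner \<Omega> (\<lambda>x. max 0 (- p x)) (\<lambda>x. ua - ubar x) = 0" by simp
  have "L2_inner \<Omega> (\<lambda>x. max 0 (p x)) (\<lambda>x. ubar x - ub) = - L2_inner \<Omega> p (\<lambda>x. if p x > 0 then ub - ubar x else 0)"
    unfolding L2_inner_def Bochner_Integration.integral_minus[symmetric]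
    by (rule Bochner_Integration.integral_cong) (auto simp: max_def algebra_simps)
  moreover have "L2_inner \<Omega> p (\<lambda>x. if p x > 0 then ub - ubar x else 0) \<le> 0"
    by (rule nonpos[OF dom], measurable, rule eventually_mono[OF bounds]) (use \<open>ua \<le> ub\<close> in auto)
  moreover have "L2_inner \<Omega> p (\<lambda>x. if p x > 0 then ub - ubar x else 0) \<ge> 0"
    unfolding L2_inner_def
    by (rule integral_nonneg_AE, rule eventually_mono[OF bounds]) auto
  ultimately show "L2_inner \<Omega> (\<lambda>x. max 0 (p x)) (\<lambda>x. ubar x - ub) = 0" by simp
qed

text \<open>Both arguments are increments from \<open>\<mu>\<close> and \<open>ubar\<close>, so that
  a linear minorant restricted to pairs \<open>(\<nu>, 0)\<close> is a subgradient at
  \<open>\<mu>\<close> whenever the penalty vanishes at \<open>ubar\<close>.\<close>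

definition penalized :: "('n \<Rightarrow> (real ^ 'n \<Rightarrow> real) \<Rightarrow> real) \<Rightarrow> (real ^ 'n \<Rightarrow> real) \<Rightarrow> real \<Rightarrow> real \<Rightarrow>
    (real ^ 'n \<Rightarrow> real) \<Rightarrow> (('n \<Rightarrow> (real ^ 'n \<Rightarrow> real) \<Rightarrow> real) \<times> (real ^ 'n \<Rightarrow> real)) \<Rightarrow> real" where
  "penalized \<mu> g ua ub ubar = (\<lambda>(\<nu>, h). total_variation \<Omega> (\<mu> + \<nu>) - total_variation \<Omega> \<mu>
    + (LINT x|lebesgue_on \<Omega>. \<bar>g x\<bar> * excess ua ub (ubar x + h x)))"

lemma penalized_convex:
  assumes \<mu>: "\<mu> \<in> vector_measures \<Omega>" and g: "g \<in> L2 \<Omega>" and ubar: "ubar \<in> L2 \<Omega>"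
  shows "convex_on (vector_measures \<Omega> \<times> L2 \<Omega>) (penalized \<mu> g ua ub ubar)"
  unfolding convex_on_def
proof (intro conjI ballI allI impI)
  show "convex (vector_measures \<Omega> \<times> L2 \<Omega>)"
    by (intro convex_Times subspace_imp_convex subspace_vector_measures subspace_L2)
next
  fix y z and s t :: real
  assume "y \<in> vector_measures \<Omega> \<times> L2 \<Omega>" "z \<in> vector_measures \<Omega> \<times> L2 \<Omega>"
    and st: "0 \<le> s" "0 \<le> t" "s + t = 1"
  then obtain \<nu> h \<rho> k where y: "y = (\<nu>, h)" "\<nu> \<in> vector_measures \<Omega>" "h \<in> L2 \<Omega>"
    and z: "z = (\<rho>, k)" "\<rho> \<in> vector_measures \<Omega>" "k \<in> L2 \<Omega>" by blast
  have "\<mu> + (s *\<^sub>R \<nu> + t *\<^sub>R \<rho>) = s *\<^sub>R (\<mu> + \<nu>) + t *\<^sub>R (\<mu> + \<rho>)"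
    using st(3) by (simp add: scaleR_add_right algebra_simps flip: scaleR_add_left)
  then have tv: "total_variation \<Omega> (\<mu> + (s *\<^sub>R \<nu> + t *\<^sub>R \<rho>))
      \<le> s * total_variation \<Omega> (\<mu> + \<nu>) + t * total_variation \<Omega> (\<mu> + \<rho>)"
    using total_variation_linear_combination[of "\<mu> + \<nu>" "\<mu> + \<rho>" s t] st
      subspace_add[OF subspace_vector_measures \<mu>] y(2) z(2) by simp
  have int: "integrable (lebesgue_on \<Omega>) (\<lambda>x. \<bar>g x\<bar> * excess ua ub (ubar x + h x))" if "h \<in> L2 \<Omega>" for h
    by (intro L2_mult_integrable L2_abs g L2_excess L2_add ubar that)
  have "(LINT x|lebesgue_on \<Omega>. \<bar>g x\<bar> * excess ua ub (ubar x + (s * h x + t * k x)))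
      \<le> (LINT x|lebesgue_on \<Omega>. s * (\<bar>g x\<bar> * excess ua ub (ubar x + h x)) + t * (\<bar>g x\<bar> * excess ua ub (ubar x + k x)))"
  proof (rule integral_mono)
    show "integrable (lebesgue_on \<Omega>) (\<lambda>x. \<bar>g x\<bar> * excess ua ub (ubar x + (s * h x + t * k x)))"
      by (intro int L2_add L2_scale y z)
    show "integrable (lebesgue_on \<Omega>) (\<lambda>x. s * (\<bar>g x\<bar> * excess ua ub (ubar x + h x)) + t * (\<bar>g x\<bar> * excess ua ub (ubar x + k x)))"
      using int[OF y(3)] int[OF z(3)] by simp
    fix x
    have "ubar x + (s * h x + t * k x) = (s + t) * ubar x + (s * h x + t * k x)" using st(3) by simp
    also have "\<dots> = s * (ubar x + h x) + t * (ubar x + k x)" by (simp add: algebra_simps)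
    finally have "excess ua ub (ubar x + (s * h x + t * k x))
        \<le> s * excess ua ub (ubar x + h x) + t * excess ua ub (ubar x + k x)"
      using excess_convex[OF st] by metis
    from mult_left_mono[OF this abs_ge_zero[of "g x"]]
    show "\<bar>g x\<bar> * excess ua ub (ubar x + (s * h x + t * k x))
        \<le> s * (\<bar>g x\<bar> * excess ua ub (ubar x + h x)) + t * (\<bar>g x\<bar> * excess ua ub (ubar x + k x))"
      by (simp add: algebra_simps)
  qed
  also have "\<dots> = s * (LINT x|lebesgue_on \<Omega>. \<bar>g x\<bar> * excess ua ub (ubar x + h x))
      + t * (LINT x|lebesgue_on \<Omega>. \<bar>g x\<bar> * excess ua ub (ubar x + k x))"
    using int[OF y(3)] int[OF z(3)] by simp
  finally have "penalized \<mu> g ua ub ubar (s *\<^sub>R y + t *\<^sub>R z)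
      \<le> (s * total_variation \<Omega> (\<mu> + \<nu>) + t * total_variation \<Omega> (\<mu> + \<rho>)) - (s + t) * total_variation \<Omega> \<mu>
        + (s * (LINT x|lebesgue_on \<Omega>. \<bar>g x\<bar> * excess ua ub (ubar x + h x))
      + t * (LINT x|lebesgue_on \<Omega>. \<bar>g x\<bar> * excess ua ub (ubar x + k x)))"
    using tv st(3) by (simp add: penalized_def y(1) z(1))
  then show "penalized \<mu> g ua ub ubar (s *\<^sub>R y + t *\<^sub>R z)
      \<le> s * penalized \<mu> g ua ub ubar y + t * penalized \<mu> g ua ub ubar z"
    by (simp add: penalized_def y(1) z(1) algebra_simps)
qed

lemma KKT:
  assumes "ua \<le> ub" and f: "L2_has_derivative \<Omega> f (L2_inner \<Omega> g) ubar" and g: "g \<in> L2 \<Omega>"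
    and opt: "locally_optimal \<Omega> ua ub f ubar"
  shows "\<exists>l \<in> subdifferential \<Omega> (total_variation \<Omega>) (BV_gradient \<Omega> ubar). \<exists>p\<in>L2 \<Omega>.
    dual_div_is \<Omega> l (\<lambda>x. g x + p x) \<and>
    L2_inner \<Omega> (\<lambda>x. max 0 (- p x)) (\<lambda>x. ua - ubar x) = 0 \<and>
    L2_inner \<Omega> (\<lambda>x. max 0 (p x)) (\<lambda>x. ubar x - ub) = 0"
proof -
  have ubar: "ubar \<in> U_ad \<Omega> ua ub" "ubar \<in> BV \<Omega>" "ubar \<in> L2 \<Omega>"
    and bounds: "AE x in lebesgue_on \<Omega>. ua \<le> ubar x \<and> ubar x \<le> ub"
    using opt by (auto simp: locally_optimal_def U_ad_def)
  define \<mu> where "\<mu> = BV_gradient \<Omega> ubar"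
  have \<mu>: "\<mu> \<in> vector_measures \<Omega>" unfolding \<mu>_def by (rule BV_gradient(1)[OF ubar(2)])
  define X where "X = vector_measures \<Omega> \<times> L2 \<Omega>"
  have X: "subspace X" unfolding X_def by (intro subspace_Times subspace_vector_measures subspace_L2)
  let ?\<Phi> = "penalized \<mu> g ua ub ubar"
  define V where "V = BV \<Omega> \<inter> L2 \<Omega>"
  define G where "G = (\<lambda>h. ((BV_gradient \<Omega> h, h), - L2_inner \<Omega> g h)) ` V"
  have V_lin: "(\<lambda>x. a * u x + b * v x) \<in> V"
    and G_lin: "a *\<^sub>R ((BV_gradient \<Omega> u, u), - L2_inner \<Omega> g u) + b *\<^sub>R ((BV_gradient \<Omega> v, v), - L2_inner \<Omega> g v) \<in> G"
    if "u \<in> V" "v \<in> V" for a b u v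
  proof -
    show *: "(\<lambda>x. a * u x + b * v x) \<in> V"
      using that by (auto simp: V_def intro: BV_linear_combination(1) L2_add L2_scale)
    have "L2_inner \<Omega> g (\<lambda>x. a * u x + b * v x) = a * L2_inner \<Omega> g u + b * L2_inner \<Omega> g v"
      using that L2_inner_add_right[OF L2_scale L2_scale g, of u v a b]
      by (simp add: V_def L2_inner_scale_right)
    then have "a *\<^sub>R ((BV_gradient \<Omega> u, u), - L2_inner \<Omega> g u) + b *\<^sub>R ((BV_gradient \<Omega> v, v), - L2_inner \<Omega> g v)
        = ((BV_gradient \<Omega> (\<lambda>x. a * u x + b * v x), \<lambda>x. a * u x + b * v x), - L2_inner \<Omega> g (\<lambda>x. a * u x + b * v x))"
      using that BV_linear_combination(3)[of u v a b]
      by (simp add: V_def fun_eq_iff)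
    then show "a *\<^sub>R ((BV_gradient \<Omega> u, u), - L2_inner \<Omega> g u) + b *\<^sub>R ((BV_gradient \<Omega> v, v), - L2_inner \<Omega> g v) \<in> G"
      using * by (simp add: G_def)
  qed
  have "subspace G"
  proof (rule subspaceI)
    \<comment> \<open>\<open>ubar\<close> itself is the element of \<open>V\<close> from which the
      zero vector is formed.\<close>
    have "0 *\<^sub>R ((BV_gradient \<Omega> ubar, ubar), - L2_inner \<Omega> g ubar) + 0 *\<^sub>R ((BV_gradient \<Omega> ubar, ubar), - L2_inner \<Omega> g ubar) \<in> G"
      by (rule G_lin) (use ubar in \<open>simp_all add: V_def\<close>)
    then show "0 \<in> G" by (simp add: zero_prod_def)
  next
    fix y z assume "y \<in> G" "z \<in> G"
    then obtain u v where "u \<in> V" "v \<in> V" "y = ((BV_gradient \<Omega> u, u), - L2_inner \<Omega> g u)"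
      "z = ((BV_gradient \<Omega> v, v), - L2_inner \<Omega> g v)" by (auto simp: G_def)
    then show "y + z \<in> G" using G_lin[of u v 1 1] by simp
  next
    fix c :: real and y assume "y \<in> G"
    then obtain u where "u \<in> V" "y = ((BV_gradient \<Omega> u, u), - L2_inner \<Omega> g u)" by (auto simp: G_def)
    then show "c *\<^sub>R y \<in> G" using G_lin[of u u c 0] by simp
  qed
  moreover have "(BV_gradient \<Omega> h, h) \<in> X \<and> - L2_inner \<Omega> g h \<le> ?\<Phi> (BV_gradient \<Omega> h, h)" if h: "h \<in> V" for h
  proof
    have h': "h \<in> BV \<Omega>" "h \<in> L2 \<Omega>" using h by (auto simp: V_def)
    then show "(BV_gradient \<Omega> h, h) \<in> X" by (simp add: X_def BV_gradient(1))
    let ?v = "\<lambda>x. ubar x + h x"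
    have v: "?v \<in> BV \<Omega>" "BV_gradient \<Omega> ?v = \<mu> + BV_gradient \<Omega> h"
      using BV_linear_combination(1,3)[OF ubar(2) h'(1), of 1 1] by (simp_all add: \<mu>_def)
    have "0 \<le> L2_inner \<Omega> g (\<lambda>x. ?v x - ubar x) + BV_seminorm \<Omega> ?v - BV_seminorm \<Omega> ubar
        + (LINT x|lebesgue_on \<Omega>. \<bar>g x\<bar> * excess ua ub (?v x))"
      \<comment> \<open>The penalized first-order inequality at \<open>ubar + h\<close>, once
        seminorms are rewritten as total variations of gradients, says that \<open>G\<close> lies
        below the majorant.\<close>
      by (rule exact_penalty[OF \<open>ua \<le> ub\<close> g ubar(3) first_order_condition[OF f opt] v(1) L2_add[OF ubar(3) h'(2)]])
    then show "- L2_inner \<Omega> g h \<le> ?\<Phi> (BV_gradient \<Omega> h, h)"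
      using total_variation_BV_gradient[OF v(1)] total_variation_BV_gradient[OF ubar(2)]
      by (simp add: penalized_def v(2) \<mu>_def)
  qed
  ultimately have "subfunctional_graph X ?\<Phi> G"
    unfolding subfunctional_graph_def by (auto simp: G_def)
  then obtain F where F_le: "\<And>y. y \<in> X \<Longrightarrow> F y \<le> ?\<Phi> y"
    and F_add: "\<And>y z. y \<in> X \<Longrightarrow> z \<in> X \<Longrightarrow> F (y + z) = F y + F z"
    and F_scale: "\<And>y c. y \<in> X \<Longrightarrow> F (c *\<^sub>R y) = c * F y"
    and F_G: "\<And>y a. (y, a) \<in> G \<Longrightarrow> F y = a"
    by (rule Hahn_Banach_convex[OF X penalized_convex[OF \<mu> g ubar(3), of ua ub, folded X_def]]) blast
  define l where "l \<nu> = F (\<nu>, 0)" for \<nu>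
  have X1: "(\<nu>, 0) \<in> X" if "\<nu> \<in> vector_measures \<Omega>" for \<nu>
    using that subspace_0[OF subspace_L2] by (simp add: X_def)
  have X2: "(0, h) \<in> X" if "h \<in> L2 \<Omega>" for h
    using that subspace_0[OF subspace_vector_measures] by (simp add: X_def)
  \<comment> \<open>Admissibility of \<open>ubar\<close> removes the penalty on pairs
    \<open>(\<nu>, 0)\<close> and leaves the subgradient inequality.\<close>
  have pen0: "(LINT x|lebesgue_on \<Omega>. \<bar>g x\<bar> * excess ua ub (ubar x)) = 0"
    by (rule integral_eq_zero_AE, rule eventually_mono[OF bounds]) (simp add: excess_eq_0)
  have l_le: "l \<nu> \<le> total_variation \<Omega> (\<mu> + \<nu>) - total_variation \<Omega> \<mu>" if "\<nu> \<in> vector_measures \<Omega>" for \<nu>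
    using F_le[OF X1[OF that]] pen0 by (simp add: l_def penalized_def)
  have l_scale: "l (c *\<^sub>R \<nu>) = c * l \<nu>" if "\<nu> \<in> vector_measures \<Omega>" for c \<nu>
    using F_scale[OF X1[OF that], of c] by (simp add: l_def)
  have l_add: "l (\<nu> + \<rho>) = l \<nu> + l \<rho>" if "\<nu> \<in> vector_measures \<Omega>" "\<rho> \<in> vector_measures \<Omega>" for \<nu> \<rho>
    using F_add[OF X1[OF that(1)] X1[OF that(2)]] by (simp add: l_def)
  \<comment> \<open>The triangle inequality cancels the shift by \<open>\<mu>\<close>; the factors
    \<open>1\<close> and \<open>-1\<close> then bound \<open>\<bar>l \<nu>\<bar>\<close> by the
    total variation.\<close>
  have l_tv: "c * l \<nu> \<le> \<bar>c\<bar> * total_variation \<Omega> \<nu>" if "\<nu> \<in> vector_measures \<Omega>" for c \<nu>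
  proof -
    have "c * l \<nu> \<le> total_variation \<Omega> (1 *\<^sub>R \<mu> + c *\<^sub>R \<nu>) - total_variation \<Omega> \<mu>"
      using l_le[OF subspace_scale[OF subspace_vector_measures that]] l_scale[OF that] by simp
    then show ?thesis using total_variation_linear_combination[OF \<mu> that, of 1 c] by simp
  qed
  have "\<bar>l \<nu>\<bar> \<le> 1 * total_variation \<Omega> \<nu>" if "\<nu> \<in> vector_measures \<Omega>" for \<nu>
    using l_tv[OF that, of 1] l_tv[OF that, of "-1"] by (simp add: abs_le_iff)
  then have "l \<in> vector_measures_dual \<Omega>"
    using l_add l_scale
    by (auto simp: vector_measures_dual_def plus_fun_def scaleR_fun_def intro!: exI[of _ 1])
  moreover have "total_variation \<Omega> \<mu> + l (\<lambda>i \<phi>. \<nu> i \<phi> - \<mu> i \<phi>) \<le> total_variation \<Omega> \<nu>"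
    if "\<nu> \<in> vector_measures \<Omega>" for \<nu>
  proof -
    have "(\<lambda>i \<phi>. \<nu> i \<phi> - \<mu> i \<phi>) = \<nu> - \<mu>" by (simp add: fun_eq_iff)
    moreover have "\<mu> + (\<nu> - \<mu>) = \<nu>" by simp
    ultimately show ?thesis
      using l_le[OF subspace_diff[OF subspace_vector_measures that \<mu>]] by simp
  qed
  ultimately have l_sub: "l \<in> subdifferential \<Omega> (total_variation \<Omega>) (BV_gradient \<Omega> ubar)"
    by (simp add: subdifferential_def \<mu>_def)
  define \<Lambda> where "\<Lambda> h = F (0, h)" for h
  have \<Lambda>_le: "\<Lambda> h \<le> (LINT x|lebesgue_on \<Omega>. \<bar>g x\<bar> * excess ua ub (ubar x + h x))" if "h \<in> L2 \<Omega>" for h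
    using F_le[OF X2[OF that]] by (simp add: \<Lambda>_def penalized_def)
  have \<Lambda>_add: "\<Lambda> (\<lambda>x. h x + k x) = \<Lambda> h + \<Lambda> k" if "h \<in> L2 \<Omega>" "k \<in> L2 \<Omega>" for h k
    using F_add[OF X2[OF that(1)] X2[OF that(2)]] by (simp add: \<Lambda>_def plus_fun_def[of h k])
  have \<Lambda>_scale: "\<Lambda> (\<lambda>x. c * h x) = c * \<Lambda> h" if "h \<in> L2 \<Omega>" for c h
    using F_scale[OF X2[OF that], of c] by (simp add: \<Lambda>_def scaleR_fun_def[of c h])
  \<comment> \<open>Starting from the admissible \<open>ubar\<close>, an increment \<open>h\<close>
    produces an excess of at most \<open>\<bar>h\<bar>\<close>; Cauchy-Schwarz turns this into
    continuity on \<open>L2\<close>.\<close>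
  have \<Lambda>_bound: "\<Lambda> h \<le> L2_norm \<Omega> g * L2_norm \<Omega> h" if h: "h \<in> L2 \<Omega>" for h
  proof -
    have "\<Lambda> h \<le> (LINT x|lebesgue_on \<Omega>. \<bar>g x\<bar> * excess ua ub (ubar x + h x))" by (rule \<Lambda>_le[OF h])
    also have "\<dots> \<le> (LINT x|lebesgue_on \<Omega>. \<bar>g x\<bar> * \<bar>h x\<bar>)"
    proof (rule integral_mono_AE)
      show "AE x in lebesgue_on \<Omega>. \<bar>g x\<bar> * excess ua ub (ubar x + h x) \<le> \<bar>g x\<bar> * \<bar>h x\<bar>"
        using bounds by eventually_elim (intro mult_left_mono excess_add_le, auto)
    qed (intro L2_mult_integrable L2_abs L2_excess L2_add g h ubar(3))+
    also have "\<dots> \<le> L2_norm \<Omega> g * L2_norm \<Omega> h"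
      using L2_Cauchy_Schwarz[OF L2_abs[OF g] L2_abs[OF h]] by (simp add: L2_inner_def L2_norm_def)
    finally show ?thesis .
  qed
  have "\<bar>\<Lambda> h\<bar> \<le> L2_norm \<Omega> g * L2_norm \<Omega> h" if h: "h \<in> L2 \<Omega>" for h
    using \<Lambda>_bound[OF h] \<Lambda>_bound[OF L2_scale[OF h, of "-1"]] \<Lambda>_scale[OF h, of "-1"] L2_norm_scale[of \<Omega> "-1" h]
    by (simp add: abs_le_iff)
  then have "bounded_linear_functional (L2 \<Omega>) (L2_norm \<Omega>) \<Lambda>"
    using \<Lambda>_add \<Lambda>_scale unfolding bounded_linear_functional_def by blast
  then obtain p where p: "p \<in> L2 \<Omega>" "\<And>h. h \<in> L2 \<Omega> \<Longrightarrow> \<Lambda> h = L2_inner \<Omega> p h"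
    using L2_Riesz by blast
  \<comment> \<open>On the pair formed by the gradient of \<open>h\<close> and \<open>h\<close>, the
    extension equals \<open>- (g, h)\<close> and also splits into \<open>l\<close> of the gradient
    plus \<open>(p, h)\<close>; solving for \<open>l\<close> identifies \<open>div l\<close> with
    \<open>g + p\<close>.\<close>
  have "dual_div \<Omega> l h = L2_inner \<Omega> (\<lambda>x. g x + p x) h" if "h \<in> BV \<Omega> \<inter> L2 \<Omega>" for h
  proof -
    have h: "h \<in> V" "h \<in> L2 \<Omega>" "BV_gradient \<Omega> h \<in> vector_measures \<Omega>"
      using that BV_gradient(1) by (auto simp: V_def)
    have "F (BV_gradient \<Omega> h, h) = - L2_inner \<Omega> g h" by (rule F_G) (use h(1) in \<open>simp add: G_def\<close>)
    moreover have "F (BV_gradient \<Omega> h, h) = l (BV_gradient \<Omega> h) + \<Lambda> h"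
      using F_add[OF X1[OF h(3)] X2[OF h(2)]] by (simp add: l_def \<Lambda>_def)
    ultimately show ?thesis
      using p(2)[OF h(2)] L2_inner_add_left[OF g p(1) h(2)] by (simp add: dual_div_def)
  qed
  then have div: "dual_div_is \<Omega> l (\<lambda>x. g x + p x)"
    using L2_add[OF g p(1)] by (simp add: dual_div_is_def)
  have "L2_inner \<Omega> (\<lambda>x. max 0 (- p x)) (\<lambda>x. ua - ubar x) = 0"
    "L2_inner \<Omega> (\<lambda>x. max 0 (p x)) (\<lambda>x. ubar x - ub) = 0"
    using KKT_split[OF \<open>ua \<le> ub\<close> g p(1) ubar(1)] \<Lambda>_le p(2) by simp_all
  then show ?thesis using l_sub div p(1) by blast
qed

end

theorem theorem4p3:
  fixes \<Omega> :: "(real ^ 'n) set"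
    and ua ub :: real
    and f :: "(real ^ 'n \<Rightarrow> real) \<Rightarrow> real"
    and ubar :: "real ^ 'n \<Rightarrow> real"
  assumes "open \<Omega>" and "bounded \<Omega>" and "lipschitz_boundary \<Omega>"
    and "ua < ub"
    and "L2_well_defined \<Omega> f"
    and "L2_bounded_below \<Omega> f"
    and "L2_weakly_lsc \<Omega> f"
    and "L2_continuously_differentiable \<Omega> f"
    and "\<And>U. (\<And>k. U k \<in> U_ad \<Omega> ua ub) \<Longrightarrow>
           filterlim (\<lambda>k. L2_norm \<Omega> (U k)) at_top sequentially \<Longrightarrow>
           filterlim (\<lambda>k. f (U k)) at_top sequentially"
    and "locally_optimal \<Omega> ua ub f ubar"
  shows "\<exists>l \<in> subdifferential \<Omega> (total_variation \<Omega>) (BV_gradient \<Omega> ubar).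
         \<exists>div_l. dual_div_is \<Omega> l div_l \<and>
         (\<exists>la \<in> L2 \<Omega>. \<exists>lb \<in> L2 \<Omega>.
            (AE x in lebesgue_on \<Omega>. - div_l x - la x + lb x = - L2_gradient \<Omega> f ubar x) \<and>
            (AE x in lebesgue_on \<Omega>. la x \<ge> 0) \<and>
            (AE x in lebesgue_on \<Omega>. lb x \<ge> 0) \<and>
            L2_inner \<Omega> la (\<lambda>x. ua - ubar x) = 0 \<and>
            L2_inner \<Omega> lb (\<lambda>x. ubar x - ub) = 0)"
proof -
  interpret bounded_open \<Omega> using assms(1,2) by (rule bounded_open.intro)
  let ?g = "L2_gradient \<Omega> f ubar"
  have "ubar \<in> L2 \<Omega>" using assms(10) by (auto simp: locally_optimal_def U_ad_def)
  note g = L2_gradient_Riesz[OF assms(8) this]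
  obtain l p where l: "l \<in> subdifferential \<Omega> (total_variation \<Omega>) (BV_gradient \<Omega> ubar)" and p: "p \<in> L2 \<Omega>"
    and div: "dual_div_is \<Omega> l (\<lambda>x. ?g x + p x)"
    and compl: "L2_inner \<Omega> (\<lambda>x. max 0 (- p x)) (\<lambda>x. ua - ubar x) = 0"
      "L2_inner \<Omega> (\<lambda>x. max 0 (p x)) (\<lambda>x. ubar x - ub) = 0"
    using KKT[OF less_imp_le[OF assms(4)] g(2,1) assms(10)] by blast
  have "(\<lambda>x. max 0 (- p x)) \<in> L2 \<Omega>" "(\<lambda>x. max 0 (p x)) \<in> L2 \<Omega>"
    using L2_D(1)[OF p] by (auto intro!: L2_dominated[OF p])
  \<comment> \<open>The multipliers are the negative and positive parts of \<open>p\<close>, whose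
    difference restores \<open>p\<close> and cancels it from the divergence.\<close>
  moreover have "- (?g x + p x) - max 0 (- p x) + max 0 (p x) = - ?g x" for x by simp
  ultimately show ?thesis
    using div compl by (intro bexI[OF _ l] exI[of _ "\<lambda>x. ?g x + p x"] conjI
        bexI[of _ "\<lambda>x. max 0 (- p x)"] bexI[of _ "\<lambda>x. max 0 (p x)"]) simp_all
qed

end
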